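(* Let $r>0$ and let $(X_t)_{t\ge0}$ be the Brownian motion with drift $X_t = X_0+B_t-rt$ ($B$ a standard Brownian motion started at $0$ independent of $X_0$), with $\tau_0:=\inf\{t\ge0:X_t=0\}$. There exists $s_0>0$ such that, for any probability measure $\mu$ on $(0,+\infty)$ satisfying $\int_0^\infty x^4e^{rx}\mu(dx)<+\infty$ and for any $s\ge s_0$, $$0<\liminf_{t\to\infty} t\,\mathcal{W}_1\big(\mathbb{P}_\mu[X_s\in\cdot\mid\tau_0>t],\ \mathbb{Q}_{\eta\circ\mu}[X_s\in\cdot]\big)\le \limsup_{t\to\infty} t\,\mathcal{W}_1\big(\mathbb{P}_\mu[X_s\in\cdot\mid\tau_0>t],\ \mathbb{Q}_{\eta\circ\mu}[X_s\in\cdot]\big)<+\infty.$$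
   Context: $\mathbb{P}_\mu$ is the law of $X$ with $X_0\sim\mu$, and $\mathbb{P}_\mu[X_s\in\cdot\mid\tau_0>t]=\mathbb{P}_\mu[X_s\in\cdot,\tau_0>t]/\mathbb{P}_\mu[\tau_0>t]$. Let $\eta(x) := \frac{1}{r^2}xe^{rx}$ and $\eta\circ\mu(dx) := \frac{\eta(x)\mu(dx)}{\mu(\eta)}$ where $\mu(\eta)=\int\eta\,d\mu$. For $x>0$, $\mathbb{Q}_x$ is the law of the $Q$-process, i.e. the process conditioned never to hit $0$: $\mathbb{Q}_x(\Gamma)=\lim_{T\to\infty}\mathbb{P}_x(\Gamma\mid\tau_0>T)$ for $\Gamma\in\sigma(X_u,u\le t)$; equivalently, under $\mathbb{Q}_x$, $X$ is a Bessel-3 process $dX_t=dW_t+\frac{1}{X_t}dt$ started at $x$, and $\mathbb{E}^{\mathbb{Q}}_x[f(X_t)] = \frac{e^{r^2t/2}}{\eta(x)}\mathbb{E}_x[\eta(X_t)f(X_t)\mathbf{1}_{\tau_0>t}]$. $\mathbb{Q}_{\nu}:=\int\mathbb{Q}_x\,\nu(dx)$. The $1$-Wasserstein distance is $\mathcal{W}_1(\mu,\nu):=\sup_{f\in\mathrm{Lip}_{1,1}(\mathbb{R}_+)}|\mu(f)-\nu(f)|$, where $\mathrm{Lip}_{1,1}(\mathbb{R}_+)$ is the set of $1$-Lipschitz functions $f$ on $\mathbb{R}_+$ with $f(0)=1$. *)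

theory Defs
  imports "HOL-Probability.Probability"
begin

definition std_BM :: "'a measure \<Rightarrow> (real \<Rightarrow> 'a \<Rightarrow> real) \<Rightarrow> bool" where
  "std_BM M B \<longleftrightarrow>
     prob_space M \<and>
     (\<forall>t. B t \<in> borel_measurable M) \<and>
     (\<forall>\<omega>\<in>space M. B 0 \<omega> = 0 \<and> continuous_on {0..} (\<lambda>t. B t \<omega>)) \<and>
     (\<forall>s t. 0 \<le> s \<and> s < t \<longrightarrow>
        distributed M lborel (\<lambda>\<omega>. B t \<omega> - B s \<omega>)
          (\<lambda>x. ennreal (normal_density 0 (sqrt (t - s)) x))) \<and>
     (\<forall>(n::nat) (ts::nat \<Rightarrow> real). 0 \<le> ts 0 \<and> (\<forall>i<n. ts i < ts (Suc i)) \<longrightarrow>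
        prob_space.indep_vars M (\<lambda>_. borel)
          (\<lambda>i \<omega>. B (ts (Suc i)) \<omega> - B (ts i) \<omega>) {..<n})"

definition Xp :: "real \<Rightarrow> ('a \<Rightarrow> real) \<Rightarrow> (real \<Rightarrow> 'a \<Rightarrow> real) \<Rightarrow> real \<Rightarrow> 'a \<Rightarrow> real" where
  "Xp r X0 B t \<omega> = X0 \<omega> + B t \<omega> - r * t"

text \<open>Hitting time of 0 (value \<infinity> if 0 is never hit).\<close>
definition tau0 :: "real \<Rightarrow> ('a \<Rightarrow> real) \<Rightarrow> (real \<Rightarrow> 'a \<Rightarrow> real) \<Rightarrow> 'a \<Rightarrow> ereal" where
  "tau0 r X0 B \<omega> = Inf (ereal ` {t. 0 \<le> t \<and> Xp r X0 B t \<omega> = 0})"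

definition surv :: "'a measure \<Rightarrow> real \<Rightarrow> ('a \<Rightarrow> real) \<Rightarrow> (real \<Rightarrow> 'a \<Rightarrow> real) \<Rightarrow> real \<Rightarrow> 'a set" where
  "surv M r X0 B t = {\<omega>\<in>space M. tau0 r X0 B \<omega> > ereal t}"

definition cond_law :: "'a measure \<Rightarrow> real \<Rightarrow> ('a \<Rightarrow> real) \<Rightarrow> (real \<Rightarrow> 'a \<Rightarrow> real) \<Rightarrow> real \<Rightarrow> real \<Rightarrow> real measure" where
  "cond_law M r X0 B s t = distr (uniform_measure M (surv M r X0 B t)) borel (Xp r X0 B s)"

definition eta :: "real \<Rightarrow> real \<Rightarrow> real" where
  "eta r x = x * exp (r * x) / r\<^sup>2"

text \<open>Law of X_s under Q_{eta o mu}, via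
  E^Q_x[f(X_s)] = e^{r^2 s/2}/eta(x) E_x[eta(X_s) f(X_s) 1_{tau_0>s}], integrated against
  eta o mu (dx) = eta(x) mu(dx) / mu(eta).\<close>
definition Q_law :: "'a measure \<Rightarrow> real \<Rightarrow> ('a \<Rightarrow> real) \<Rightarrow> (real \<Rightarrow> 'a \<Rightarrow> real) \<Rightarrow> real measure \<Rightarrow> real \<Rightarrow> real measure" where
  "Q_law M r X0 B \<mu> s =
     distr (density M (\<lambda>\<omega>. ennreal (exp (r\<^sup>2 * s / 2) / (\<integral>x. eta r x \<partial>\<mu>)
                 * eta r (Xp r X0 B s \<omega>) * indicator (surv M r X0 B s) \<omega>)))
       borel (Xp r X0 B s)"

text \<open>1-Lipschitz functions on R_+ with f(0)=1 (values on negative reals irrelevant).\<close>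
definition Lip11 :: "(real \<Rightarrow> real) set" where
  "Lip11 = {f. f 0 = 1 \<and> (\<forall>x\<ge>0. \<forall>y\<ge>0. \<bar>f x - f y\<bar> \<le> \<bar>x - y\<bar>)}"

definition W1 :: "real measure \<Rightarrow> real measure \<Rightarrow> ereal" where
  "W1 P Q = (SUP f\<in>Lip11. ereal \<bar>(\<integral>x. f x \<partial>P) - (\<integral>x. f x \<partial>Q)\<bar>)"

end

theory Submission
  imports Defs "HOL-Probability.Probability" "HOL-Real_Asymp.Real_Asymp"
begin

text \<open>
  Let \<open>\<nu>\<close> be the law of \<open>X\<^sub>s\<close> on survival up to time \<open>s\<close>. By the Markov property and the reflection
  principle, the law of \<open>X\<^sub>s\<close> given survival up to \<open>t\<close> has a density with respect to \<open>\<nu>\<close> proportional to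
  the survival probability from \<open>y\<close> over a time \<open>T = t - s\<close>, which is a constant depending on \<open>T\<close>
  times \<open>\<eta>(y) (1 - (y\<^sup>2 + c) / (2 T) + o(1/T))\<close>, while the law under the \<open>Q\<close>-process has density
  proportional to \<open>\<eta>\<close>. Hence \<open>t\<close> times the difference of the integrals of \<open>f\<close> tends to
  \<open>- Cov(y\<^sup>2, f) / 2\<close> under the \<open>Q\<close>-law. The third moments of \<open>\<eta> \<nu>\<close> give a bound uniform in \<open>f\<close>, and for
  \<open>f(y) = 1 + y\<close> the covariance is positive as \<open>\<nu>\<close> has no atoms.

  The reflection principle is obtained without stopping times: the extension \<open>h\<close> of a Lipschitz
  function \<open>f\<close> with \<open>f(0) = 0\<close> to the negative reals is chosen such that the expectation of
  \<open>h(X\<^sub>t)\<close> started at 0 vanishes for all \<open>t\<close>; these expectations are Lipschitz in the starting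
  point uniformly in \<open>t\<close>, so paths which come close to 0 at a grid time contribute little.
\<close>

section \<open>The free and the killed semigroup\<close>

text \<open>The fourth moment is a degree count: \<open>eta\<close> carries one power of y besides
  the exponential, a Lipschitz test function a second one, and the correction y^2 / (2 T) two more.
  The constant c is the second moment of the density r^2 z e^(-r z), which splits off from the
  killed transition density at leading order; c does not depend on y, so normalising removes it from
  the covariance.

  \<open>std_BM\<close> speaks of increments along finite time sequences and provides no filtration.
  Killing is therefore done along grids and passes through three limits whose order matters: the
  mesh goes to 0 first, then the margin \<epsilon> above 0, and last the slope q of the ramp goes to
  infinity, because the error left by the first limit is (q + 2 r) \<epsilon>. The ramps are cut off
  at 1, which makes each limit an instance of bounded convergence.

  The normalisation of the Q-law is not computed from Gaussian integrals: survival up to a large t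
  is evaluated from two times, and t \<rightarrow> \<infinity> shows that killing up to time s
  multiplies the mean of \<open>eta\<close> by exp (- r^2 s / 2).\<close>

definition drift_op :: "real \<Rightarrow> (real \<Rightarrow> real) \<Rightarrow> real \<Rightarrow> real \<Rightarrow> real" where
  "drift_op r h t x = (\<integral>z. normal_density 0 (sqrt t) z * h (x + z - r * t) \<partial>lborel)"

text \<open>The negative half is chosen so that \<open>exp (- r * z) * ramp r n z\<close> is odd in \<open>z\<close>: after a
  Girsanov change of measure this is the odd extension used in the reflection principle, and it
  makes \<open>drift_op r (ramp r n) t\<close> vanish at 0.\<close>

definition ramp :: "real \<Rightarrow> nat \<Rightarrow> real \<Rightarrow> real" where
  "ramp r n z = (if z \<ge> 0 then min 1 (real n * z) else - exp (2 * r * z) * min 1 (- real n * z))"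

text \<open>Transition density of the drifted Brownian motion killed at 0, as produced by that extension.\<close>

definition killed_density :: "real \<Rightarrow> real \<Rightarrow> real \<Rightarrow> real \<Rightarrow> real" where
  "killed_density r t y z = normal_density (y - r * t) (sqrt t) z
     - exp (- 2 * r * z) * normal_density (y - r * t) (sqrt t) (- z)"

definition surv_prob :: "real \<Rightarrow> real \<Rightarrow> real \<Rightarrow> real" where
  "surv_prob r t y = (\<integral>z. indicator {0<..} z * killed_density r t y z \<partial>lborel)"

section \<open>The ramp and its Gaussian averages\<close>

lemma ramp_measurable[measurable]: "ramp r n \<in> borel_measurable borel"
  unfolding ramp_def[abs_def] by measurable

lemma ramp_zero[simp]: "ramp r n 0 = 0"
  by (simp add: ramp_def)

lemma abs_ramp_le_1: "r > 0 \<Longrightarrow> \<bar>ramp r n z\<bar> \<le> 1"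
proof -
  assume r: "r > 0"
  show ?thesis
  proof (cases "z \<ge> 0")
    case True
    then show ?thesis by (auto simp: ramp_def min_def)
  next
    case False
    then have "r * z \<le> 0" using r by (simp add: mult_le_0_iff)
    then have "exp (2 * r * z) \<le> 1" by simp
    moreover have "0 \<le> min 1 (- real n * z)" "min 1 (- real n * z) \<le> 1"
      using False by (auto simp: mult_nonneg_nonpos)
    ultimately show ?thesis using False
      by (simp add: ramp_def abs_mult mult_le_one del: mult_minus_left min_def)
  qed
qed

text \<open>The cut-off linear part has slope at most n, and on the left the exponential factor adds
  at most 2 r. Points on opposite sides are compared through 0, where both branches vanish and the
  distances add up.\<close>

lemma ramp_lipschitz:
  assumes r: "r > 0"
  shows "\<bar>ramp r n x - ramp r n y\<bar> \<le> (real n + 2 * r) * \<bar>x - y\<bar>"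
proof -
  let ?L = "real n + 2 * r"
  have expd: "\<bar>exp (2 * r * x) - exp (2 * r * y)\<bar> \<le> 2 * r * \<bar>x - y\<bar>" if "x \<le> 0" "y \<le> 0" for x y
  proof -
    have *: "exp (2 * r * x) - exp (2 * r * y) \<le> 2 * r * (x - y) \<and> 0 \<le> exp (2 * r * x) - exp (2 * r * y)"
      if "y \<le> x" "x \<le> 0" for x y
    proof -
      have "1 + 2 * r * (y - x) \<le> exp (2 * r * (y - x))" by (rule exp_ge_add_one_self)
      then have "1 - exp (2 * r * (y - x)) \<le> 2 * r * (x - y)" by (simp add: algebra_simps)
      moreover have "0 \<le> 1 - exp (2 * r * (y - x))" using r that by (simp add: mult_le_0_iff)
      moreover have "exp (2 * r * x) \<le> 1" using r that by (simp add: mult_le_0_iff)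
      ultimately have "exp (2 * r * x) * (1 - exp (2 * r * (y - x))) \<le> 1 * (2 * r * (x - y))"
        by (intro mult_mono) auto
      moreover have "exp (2 * r * x) * (1 - exp (2 * r * (y - x))) = exp (2 * r * x) - exp (2 * r * y)"
        by (simp add: right_diff_distrib flip: exp_add)
      ultimately show ?thesis using r that by (auto intro: mult_left_mono)
    qed
    show ?thesis
      using *[of x y] *[of y x] that by (cases "x \<le> y") (auto simp: abs_minus_commute)
  qed
  have mind: "\<bar>min 1 (real n * x) - min 1 (real n * y)\<bar> \<le> real n * \<bar>x - y\<bar>" for x y
  proof -
    have "\<bar>min 1 (real n * x) - min 1 (real n * y)\<bar> \<le> \<bar>real n * x - real n * y\<bar>" by (simp add: min_def)
    also have "\<dots> = real n * \<bar>x - y\<bar>" by (simp add: abs_mult flip: right_diff_distrib)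
    finally show ?thesis .
  qed
  have pos: "\<bar>ramp r n x - ramp r n y\<bar> \<le> ?L * \<bar>x - y\<bar>" if "x \<ge> 0" "y \<ge> 0" for x y
  proof -
    have "\<bar>ramp r n x - ramp r n y\<bar> \<le> real n * \<bar>x - y\<bar>" using mind[of x y] that by (simp add: ramp_def)
    also have "\<dots> \<le> ?L * \<bar>x - y\<bar>" using r by (intro mult_right_mono) auto
    finally show ?thesis .
  qed
  have neg: "\<bar>ramp r n x - ramp r n y\<bar> \<le> ?L * \<bar>x - y\<bar>" if "x \<le> 0" "y \<le> 0" for x y
  proof -
    define a b c d where abcd: "a = exp (2 * r * x)" "b = min 1 (real n * (- x))" "c = exp (2 * r * y)" "d = min 1 (real n * (- y))"
    have eq: "ramp r n x = - (a * b)" "ramp r n y = - (c * d)" using that by (auto simp: ramp_def abcd)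
    have bd: "\<bar>a\<bar> \<le> 1" "\<bar>d\<bar> \<le> 1" using that r by (auto simp: abcd mult_le_0_iff mult_nonneg_nonpos)
    have "\<bar>ramp r n x - ramp r n y\<bar> = \<bar>a * (b - d) + (a - c) * d\<bar>" unfolding eq by (simp add: algebra_simps abs_minus_commute)
    also have "\<dots> \<le> \<bar>a\<bar> * \<bar>b - d\<bar> + \<bar>a - c\<bar> * \<bar>d\<bar>" by (metis abs_mult abs_triangle_ineq)
    also have "\<dots> \<le> 1 * (real n * \<bar>x - y\<bar>) + (2 * r * \<bar>x - y\<bar>) * 1"
      using mind[of "-x" "-y"] expd[OF that] bd r by (intro add_mono mult_mono) (auto simp: abcd abs_minus_commute)
    also have "\<dots> = ?L * \<bar>x - y\<bar>" by (simp add: algebra_simps)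
    finally show ?thesis .
  qed
  consider "x \<ge> 0" "y \<ge> 0" | "x \<le> 0" "y \<le> 0" | "x \<ge> 0" "y \<le> 0" | "x \<le> 0" "y \<ge> 0" by linarith
  then show ?thesis
  proof cases
    case 3
    then have "\<bar>ramp r n x - ramp r n y\<bar> \<le> ?L * \<bar>x\<bar> + ?L * \<bar>y\<bar>"
      using pos[of x 0] neg[of y 0] by simp
    then show ?thesis using 3 by (simp add: algebra_simps)
  next
    case 4
    then have "\<bar>ramp r n x - ramp r n y\<bar> \<le> ?L * \<bar>x\<bar> + ?L * \<bar>y\<bar>"
      using pos[of y 0] neg[of x 0] by simp
    then show ?thesis using 4 by (simp add: algebra_simps)
  qed (use pos neg in auto)
qed

lemma integrable_normal_times_bounded:
  assumes [measurable]: "h \<in> borel_measurable borel" and b: "\<And>x. \<bar>h x :: real\<bar> \<le> d"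
    and s: "s > 0"
  shows "integrable lborel (\<lambda>z. normal_density m s z * h z)"
proof (rule Bochner_Integration.integrable_bound)
  show "integrable lborel (\<lambda>z. normal_density m s z * d)" using s by simp
  have d: "0 \<le> d" using b[of 0] by linarith
  show "AE z in lborel. norm (normal_density m s z * h z) \<le> norm (normal_density m s z * d)"
  proof (rule AE_I2)
    fix z
    show "norm (normal_density m s z * h z) \<le> norm (normal_density m s z * d)"
      unfolding real_norm_def abs_mult using b[of z] d by (intro mult_left_mono) auto
  qed
qed simp

lemma drift_op_eq:
  assumes "t > 0"
  shows "drift_op r h t x = (\<integral>z. normal_density (x - r * t) (sqrt t) z * h z \<partial>lborel)"
  unfolding drift_op_def
  by (subst (2) lborel_integral_real_affine[where c=1 and t="x - r * t"])
    (auto simp: normal_density_def algebra_simps)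

lemma drift_op_abs_le:
  assumes t: "t > 0" and [measurable]: "h \<in> borel_measurable borel" and b: "\<And>x. \<bar>h x\<bar> \<le> d"
  shows "\<bar>drift_op r h t x\<bar> \<le> d"
proof -
  have d: "0 \<le> d" using b[of 0] by linarith
  have "\<bar>drift_op r h t x\<bar> \<le> (\<integral>z. \<bar>normal_density (x - r * t) (sqrt t) z * h z\<bar> \<partial>lborel)"
    unfolding drift_op_eq[OF t] by (rule integral_abs_bound)
  also have "\<dots> \<le> (\<integral>z. normal_density (x - r * t) (sqrt t) z * d \<partial>lborel)"
  proof (rule integral_mono)
    show "integrable lborel (\<lambda>z. \<bar>normal_density (x - r * t) (sqrt t) z * h z\<bar>)"
      using t b by (intro integrable_abs integrable_normal_times_bounded[of h d]) auto
    show "\<bar>normal_density (x - r * t) (sqrt t) z * h z\<bar> \<le> normal_density (x - r * t) (sqrt t) z * d" for z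
      unfolding abs_mult using b[of z] by (auto intro: mult_left_mono)
  qed (use t in simp)
  also have "\<dots> = d" using t by simp
  finally show ?thesis .
qed

text \<open>The density of N(- r t, t) times e^(r z) is even in z and e^(- r z) times the ramp is
  odd, so the integrand is odd.\<close>

lemma drift_op_ramp_zero:
  assumes r: "r > 0" and t: "t > 0"
  shows "drift_op r (ramp r n) t 0 = 0"
proof -
  have odd: "normal_density (- (r * t)) (sqrt t) (- z) * ramp r n (- z)
      = - (normal_density (- (r * t)) (sqrt t) z * ramp r n z)" for z
  proof -
    have e: "normal_density (- (r * t)) (sqrt t) (- z) = exp (2 * r * z) * normal_density (- (r * t)) (sqrt t) z" for z
    proof -
      have "- (- z + r * t)\<^sup>2 / (2 * t) = 2 * r * z + (- (z + r * t)\<^sup>2 / (2 * t))"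
        using t by (simp add: field_simps power2_eq_square)
      then show ?thesis using t by (simp add: normal_density_def exp_add[symmetric] mult_ac)
    qed
    have p: "normal_density (- (r * t)) (sqrt t) (- z) * ramp r n (- z)
      = - (normal_density (- (r * t)) (sqrt t) z * ramp r n z)" if "z > 0" for z
      using that unfolding e[of z] by (simp add: ramp_def exp_minus field_simps)
    show ?thesis
      using p[of z] p[of "-z"] by (cases z "0 :: real" rule: linorder_cases) auto
  qed
  have "drift_op r (ramp r n) t 0 = (\<integral>z. normal_density (- (r * t)) (sqrt t) z * ramp r n z \<partial>lborel)"
    using drift_op_eq[OF t, of r "ramp r n" 0] by simp
  also have "\<dots> = (\<integral>z. normal_density (- (r * t)) (sqrt t) (-z) * ramp r n (-z) \<partial>lborel)"
    by (subst lborel_integral_real_affine[where c="-1" and t=0]) auto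
  also have "\<dots> = - drift_op r (ramp r n) t 0"
    unfolding odd using drift_op_eq[OF t, of r "ramp r n" 0] by simp
  finally show ?thesis by simp
qed

text \<open>Averaging over Gaussian shifts keeps the Lipschitz constant, and the value 0 at the
  origin anchors the estimate. The cut-off at 1 keeps the error term of
  \<open>discrete_killing\<close> bounded, so that its limit can be taken without any integrability
  of path oscillations.\<close>

lemma drift_op_ramp_le:
  assumes r: "r > 0" and t: "t > 0"
  shows "\<bar>drift_op r (ramp r n) t x\<bar> \<le> min 1 ((real n + 2 * r) * \<bar>x\<bar>)"
proof -
  have "\<bar>drift_op r (ramp r n) t x\<bar> \<le> 1"
    by (rule drift_op_abs_le[OF t]) (auto simp: abs_ramp_le_1[OF r])
  moreover have "\<bar>drift_op r (ramp r n) t x\<bar> \<le> (real n + 2 * r) * \<bar>x\<bar>"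
  proof -
    let ?L = "real n + 2 * r"
    have int: "integrable lborel (\<lambda>z. normal_density 0 (sqrt t) z * ramp r n (x + z - r * t))" for x
      by (rule integrable_normal_times_bounded[where d=1]) (use t in \<open>auto simp: abs_ramp_le_1[OF r]\<close>)
    let ?d = "\<lambda>z. normal_density 0 (sqrt t) z * (ramp r n (x + z - r * t) - ramp r n (0 + z - r * t))"
    have intd: "integrable lborel ?d"
      unfolding right_diff_distrib by (rule Bochner_Integration.integrable_diff) (fact int)+
    have "drift_op r (ramp r n) t x - drift_op r (ramp r n) t 0 = (\<integral>z. ?d z \<partial>lborel)"
      unfolding drift_op_def right_diff_distrib
      by (rule Bochner_Integration.integral_diff[symmetric]) (fact int)+
    then have "\<bar>drift_op r (ramp r n) t x\<bar> = \<bar>\<integral>z. ?d z \<partial>lborel\<bar>"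
      using drift_op_ramp_zero[OF assms, of n] by linarith
    also have "\<dots> \<le> (\<integral>z. \<bar>?d z\<bar> \<partial>lborel)"
      by (rule integral_abs_bound)
    also have "\<dots> \<le> (\<integral>z. normal_density 0 (sqrt t) z * (?L * \<bar>x\<bar>) \<partial>lborel)"
    proof (rule integral_mono)
      show "\<bar>?d z\<bar> \<le> normal_density 0 (sqrt t) z * (?L * \<bar>x\<bar>)" for z
        unfolding abs_mult using ramp_lipschitz[OF r, of n "x + z - r * t" "0 + z - r * t"]
        by (auto intro!: mult_left_mono)
    qed (use t intd in auto)
    also have "\<dots> = ?L * \<bar>x\<bar>" using t by simp
    finally show ?thesis .
  qed
  ultimately show ?thesis by simp
qed

section \<open>Folding onto the half-line: the killed density\<close>

lemma killed_density_measurable[measurable]: "killed_density r t y \<in> borel_measurable borel"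
  unfolding killed_density_def[abs_def] by measurable

lemma normal_density_uminus: "normal_density m s (- z) = normal_density (- m) s z"
  by (simp add: normal_density_def power2_commute add.commute)

lemma integrable_normal_uminus[simp]: "s > 0 \<Longrightarrow> integrable lborel (\<lambda>z. normal_density m s (- z))"
  unfolding normal_density_uminus by simp

text \<open>Folding the negative half-line onto the positive one turns the factor exp (2 r z) of the
  ramp into the weight exp (- 2 r z) of the reflected Gaussian in \<open>killed_density\<close>;
  what is left of the ramp is the common factor min 1 (n z).\<close>

lemma drift_op_ramp_eq:
  assumes r: "r > 0" and t: "t > 0"
  shows "drift_op r (ramp r n) t y = (\<integral>z. min 1 (real n * z) * (indicator {0<..} z * killed_density r t y z) \<partial>lborel)"
proof -
  let ?F = "\<lambda>z. normal_density (y - r * t) (sqrt t) z * ramp r n z"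
  have intF: "integrable lborel ?F"
    by (rule integrable_normal_times_bounded[where d=1]) (use t in \<open>auto simp: abs_ramp_le_1[OF r]\<close>)
  have i1: "integrable lborel (\<lambda>z. indicator {0<..} z * ?F z)" "integrable lborel (\<lambda>z. indicator {..<0} z * ?F z)"
    using integrable_mult_indicator[OF _ intF, of "{0<..}"] integrable_mult_indicator[OF _ intF, of "{..<0}"] by simp_all
  have i2: "integrable lborel (\<lambda>z. indicator {0<..} z * ?F (- z))"
  proof -
    have "integrable lborel (\<lambda>z. indicator {..<0} (- z) * ?F (- z))"
      using lborel_integrable_real_affine[OF i1(2), of "-1" 0] by simp
    also have "(\<lambda>z. indicator {..<0} (- z) * ?F (- z)) = (\<lambda>z. indicator {0<..} z * ?F (- z))"
      by (auto simp: indicator_def)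
    finally show ?thesis .
  qed
  have "drift_op r (ramp r n) t y = (\<integral>z. ?F z \<partial>lborel)" by (rule drift_op_eq[OF t])
  also have "\<dots> = (\<integral>z. indicator {0<..} z * ?F z + indicator {..<0} z * ?F z \<partial>lborel)"
    by (intro Bochner_Integration.integral_cong) (auto simp: indicator_def)
  also have "\<dots> = (\<integral>z. indicator {0<..} z * ?F z \<partial>lborel) + (\<integral>z. indicator {..<0} z * ?F z \<partial>lborel)"
    by (rule Bochner_Integration.integral_add) (fact i1)+
  also have "(\<integral>z. indicator {..<0} z * ?F z \<partial>lborel) = (\<integral>z. indicator {0<..} z * ?F (- z) \<partial>lborel)"
    by (subst lborel_integral_real_affine[where c="-1" and t=0]) (auto simp: indicator_def intro!: Bochner_Integration.integral_cong)
  also have "(\<integral>z. indicator {0<..} z * ?F z \<partial>lborel) + (\<integral>z. indicator {0<..} z * ?F (- z) \<partial>lborel)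
     = (\<integral>z. indicator {0<..} z * ?F z + indicator {0<..} z * ?F (- z) \<partial>lborel)"
    by (rule Bochner_Integration.integral_add[symmetric]) (fact i1 i2)+
  also have "\<dots> = (\<integral>z. min 1 (real n * z) * (indicator {0<..} z * killed_density r t y z) \<partial>lborel)"
    by (intro Bochner_Integration.integral_cong) (auto simp: indicator_def ramp_def killed_density_def algebra_simps)
  finally show ?thesis .
qed

lemma killed_density_bound:
  assumes "r > 0" "z > 0"
  shows "\<bar>killed_density r t y z\<bar> \<le> normal_density (y - r * t) (sqrt t) z + normal_density (y - r * t) (sqrt t) (- z)"
proof -
  have "exp (- 2 * r * z) * normal_density (y - r * t) (sqrt t) (- z) \<le> 1 * normal_density (y - r * t) (sqrt t) (- z)"
    using assms by (intro mult_right_mono) auto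
  moreover have "0 \<le> exp (- 2 * r * z) * normal_density (y - r * t) (sqrt t) (- z)" by simp
  ultimately show ?thesis
    using normal_density_nonneg[of "y - r * t" "sqrt t" z] unfolding killed_density_def by linarith
qed

lemma drift_op_ramp_tendsto:
  assumes r: "r > 0" and t: "t > 0"
  shows "(\<lambda>n. drift_op r (ramp r n) t y) \<longlonglongrightarrow> surv_prob r t y"
  unfolding drift_op_ramp_eq[OF assms] surv_prob_def
proof (rule integral_dominated_convergence)
  let ?w = "\<lambda>z. normal_density (y - r * t) (sqrt t) z + normal_density (y - r * t) (sqrt t) (- z)"
  show "integrable lborel ?w" using t by simp
  show "AE z in lborel. (\<lambda>n. min 1 (real n * z) * (indicator {0<..} z * killed_density r t y z))
      \<longlonglongrightarrow> indicator {0<..} z * killed_density r t y z"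
  proof (rule AE_I2)
    fix z :: real
    show "(\<lambda>n. min 1 (real n * z) * (indicator {0<..} z * killed_density r t y z))
      \<longlonglongrightarrow> indicator {0<..} z * killed_density r t y z"
    proof (cases "z > 0")
      case True
      have ev: "eventually (\<lambda>n. min 1 (real n * z) * (indicator {0<..} z * killed_density r t y z) = indicator {0<..} z * killed_density r t y z) sequentially"
        using eventually_ge_at_top[of "nat \<lceil>1 / z\<rceil>"]
      proof eventually_elim
        case (elim n)
        then have "1 / z \<le> real n" by linarith
        then have "1 \<le> real n * z" using True by (simp add: field_simps)
        then show ?case by (simp add: min_def)
      qed
      then show ?thesis by (rule tendsto_eventually)
    qed simp
  qed
  show "AE z in lborel. norm (min 1 (real n * z) * (indicator {0<..} z * killed_density r t y z)) \<le> ?w z" for n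
  proof (rule AE_I2)
    fix z :: real
    show "norm (min 1 (real n * z) * (indicator {0<..} z * killed_density r t y z)) \<le> ?w z"
    proof (cases "z > 0")
      case True
      have "\<bar>min 1 (real n * z)\<bar> * \<bar>killed_density r t y z\<bar> \<le> 1 * ?w z"
        using True killed_density_bound[OF r True] by (intro mult_mono) auto
      then show ?thesis using True by (simp add: abs_mult)
    qed simp
  qed
qed simp_all

section \<open>Survival probabilities for long times\<close>

lemma sinh_ge: "w \<ge> 0 \<Longrightarrow> sinh w \<ge> (w::real)"
proof -
  assume "w \<ge> 0"
  have "(\<lambda>w. sinh w - w) 0 \<le> (\<lambda>w. sinh w - w) w"
  proof (rule DERIV_nonneg_imp_nondecreasing[OF \<open>w \<ge> 0\<close>])
    fix x :: real
    show "\<exists>y. ((\<lambda>w. sinh w - w) has_real_derivative y) (at x) \<and> 0 \<le> y"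
      by (rule exI[of _ "cosh x - 1"]) (auto intro!: derivative_eq_intros simp: cosh_real_ge_1)
  qed
  then show ?thesis by simp
qed

text \<open>This is 1 - 2 w \<le> exp (- 2 w) multiplied by exp w.\<close>

lemma sinh_le_times_exp: "sinh w \<le> w * exp (w::real)"
proof -
  have "exp w * (1 - 2 * w) \<le> exp w * exp (- 2 * w)"
    using exp_ge_add_one_self[of "-2 * w"] by (intro mult_left_mono) auto
  then show ?thesis by (simp add: sinh_field_def exp_add[symmetric] field_simps)
qed

text \<open>Ratio of the killed density to its leading order for large \<open>t\<close>. It lies between
  \<open>1 - (y\<^sup>2 + z\<^sup>2) / (2 * t)\<close> and 1 because \<open>w \<le> sinh w \<le> w * exp w\<close> at \<open>w = y * z / t\<close>.\<close>

definition kernel_ratio :: "real \<Rightarrow> real \<Rightarrow> real \<Rightarrow> real" where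
  "kernel_ratio t y z = exp (- ((y\<^sup>2 + z\<^sup>2) / (2 * t))) * (t * sinh (y * z / t) / (y * z))"

text \<open>\<open>erlang_density (Suc 0) r\<close> is r^2 z e^(- r z) on the half-line, a
  quasi-stationary density of the killed process. The average against it is what remains of the
  survival probability once \<open>eta\<close> and a prefactor in t are split off.\<close>

definition rel_surv :: "real \<Rightarrow> real \<Rightarrow> real \<Rightarrow> real" where
  "rel_surv r t y = (\<integral>z. erlang_density (Suc 0) r z * kernel_ratio t y z \<partial>lborel)"

lemma kernel_ratio_measurable[measurable]: "(\<lambda>(y, z). kernel_ratio t y z) \<in> borel_measurable (borel \<Otimes>\<^sub>M borel)"
  unfolding kernel_ratio_def sinh_field_def by measurable

lemma kernel_ratio_bounds:
  assumes "t > 0" "y > 0" "z > 0"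
  shows "0 \<le> kernel_ratio t y z" "kernel_ratio t y z \<le> 1" "1 - kernel_ratio t y z \<le> (y\<^sup>2 + z\<^sup>2) / (2 * t)"
proof -
  define w a where "w = y * z / t" and "a = (y\<^sup>2 + z\<^sup>2) / (2 * t)"
  have w: "w > 0" using assms by (simp add: w_def)
  \<comment> \<open>The inequality between arithmetic and geometric mean; it lets the Gaussian
    factor exp (- a) absorb the exp w from the upper bound on sinh.\<close>
  have wa: "w \<le> a"
  proof -
    have "2 * (y * z) \<le> y\<^sup>2 + z\<^sup>2" using sum_squares_bound[of y z] by (simp add: mult.assoc)
    then show ?thesis using assms by (simp add: w_def a_def field_simps)
  qed
  have c: "kernel_ratio t y z = exp (- a) * (sinh w / w)"
    unfolding kernel_ratio_def a_def w_def minus_divide_left using assms by (simp add: field_simps)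
  show "0 \<le> kernel_ratio t y z" using w unfolding c by (intro mult_nonneg_nonneg) auto
  have "kernel_ratio t y z \<le> exp (- a) * exp w"
    using w sinh_le_times_exp[of w] unfolding c by (intro mult_left_mono) (auto simp: field_simps)
  also have "\<dots> \<le> 1" using wa by (simp add: exp_add[symmetric])
  finally show "kernel_ratio t y z \<le> 1" .
  have "exp (-a) * 1 \<le> kernel_ratio t y z"
    using w sinh_ge[of w] unfolding c by (intro mult_left_mono) (auto simp: field_simps)
  then show "1 - kernel_ratio t y z \<le> (y\<^sup>2 + z\<^sup>2) / (2 * t)"
    using exp_ge_add_one_self[of "-a"] unfolding a_def[symmetric] by linarith
qed

text \<open>Since sinh w / w = 1 + O(w^2) and w = y z / t, the quotient contributes only at order 1
  / t^2; the term of order 1 / t comes from the exponential alone.\<close>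

lemma kernel_ratio_tendsto:
  assumes "y > 0" "z > 0"
  shows "((\<lambda>t. t * (1 - kernel_ratio t y z)) \<longlongrightarrow> (y\<^sup>2 + z\<^sup>2) / 2) at_top"
proof -
  define w a where "w = y * z" and "a = (y\<^sup>2 + z\<^sup>2) / 2"
  have "w > 0" "a > 0" using assms by (auto simp: w_def a_def add_pos_pos)
  then have "((\<lambda>t. t * (1 - exp (- a / t) * (t * sinh (w / t) / w))) \<longlongrightarrow> a) at_top"
    by real_asymp
  then show ?thesis by (simp add: kernel_ratio_def w_def a_def divide_divide_eq_left mult.commute)
qed

lemma integrable_erlang_moment:
  assumes "r > 0"
  shows "integrable lborel (\<lambda>z. erlang_density (Suc 0) r z * z ^ k)"
proof -
  have "(\<integral>\<^sup>+z. ennreal (erlang_density (Suc 0) r z * z ^ k) \<partial>lborel) = ennreal (fact (1 + k) / (fact 1 * r ^ k))"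
    using nn_integral_erlang_ith_moment[OF assms, of "Suc 0" k] by simp
  then show ?thesis
    using assms by (intro integrableI_nonneg) (auto intro!: AE_I2 simp: erlang_density_def)
qed

text \<open>After expanding the squares the two exponents differ only in the sign of y z / t, so the
  difference of the exponentials is a common factor times 2 sinh (y z / t). The factor r^2 of the
  Erlang density cancels the one in the denominator of \<open>eta\<close>.\<close>

lemma killed_density_eq:
  assumes "r > 0" "t > 0" "y > 0" "z > 0"
  shows "killed_density r t y z
    = 2 / (t * sqrt (2 * pi * t)) * exp (- r\<^sup>2 * t / 2) * eta r y * (erlang_density (Suc 0) r z * kernel_ratio t y z)"
proof -
  define A q w where "A = - r\<^sup>2 * t / 2" and "q = (y\<^sup>2 + z\<^sup>2) / (2 * t)" and "w = y * z / t"
  have e1: "- (z - (y - r * t))\<^sup>2 / (2 * t) = A + r * y + (- (r * z)) + (- q) + w"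
    using assms by (simp add: field_simps power2_eq_square A_def q_def w_def)
  have e2: "- 2 * r * z + (- (- z - (y - r * t))\<^sup>2 / (2 * t)) = A + r * y + (- (r * z)) + (- q) + (- w)"
    using assms by (simp add: field_simps power2_eq_square A_def q_def w_def)
  have "killed_density r t y z = 1 / sqrt (2 * pi * t) *
     (exp (- (z - (y - r * t))\<^sup>2 / (2 * t)) - exp (- 2 * r * z + (- (- z - (y - r * t))\<^sup>2 / (2 * t))))"
    using assms unfolding killed_density_def normal_density_def exp_add by (simp add: algebra_simps)
  also have "\<dots> = 1 / sqrt (2 * pi * t) * (exp A * exp (r * y) * exp (- (r * z)) * exp (- q) * (2 * sinh w))"
    unfolding e1 e2 sinh_field_def exp_add by (simp add: algebra_simps)
  also have "\<dots> = 2 / (t * sqrt (2 * pi * t)) * exp A * eta r y * (erlang_density (Suc 0) r z * (exp (- q) * (t * sinh w / (y * z))))"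
    using assms by (simp add: eta_def erlang_density_def power2_eq_square)
  also have "\<dots> = 2 / (t * sqrt (2 * pi * t)) * exp (- r\<^sup>2 * t / 2) * eta r y * (erlang_density (Suc 0) r z * kernel_ratio t y z)"
    by (simp add: kernel_ratio_def A_def q_def w_def)
  finally show ?thesis .
qed

lemma erlang_nonpos: "\<not> 0 < z \<Longrightarrow> erlang_density (Suc 0) r z = 0"
  by (simp add: erlang_density_def)

text \<open>The prefactor, of order t^(-3/2) exp (- r^2 t / 2), does not involve y; hence it cancels
  in every conditional law.\<close>

lemma surv_prob_eq:
  assumes "r > 0" "t > 0" "y > 0"
  shows "surv_prob r t y = 2 / (t * sqrt (2 * pi * t)) * exp (- r\<^sup>2 * t / 2) * (eta r y * rel_surv r t y)"
proof -
  have "surv_prob r t y = (\<integral>z. (2 / (t * sqrt (2 * pi * t)) * exp (- r\<^sup>2 * t / 2) * eta r y)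
      * (erlang_density (Suc 0) r z * kernel_ratio t y z) \<partial>lborel)"
    unfolding surv_prob_def
    by (intro Bochner_Integration.integral_cong) (auto simp: indicator_def killed_density_eq[OF assms] erlang_nonpos)
  then show ?thesis by (simp add: rel_surv_def mult.assoc)
qed

text \<open>The constant c of the overview, equal to 6 / r^2. Its value stays unevaluated because it
  drops out of the limit.\<close>

definition erlang_moment2 :: "real \<Rightarrow> real" where
  "erlang_moment2 r = (\<integral>z. erlang_density (Suc 0) r z * z\<^sup>2 \<partial>lborel)"

lemma integral_erlang: 
  assumes "r > 0" shows "(\<integral>z. erlang_density (Suc 0) r z \<partial>lborel) = 1"
  using integral_eq_nn_integral[of "erlang_density (Suc 0) r" lborel] nn_integral_erlang_ith_moment[OF assms, of "Suc 0" 0] assms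
  by (simp add: erlang_density_nonneg)

lemma erlang_density_Suc_0_nonneg: "r > 0 \<Longrightarrow> 0 \<le> erlang_density (Suc 0) r z"
  by (simp add: erlang_density_def)

lemma integrable_rel_surv:
  assumes "r > 0" "t > 0" "y > 0"
  shows "integrable lborel (\<lambda>z. erlang_density (Suc 0) r z * kernel_ratio t y z)"
proof (rule Bochner_Integration.integrable_bound)
  show "integrable lborel (\<lambda>z. erlang_density (Suc 0) r z * z ^ 0)" by (rule integrable_erlang_moment) fact
  show "AE z in lborel. norm (erlang_density (Suc 0) r z * kernel_ratio t y z) \<le> norm (erlang_density (Suc 0) r z * z ^ 0)"
  proof (rule AE_I2)
    fix z
    show "norm (erlang_density (Suc 0) r z * kernel_ratio t y z) \<le> norm (erlang_density (Suc 0) r z * z ^ 0)"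
    proof (cases "z > 0")
      case True
      then have "erlang_density (Suc 0) r z * kernel_ratio t y z \<le> erlang_density (Suc 0) r z * 1"
        using kernel_ratio_bounds[OF assms(2,3) True] assms by (intro mult_left_mono erlang_density_Suc_0_nonneg) auto
      then show ?thesis using kernel_ratio_bounds[OF assms(2,3) True] assms(1) by (simp add: erlang_density_Suc_0_nonneg abs_mult)
    qed (simp add: erlang_nonpos)
  qed
qed measurable

lemma rel_surv_bounds:
  assumes "r > 0" "t > 0" "y > 0"
  shows "0 \<le> rel_surv r t y" "rel_surv r t y \<le> 1" "1 - rel_surv r t y \<le> (y\<^sup>2 + erlang_moment2 r) / (2 * t)"
proof -
  note int = integrable_rel_surv[OF assms]
  note m0 = integrable_erlang_moment[OF assms(1), of 0, simplified]
  note m2 = integrable_erlang_moment[OF assms(1), of 2]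
  show "0 \<le> rel_surv r t y" unfolding rel_surv_def
  proof (rule integral_nonneg_AE, rule AE_I2)
    show "0 \<le> erlang_density (Suc 0) r z * kernel_ratio t y z" for z
      using kernel_ratio_bounds[OF assms(2,3), of z] erlang_density_Suc_0_nonneg[OF assms(1), of z] by (cases "z > 0") (auto simp: erlang_nonpos)
  qed
  have le: "erlang_density (Suc 0) r z * kernel_ratio t y z \<le> erlang_density (Suc 0) r z" for z
    using kernel_ratio_bounds[OF assms(2,3), of z] erlang_density_Suc_0_nonneg[OF assms(1), of z]
    by (cases "z > 0") (auto simp: erlang_nonpos mult_left_le)
  have "rel_surv r t y \<le> (\<integral>z. erlang_density (Suc 0) r z \<partial>lborel)"
    unfolding rel_surv_def by (intro integral_mono int m0 le)
  then show "rel_surv r t y \<le> 1" by (simp add: integral_erlang assms(1))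
  have "1 - rel_surv r t y = (\<integral>z. erlang_density (Suc 0) r z - erlang_density (Suc 0) r z * kernel_ratio t y z \<partial>lborel)"
    unfolding rel_surv_def by (subst Bochner_Integration.integral_diff[OF m0 int]) (simp add: integral_erlang assms(1))
  also have "\<dots> \<le> (\<integral>z. (erlang_density (Suc 0) r z * y\<^sup>2 + erlang_density (Suc 0) r z * z\<^sup>2) / (2 * t) \<partial>lborel)"
  proof (rule integral_mono)
    fix z
    show "erlang_density (Suc 0) r z - erlang_density (Suc 0) r z * kernel_ratio t y z \<le> (erlang_density (Suc 0) r z * y\<^sup>2 + erlang_density (Suc 0) r z * z\<^sup>2) / (2 * t)"
    proof (cases "z > 0")
      case True
      have "erlang_density (Suc 0) r z * (1 - kernel_ratio t y z) \<le> erlang_density (Suc 0) r z * ((y\<^sup>2 + z\<^sup>2) / (2 * t))"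
        by (intro mult_left_mono kernel_ratio_bounds assms True erlang_density_Suc_0_nonneg)
      then show ?thesis by (simp add: algebra_simps)
    qed (simp add: erlang_nonpos)
  qed (use m0 m2 int in simp_all)
  also have "\<dots> = (y\<^sup>2 + erlang_moment2 r) / (2 * t)"
    using m0 m2 by (simp add: integral_erlang assms(1) erlang_moment2_def)
  finally show "1 - rel_surv r t y \<le> (y\<^sup>2 + erlang_moment2 r) / (2 * t)" .
qed

text \<open>Dominated convergence: t times the bound on 1 - \<open>kernel_ratio\<close> is a
  majorant in z from which t has disappeared.\<close>

lemma rel_surv_tendsto:
  assumes "r > 0" "y > 0"
  shows "((\<lambda>t. t * (1 - rel_surv r t y)) \<longlongrightarrow> (y\<^sup>2 + erlang_moment2 r) / 2) at_top"
proof -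
  note m0 = integrable_erlang_moment[OF assms(1), of 0, simplified]
  note m2 = integrable_erlang_moment[OF assms(1), of 2]
  have lim: "((\<lambda>t. \<integral>z. erlang_density (Suc 0) r z * (t * (1 - kernel_ratio t y z)) \<partial>lborel) \<longlongrightarrow>
      (\<integral>z. erlang_density (Suc 0) r z * ((y\<^sup>2 + z\<^sup>2) / 2) \<partial>lborel)) at_top"
  proof (rule integral_dominated_convergence_at_top)
    show "integrable lborel (\<lambda>z. (erlang_density (Suc 0) r z * y\<^sup>2 + erlang_density (Suc 0) r z * z\<^sup>2) / 2)"
      using m0 m2 by simp
    show "AE z in lborel. ((\<lambda>t. erlang_density (Suc 0) r z * (t * (1 - kernel_ratio t y z))) \<longlongrightarrow> erlang_density (Suc 0) r z * ((y\<^sup>2 + z\<^sup>2) / 2)) at_top"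
    proof (rule AE_I2)
      show "((\<lambda>t. erlang_density (Suc 0) r z * (t * (1 - kernel_ratio t y z))) \<longlongrightarrow> erlang_density (Suc 0) r z * ((y\<^sup>2 + z\<^sup>2) / 2)) at_top" for z
        using kernel_ratio_tendsto[OF assms(2), of z] by (cases "z > 0") (auto simp: erlang_nonpos simp del: times_divide_eq_right intro: tendsto_mult_left)
    qed
    show "\<forall>\<^sub>F t in at_top. AE z in lborel. norm (erlang_density (Suc 0) r z * (t * (1 - kernel_ratio t y z)))
        \<le> (erlang_density (Suc 0) r z * y\<^sup>2 + erlang_density (Suc 0) r z * z\<^sup>2) / 2"
      using eventually_gt_at_top[of 0]
    proof eventually_elim
      case (elim t)
      show ?case
      proof (rule AE_I2)
        fix z
        show "norm (erlang_density (Suc 0) r z * (t * (1 - kernel_ratio t y z))) \<le> (erlang_density (Suc 0) r z * y\<^sup>2 + erlang_density (Suc 0) r z * z\<^sup>2) / 2"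
        proof (cases "z > 0")
          case True
          note c = kernel_ratio_bounds[OF elim assms(2) True]
          have "t * (1 - kernel_ratio t y z) \<le> (y\<^sup>2 + z\<^sup>2) / 2" using c(3) elim by (simp add: field_simps)
          then have "erlang_density (Suc 0) r z * (t * (1 - kernel_ratio t y z)) \<le> erlang_density (Suc 0) r z * ((y\<^sup>2 + z\<^sup>2) / 2)"
            by (intro mult_left_mono erlang_density_Suc_0_nonneg assms)
          moreover have "0 \<le> erlang_density (Suc 0) r z * (t * (1 - kernel_ratio t y z))"
            using c elim assms by (intro mult_nonneg_nonneg erlang_density_Suc_0_nonneg) auto
          ultimately show ?thesis by (simp add: algebra_simps)
        qed (simp add: erlang_nonpos)
      qed
    qed
  qed measurable
  have val: "(\<integral>z. erlang_density (Suc 0) r z * ((y\<^sup>2 + z\<^sup>2) / 2) \<partial>lborel) = (y\<^sup>2 + erlang_moment2 r) / 2"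
  proof -
    have "(\<integral>z. erlang_density (Suc 0) r z * ((y\<^sup>2 + z\<^sup>2) / 2) \<partial>lborel)
       = (\<integral>z. (erlang_density (Suc 0) r z * y\<^sup>2 + erlang_density (Suc 0) r z * z\<^sup>2) / 2 \<partial>lborel)"
      by (intro Bochner_Integration.integral_cong) (auto simp: algebra_simps)
    also have "\<dots> = (y\<^sup>2 + erlang_moment2 r) / 2" using m0 m2 by (simp add: integral_erlang assms(1) erlang_moment2_def)
    finally show ?thesis .
  qed
  have ev: "\<forall>\<^sub>F t in at_top. (\<integral>z. erlang_density (Suc 0) r z * (t * (1 - kernel_ratio t y z)) \<partial>lborel) = t * (1 - rel_surv r t y)"
    using eventually_gt_at_top[of 0]
  proof eventually_elim
    case (elim t)
    have "(\<integral>z. erlang_density (Suc 0) r z * (t * (1 - kernel_ratio t y z)) \<partial>lborel)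
      = (\<integral>z. t * (erlang_density (Suc 0) r z - erlang_density (Suc 0) r z * kernel_ratio t y z) \<partial>lborel)"
      by (intro Bochner_Integration.integral_cong) (auto simp: algebra_simps)
    also have "\<dots> = t * (1 - rel_surv r t y)"
      using m0 integrable_rel_surv[OF assms(1) elim assms(2)] by (simp add: rel_surv_def integral_erlang assms(1))
    finally show ?case .
  qed
  show ?thesis using Lim_transform_eventually[OF lim ev] unfolding val .
qed

lemma rel_surv_measurable[measurable]: "rel_surv r t \<in> borel_measurable borel"
  unfolding rel_surv_def[abs_def] by measurable

lemma surv_prob_measurable[measurable]: "surv_prob r t \<in> borel_measurable borel"
  unfolding surv_prob_def[abs_def] killed_density_def normal_density_def by measurable

lemma drift_op_measurable[measurable]:
  assumes [measurable]: "h \<in> borel_measurable borel"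
  shows "drift_op r h t \<in> borel_measurable borel"
  unfolding drift_op_def[abs_def] normal_density_def by measurable

lemma eta_measurable[measurable]: "eta r \<in> borel_measurable borel"
  unfolding eta_def[abs_def] by measurable

section \<open>Rate in the Wasserstein distance for densities\<close>

text \<open>Here \<open>N\<close> plays the role of the (sub-probability) law of the killed process at a fixed time.\<close>

locale eta_moments = finite_measure N for N :: "real measure" +
  fixes r :: real
  assumes sets_N[measurable_cong]: "sets N = sets borel" and pos_N: "AE y in N. 0 < y" and r_pos: "r > 0"
    and eta_y3: "integrable N (\<lambda>y. eta r y * y ^ 3)"
begin

definition mom :: "nat \<Rightarrow> real" where
  "mom k = (\<integral>y. eta r y * y ^ k \<partial>N)"

text \<open>For T > 0 this is the probability of surviving a further time T from the initial law
  \<open>N\<close>, divided by the prefactor of \<open>surv_prob_eq\<close>.\<close>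

definition mass :: "real \<Rightarrow> real" where
  "mass T = (\<integral>y. eta r y * rel_surv r T y \<partial>N)"

lemma eta_pos: "y > 0 \<Longrightarrow> eta r y > 0"
  using r_pos by (simp add: eta_def)

text \<open>Finiteness of \<open>N\<close> takes care of y \<le> 1, the third moment of y >
  1.\<close>

lemma integrable_mom:
  assumes "k \<le> 3"
  shows "integrable N (\<lambda>y. eta r y * y ^ k)"
proof (rule Bochner_Integration.integrable_bound)
  show "integrable N (\<lambda>y. exp r / r\<^sup>2 + eta r y * y ^ 3)" using eta_y3 by simp
  show "AE y in N. norm (eta r y * y ^ k) \<le> norm (exp r / r\<^sup>2 + eta r y * y ^ 3)"
    using pos_N
  proof eventually_elim
    case (elim y)
    have nn: "0 \<le> eta r y * y ^ k" "0 \<le> eta r y * y ^ 3" "0 \<le> exp r / r\<^sup>2"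
      using eta_pos[OF elim] elim by auto
    have "eta r y * y ^ k \<le> exp r / r\<^sup>2 + eta r y * y ^ 3"
    proof (cases "y \<le> 1")
      case True
      have "y * exp (r * y) \<le> 1 * exp (r * 1)" using True elim r_pos by (intro mult_mono) auto
      then have "eta r y \<le> exp r / r\<^sup>2" unfolding eta_def by (simp add: divide_right_mono)
      moreover have "y ^ k \<le> 1" using True elim by (simp add: power_le_one)
      ultimately have "eta r y * y ^ k \<le> exp r / r\<^sup>2 * 1"
        using elim nn eta_pos[OF elim] by (intro mult_mono) auto
      then show ?thesis using nn by simp
    next
      case False
      then have "eta r y * y ^ k \<le> eta r y * y ^ 3"
        using eta_pos[OF elim] assms by (intro mult_left_mono power_increasing) auto
      then show ?thesis using nn by linarith
    qed
    then show ?case using nn by simp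
  qed
qed measurable

lemma integrable_eta_times:
  assumes [measurable]: "h \<in> borel_measurable borel"
    and h: "\<And>y. y > 0 \<Longrightarrow> \<bar>h y\<bar> \<le> a + b * y ^ k" "k \<le> 3"
  shows "integrable N (\<lambda>y. eta r y * h y)"
proof (rule Bochner_Integration.integrable_bound)
  show "integrable N (\<lambda>y. a * (eta r y * y ^ 0) + b * (eta r y * y ^ k))"
    using h(2) by (intro Bochner_Integration.integrable_add integrable_mult_right integrable_mom) auto
  show "AE y in N. norm (eta r y * h y) \<le> norm (a * (eta r y * y ^ 0) + b * (eta r y * y ^ k))"
    using pos_N
  proof eventually_elim
    case (elim y)
    have "eta r y * \<bar>h y\<bar> \<le> eta r y * (a + b * y ^ k)"
      using eta_pos[OF elim] by (intro mult_left_mono h elim) auto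
    also have "\<dots> = a * (eta r y * y ^ 0) + b * (eta r y * y ^ k)" by (simp add: algebra_simps)
    finally show ?case using eta_pos[OF elim] by (simp add: abs_mult)
  qed
qed measurable

lemma abs_rel_surv: "T > 0 \<Longrightarrow> y > 0 \<Longrightarrow> \<bar>rel_surv r T y\<bar> \<le> 1"
  using rel_surv_bounds[OF r_pos, of T y] by simp

lemma abs_1_rel_surv: "T > 0 \<Longrightarrow> y > 0 \<Longrightarrow> \<bar>1 - rel_surv r T y\<bar> \<le> 1"
  using rel_surv_bounds[OF r_pos, of T y] by simp

lemma integrable_rel:
  assumes T: "T > 0" and [measurable]: "g \<in> borel_measurable borel" and g: "\<And>y. y > 0 \<Longrightarrow> \<bar>g y\<bar> \<le> 1 + y"
  shows "integrable N (\<lambda>y. eta r y * (rel_surv r T y * g y))"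
    "integrable N (\<lambda>y. eta r y * ((1 - rel_surv r T y) * g y))" "integrable N (\<lambda>y. eta r y * g y)"
proof -
  have le: "\<bar>h * g y\<bar> \<le> 1 + 1 * y ^ 1" if "y > 0" "\<bar>h\<bar> \<le> 1" for h y
    using mult_mono[OF that(2) g[OF that(1)]] that by (simp add: abs_mult)
  show "integrable N (\<lambda>y. eta r y * (rel_surv r T y * g y))"
    by (rule integrable_eta_times[where k=1, OF _ le]) (auto intro: abs_rel_surv T)
  show "integrable N (\<lambda>y. eta r y * ((1 - rel_surv r T y) * g y))"
    by (rule integrable_eta_times[where k=1, OF _ le]) (auto intro: abs_1_rel_surv T)
  show "integrable N (\<lambda>y. eta r y * g y)"
    using le[of _ 1] by (intro integrable_eta_times[where k=1 and a=1 and b=1]) auto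
qed

text \<open>The defect 1 - \<open>rel_surv\<close> costs two powers of y, so a test function of
  degree k needs the moment of order k + 2; with k = 1 this is exactly the third moment provided by
  the locale.\<close>

lemma integral_defect_bound:
  assumes T: "T > 0" and k: "k \<le> 1" and g[measurable]: "g \<in> borel_measurable borel" and gb: "\<And>y. y > 0 \<Longrightarrow> \<bar>g y\<bar> \<le> y ^ k"
  shows "\<bar>\<integral>y. eta r y * ((1 - rel_surv r T y) * g y) \<partial>N\<bar> \<le> (mom (k + 2) + erlang_moment2 r * mom k) / (2 * T)"
proof -
  have "\<bar>\<integral>y. eta r y * ((1 - rel_surv r T y) * g y) \<partial>N\<bar> \<le> (\<integral>y. \<bar>eta r y * ((1 - rel_surv r T y) * g y)\<bar> \<partial>N)"
    by (rule integral_abs_bound)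
  also have "\<dots> \<le> (\<integral>y. (eta r y * y ^ (k + 2) + erlang_moment2 r * (eta r y * y ^ k)) / (2 * T) \<partial>N)"
  proof (rule integral_mono_AE)
    have "\<bar>g y\<bar> \<le> 1 + y" if "y > 0" for y
      using gb[OF that] that k by (cases k) auto
    then show "integrable N (\<lambda>y. \<bar>eta r y * ((1 - rel_surv r T y) * g y)\<bar>)"
      by (intro integrable_abs integrable_rel T g)
    show "integrable N (\<lambda>y. (eta r y * y ^ (k + 2) + erlang_moment2 r * (eta r y * y ^ k)) / (2 * T))"
      using k by (intro integrable_divide Bochner_Integration.integrable_add integrable_mult_right integrable_mom) auto
    show "AE y in N. \<bar>eta r y * ((1 - rel_surv r T y) * g y)\<bar> \<le> (eta r y * y ^ (k + 2) + erlang_moment2 r * (eta r y * y ^ k)) / (2 * T)"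
      using pos_N
    proof eventually_elim
      case (elim y)
      note b = rel_surv_bounds[OF r_pos T elim]
      have "\<bar>eta r y * ((1 - rel_surv r T y) * g y)\<bar> = eta r y * ((1 - rel_surv r T y) * \<bar>g y\<bar>)"
        using b eta_pos[OF elim] by (simp add: abs_mult)
      also have "\<dots> \<le> eta r y * ((y\<^sup>2 + erlang_moment2 r) / (2 * T) * y ^ k)"
        using b eta_pos[OF elim] gb[OF elim] by (intro mult_left_mono mult_mono) auto
      also have "\<dots> = (eta r y * y ^ (k + 2) + erlang_moment2 r * (eta r y * y ^ k)) / (2 * T)"
        using T by (simp add: field_simps power_add power2_eq_square)
      finally show ?case .
    qed
  qed
  also have "\<dots> = (mom (k + 2) + erlang_moment2 r * mom k) / (2 * T)"
    using integrable_mom[of "k + 2"] integrable_mom[of k] k by (simp add: mom_def)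
  finally show ?thesis .
qed

text \<open>T times the bound of \<open>rel_surv_bounds\<close> is free of T and serves as majorant.
  The case k = 0 describes the loss in the normalisation, k = 1 the loss in the mean.\<close>

lemma integral_defect_tendsto:
  assumes k: "k \<le> 1"
  shows "((\<lambda>T. T * (\<integral>y. eta r y * ((1 - rel_surv r T y) * y ^ k) \<partial>N)) \<longlongrightarrow> (mom (k + 2) + erlang_moment2 r * mom k) / 2) at_top"
proof -
  have "((\<lambda>T. \<integral>y. eta r y * y ^ k * (T * (1 - rel_surv r T y)) \<partial>N) \<longlongrightarrow>
      (\<integral>y. eta r y * y ^ k * ((y\<^sup>2 + erlang_moment2 r) / 2) \<partial>N)) at_top"
  proof (rule integral_dominated_convergence_at_top)
    show "integrable N (\<lambda>y. (eta r y * y ^ (k + 2) + erlang_moment2 r * (eta r y * y ^ k)) / 2)"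
      using k by (intro integrable_divide Bochner_Integration.integrable_add integrable_mult_right integrable_mom) auto
    show "AE y in N. ((\<lambda>T. eta r y * y ^ k * (T * (1 - rel_surv r T y))) \<longlongrightarrow> eta r y * y ^ k * ((y\<^sup>2 + erlang_moment2 r) / 2)) at_top"
      using pos_N by eventually_elim (intro tendsto_mult_left rel_surv_tendsto r_pos)
    show "\<forall>\<^sub>F T in at_top. AE y in N. norm (eta r y * y ^ k * (T * (1 - rel_surv r T y)))
        \<le> (eta r y * y ^ (k + 2) + erlang_moment2 r * (eta r y * y ^ k)) / 2"
      using eventually_gt_at_top[of 0]
    proof eventually_elim
      case (elim T)
      show ?case using pos_N
      proof eventually_elim
        case (elim y)
        note b = rel_surv_bounds[OF r_pos \<open>0 < T\<close> elim]
        have "T * (1 - rel_surv r T y) \<le> (y\<^sup>2 + erlang_moment2 r) / 2" using b(3) \<open>0 < T\<close> by (simp add: field_simps)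
        then have "eta r y * y ^ k * (T * (1 - rel_surv r T y)) \<le> eta r y * y ^ k * ((y\<^sup>2 + erlang_moment2 r) / 2)"
          using eta_pos[OF elim] elim by (intro mult_left_mono) auto
        moreover have "0 \<le> eta r y * y ^ k * (T * (1 - rel_surv r T y))"
          using eta_pos[OF elim] elim b \<open>0 < T\<close> by simp
        ultimately show ?case by (simp add: field_simps power_add power2_eq_square)
      qed
    qed
  qed measurable
  moreover have "(\<integral>y. eta r y * y ^ k * ((y\<^sup>2 + erlang_moment2 r) / 2) \<partial>N) = (mom (k + 2) + erlang_moment2 r * mom k) / 2"
  proof -
    have "(\<integral>y. eta r y * y ^ k * ((y\<^sup>2 + erlang_moment2 r) / 2) \<partial>N) = (\<integral>y. (eta r y * y ^ (k + 2) + erlang_moment2 r * (eta r y * y ^ k)) / 2 \<partial>N)"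
      by (intro Bochner_Integration.integral_cong) (auto simp: field_simps power_add power2_eq_square)
    also have "\<dots> = (mom (k + 2) + erlang_moment2 r * mom k) / 2"
      using integrable_mom[of "k + 2"] integrable_mom[of k] k by (simp add: mom_def)
    finally show ?thesis .
  qed
  moreover have "(\<integral>y. eta r y * y ^ k * (T * (1 - rel_surv r T y)) \<partial>N) = T * (\<integral>y. eta r y * ((1 - rel_surv r T y) * y ^ k) \<partial>N)" for T
  proof -
    have "(\<lambda>y. eta r y * y ^ k * (T * (1 - rel_surv r T y))) = (\<lambda>y. T * (eta r y * ((1 - rel_surv r T y) * y ^ k)))"
      by (simp add: fun_eq_iff)
    then show ?thesis by simp
  qed
  ultimately show ?thesis by simp
qed

lemma integral_rel_eq:
  assumes T: "T > 0" and g: "g \<in> borel_measurable borel" "\<And>y. y > 0 \<Longrightarrow> \<bar>g y\<bar> \<le> 1 + y"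
  shows "(\<integral>y. eta r y * (rel_surv r T y * g y) \<partial>N) = (\<integral>y. eta r y * g y \<partial>N) - (\<integral>y. eta r y * ((1 - rel_surv r T y) * g y) \<partial>N)"
proof -
  note i = integrable_rel[OF T g]
  have "(\<lambda>y. eta r y * (rel_surv r T y * g y)) = (\<lambda>y. eta r y * g y - eta r y * ((1 - rel_surv r T y) * g y))"
    by (simp add: fun_eq_iff algebra_simps)
  then show ?thesis
    using Bochner_Integration.integral_diff[OF i(3,2)] by simp
qed

lemma mass_eq: "T > 0 \<Longrightarrow> mass T = mom 0 - (\<integral>y. eta r y * ((1 - rel_surv r T y) * 1) \<partial>N)"
  using integral_rel_eq[of T "\<lambda>_. 1"] by (simp add: mass_def mom_def)

lemma mass_tendsto: "(mass \<longlongrightarrow> mom 0) at_top"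
proof -
  have "((\<lambda>T. (1 / T) * (T * (\<integral>y. eta r y * ((1 - rel_surv r T y) * y ^ 0) \<partial>N))) \<longlongrightarrow> 0 * ((mom (0 + 2) + erlang_moment2 r * mom 0) / 2)) at_top"
    by (intro tendsto_mult integral_defect_tendsto) (real_asymp | simp)+
  then have "((\<lambda>T. mom 0 - (1 / T) * (T * (\<integral>y. eta r y * ((1 - rel_surv r T y) * y ^ 0) \<partial>N))) \<longlongrightarrow> mom 0 - 0) at_top"
    by (intro tendsto_diff tendsto_const) simp
  then have lim: "((\<lambda>T. mom 0 - (1 / T) * (T * (\<integral>y. eta r y * ((1 - rel_surv r T y) * y ^ 0) \<partial>N))) \<longlongrightarrow> mom 0) at_top"
    by simp
  have "\<forall>\<^sub>F T in at_top. mom 0 - (1 / T) * (T * (\<integral>y. eta r y * ((1 - rel_surv r T y) * y ^ 0) \<partial>N)) = mass T"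
    using eventually_gt_at_top[of 0] by eventually_elim (simp add: mass_eq)
  from Lim_transform_eventually[OF lim this] show ?thesis .
qed

section \<open>The conditioned law, its limit and the distance between them\<close>

definition limit_law :: "real measure" where
  "limit_law = density N (\<lambda>y. ennreal (eta r y / mom 0))"

text \<open>With \<open>N\<close> the killed law at time s, \<open>pre_law T\<close> becomes the law
  of \<open>X s\<close> given survival up to s + T (\<open>cond_law_eq\<close>), and
  \<open>limit_law\<close> becomes the Q-law (\<open>Q_law_eq\<close>).\<close>

definition pre_law :: "real \<Rightarrow> real measure" where
  "pre_law T = density N (\<lambda>y. ennreal (eta r y * rel_surv r T y / mass T))"

lemma pre_law_density_nonneg: "T > 0 \<Longrightarrow> mass T > 0 \<Longrightarrow> AE y in N. 0 \<le> eta r y * rel_surv r T y / mass T"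
  using pos_N
proof eventually_elim
  case (elim y)
  then show ?case using rel_surv_bounds(1)[OF r_pos, of T y] eta_pos[of y] by simp
qed

lemma integral_pre_law:
  assumes "T > 0" "mass T > 0" and [measurable]: "f \<in> borel_measurable borel"
  shows "(\<integral>x. f x \<partial>pre_law T) = (\<integral>y. eta r y * (rel_surv r T y * f y) \<partial>N) / mass T"
  unfolding pre_law_def using pre_law_density_nonneg[OF assms(1,2)] by (subst integral_density) (auto simp: mult_ac)

lemma integral_limit_law:
  assumes "mom 0 > 0" and [measurable]: "f \<in> borel_measurable borel"
  shows "(\<integral>x. f x \<partial>limit_law) = (\<integral>y. eta r y * f y \<partial>N) / mom 0"
proof -
  have "AE y in N. 0 \<le> eta r y / mom 0"
    using pos_N by eventually_elim (use assms(1) in \<open>simp add: less_imp_le eta_pos\<close>)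
  then show ?thesis unfolding limit_law_def by (subst integral_density) (auto simp: mult_ac)
qed

text \<open>The constant 1 integrates to 1 under both laws and disappears. Expressing everything
  through the defect 1 - \<open>rel_surv\<close> cancels the terms of order one and leaves, up to
  normalisation, minus the covariance of the defect with g, which is of order 1 / T.\<close>

lemma difference_eq:
  assumes T: "T > 0" and m: "mass T > 0" "mom 0 > 0" and [measurable]: "g \<in> borel_measurable borel"
    and g: "\<And>y. y > 0 \<Longrightarrow> \<bar>g y\<bar> \<le> y"
  shows "(\<integral>x. 1 + g x \<partial>pre_law T) - (\<integral>x. 1 + g x \<partial>limit_law)
    = ((\<integral>y. eta r y * g y \<partial>N) * (\<integral>y. eta r y * ((1 - rel_surv r T y) * 1) \<partial>N)
        - mom 0 * (\<integral>y. eta r y * ((1 - rel_surv r T y) * g y) \<partial>N)) / (mom 0 * mass T)"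
proof -
  have g1: "\<bar>g y\<bar> \<le> 1 + y" if "y > 0" for y using g[OF that] by simp
  note i = integrable_rel[OF T _ g1] and i1 = integrable_rel[OF T, of "\<lambda>_. 1"]
  define G d dg where "G = (\<integral>y. eta r y * g y \<partial>N)" and "d = (\<integral>y. eta r y * ((1 - rel_surv r T y) * 1) \<partial>N)"
    and "dg = (\<integral>y. eta r y * ((1 - rel_surv r T y) * g y) \<partial>N)"
  have "(\<integral>x. 1 + g x \<partial>pre_law T) = (\<integral>y. eta r y * (rel_surv r T y * 1) + eta r y * (rel_surv r T y * g y) \<partial>N) / mass T"
    by (subst integral_pre_law[OF T m(1)]) (simp_all add: algebra_simps)
  also have "\<dots> = (mass T + (G - dg)) / mass T"
    using i i1 integral_rel_eq[OF T _ g1] by (subst Bochner_Integration.integral_add) (auto simp: mass_def G_def dg_def)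
  finally have 1: "(\<integral>x. 1 + g x \<partial>pre_law T) = (mass T + (G - dg)) / mass T" .
  have "(\<integral>x. 1 + g x \<partial>limit_law) = (\<integral>y. eta r y * 1 + eta r y * g y \<partial>N) / mom 0"
    by (subst integral_limit_law[OF m(2)]) (simp_all add: algebra_simps)
  also have "\<dots> = (mom 0 + G) / mom 0"
    using i i1 by (subst Bochner_Integration.integral_add) (auto simp: mom_def G_def)
  finally have 2: "(\<integral>x. 1 + g x \<partial>limit_law) = (mom 0 + G) / mom 0" .
  have me: "mom 0 = d + mass T" using mass_eq[OF T] by (simp add: d_def)
  show ?thesis unfolding 1 2 G_def[symmetric] d_def[symmetric] dg_def[symmetric]
    using m unfolding me by (simp add: field_simps)
qed

text \<open>Obtained by estimating both products in the numerator of \<open>difference_eq\<close> in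
  absolute value, with \<open>\<bar>g y\<bar> \<le> y\<close>.\<close>

definition W1_const :: real where
  "W1_const = (mom 1 * (mom 2 + erlang_moment2 r * mom 0) + mom 0 * (mom 3 + erlang_moment2 r * mom 1)) / (2 * mom 0)"

lemma W1_upper:
  assumes T: "T > 0" and m: "mass T > 0" "mom 0 > 0"
  shows "W1 (pre_law T) limit_law \<le> ereal (W1_const / (T * mass T))"
  unfolding W1_def
proof (rule SUP_least)
  fix f assume f: "f \<in> Lip11"
  show "ereal \<bar>(\<integral>x. f x \<partial>pre_law T) - (\<integral>x. f x \<partial>limit_law)\<bar> \<le> ereal (W1_const / (T * mass T))"
  proof (cases "f \<in> borel_measurable borel")
    \<comment> \<open>\<open>Lip11\<close> does not control \<open>f\<close> on the negative reals, so \<open>f\<close> may fail to be measurable; then both integrals are 0.\<close>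
    case False
    then have "\<not> integrable (pre_law T) f" "\<not> integrable limit_law f"
      by (auto simp: pre_law_def limit_law_def dest!: borel_measurable_integrable cong: measurable_cong_sets)
    moreover have "0 \<le> W1_const / (T * mass T)"
    proof -
      have "0 \<le> mom k" for k unfolding mom_def
      proof (rule integral_nonneg_AE)
        show "AE y in N. 0 \<le> eta r y * y ^ k"
          using pos_N by eventually_elim (simp add: eta_pos less_imp_le)
      qed
      moreover have "0 \<le> erlang_moment2 r" unfolding erlang_moment2_def using r_pos by (intro integral_nonneg_AE AE_I2) simp
      ultimately show ?thesis using T m by (simp add: W1_const_def)
    qed
    ultimately show ?thesis by (simp add: not_integrable_integral_eq)
  next
    case True
    \<comment> \<open>Subtracting the common value f 0 = 1 gives
      \<open>\<bar>g y\<bar> \<le> y\<close>, the only size bound on f that enters, so the estimate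
      is uniform over \<open>Lip11\<close>.\<close>
    define g where "g = (\<lambda>x. f x - 1)"
    have [measurable]: "g \<in> borel_measurable borel" using True by (simp add: g_def)
    have g: "\<bar>g y\<bar> \<le> y" if "y > 0" for y
    proof -
      have "\<bar>f y - f 0\<bar> \<le> \<bar>y - 0\<bar>" using f that unfolding Lip11_def by (metis (mono_tags, lifting) less_imp_le mem_Collect_eq order.refl)
      then show ?thesis using f that by (simp add: g_def Lip11_def)
    qed
    have fg: "f = (\<lambda>x. 1 + g x)" by (simp add: g_def fun_eq_iff)
    let ?G = "\<integral>y. eta r y * g y \<partial>N" and ?d = "\<integral>y. eta r y * ((1 - rel_surv r T y) * 1) \<partial>N"
      and ?dg = "\<integral>y. eta r y * ((1 - rel_surv r T y) * g y) \<partial>N"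
    have G: "\<bar>?G\<bar> \<le> mom 1"
    proof -
      have "\<bar>?G\<bar> \<le> (\<integral>y. \<bar>eta r y * g y\<bar> \<partial>N)" by (rule integral_abs_bound)
      also have "\<dots> \<le> (\<integral>y. eta r y * y ^ 1 \<partial>N)"
      proof (rule integral_mono_AE)
        show "integrable N (\<lambda>y. \<bar>eta r y * g y\<bar>)"
          using g by (intro integrable_abs integrable_rel[OF T]) force+
        show "AE y in N. \<bar>eta r y * g y\<bar> \<le> eta r y * y ^ 1"
          using pos_N by eventually_elim (auto simp: abs_mult eta_pos less_imp_le intro!: mult_mono g)
      qed (rule integrable_mom, simp)
      finally show ?thesis by (simp add: mom_def)
    qed
    have d: "\<bar>?d\<bar> \<le> (mom 2 + erlang_moment2 r * mom 0) / (2 * T)"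
      using integral_defect_bound[OF T, of 0 "\<lambda>_. 1"] by (simp add: numeral_2_eq_2)
    have dg: "\<bar>?dg\<bar> \<le> (mom 3 + erlang_moment2 r * mom 1) / (2 * T)"
      using integral_defect_bound[OF T, of 1 g] g by (simp add: numeral_3_eq_3)
    have "\<bar>?G * ?d - mom 0 * ?dg\<bar> \<le> \<bar>?G\<bar> * \<bar>?d\<bar> + mom 0 * \<bar>?dg\<bar>"
      using m(2) abs_triangle_ineq4[of "?G * ?d" "mom 0 * ?dg"] by (simp add: abs_mult)
    also have "\<dots> \<le> mom 1 * ((mom 2 + erlang_moment2 r * mom 0) / (2 * T)) + mom 0 * ((mom 3 + erlang_moment2 r * mom 1) / (2 * T))"
      using G d dg m(2) order_trans[OF abs_ge_zero G] by (intro add_mono mult_mono) auto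
    also have "\<dots> = mom 0 * W1_const / T"
      using T m by (simp add: W1_const_def field_simps)
    finally have "\<bar>?G * ?d - mom 0 * ?dg\<bar> / (mom 0 * mass T) \<le> (mom 0 * W1_const / T) / (mom 0 * mass T)"
      using m by (intro divide_right_mono) auto
    also have "\<dots> = W1_const / (T * mass T)" using m T by (simp add: field_simps)
    finally show ?thesis
      unfolding fg using difference_eq[OF T m _ g] m by (simp add: abs_mult)
  qed
qed

text \<open>With c the mean of y under \<open>limit_law\<close>, Cov(y, y^2) is the mean of (y - c)
  (y^2 - c^2) = (y - c)^2 (y + c), which on the half-line vanishes only at y = c. Since c = mom 1 /
  mom 0, the last two terms of the expanded polynomial cancel after integration.\<close>

lemma covariance_pos:
  assumes m: "mom 0 > 0" and atom: "\<And>c. emeasure N {c} = 0"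
  shows "mom 1 * mom 2 < mom 0 * mom 3"
proof -
  define c where "c = mom 1 / mom 0"
  have "0 \<le> mom 1" unfolding mom_def
  proof (rule integral_nonneg_AE)
    show "AE y in N. 0 \<le> eta r y * y ^ 1"
      using pos_N by eventually_elim (simp add: eta_pos less_imp_le)
  qed
  then have c0: "c \<ge> 0" using m by (simp add: c_def)
  let ?f = "\<lambda>y. eta r y * y ^ 3 - c * (eta r y * y ^ 2) - c\<^sup>2 * (eta r y * y ^ 1) + c ^ 3 * (eta r y * y ^ 0)"
  have fe: "?f y = eta r y * ((y - c)\<^sup>2 * (y + c))" for y
    by (simp add: algebra_simps power2_eq_square power3_eq_cube)
  have int: "integrable N ?f"
    by (intro Bochner_Integration.integrable_add Bochner_Integration.integrable_diff integrable_mult_right integrable_mom) auto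
  have val: "(\<integral>y. ?f y \<partial>N) = mom 3 - c * mom 2 - c\<^sup>2 * mom 1 + c ^ 3 * mom 0"
    using integrable_mom[of 3] integrable_mom[of 2] integrable_mom[of 1] integrable_mom[of 0]
    by (simp add: mom_def)
  have ne: "AE y in N. y \<noteq> c"
    by (rule AE_I[where N="{c}"]) (auto simp: atom sets_N)
  have AEpos: "AE y in N. 0 < ?f y"
    using pos_N ne unfolding fe by eventually_elim (use c0 in \<open>simp add: eta_pos add_pos_nonneg\<close>)
  have "0 \<le> (\<integral>y. ?f y \<partial>N)" using AEpos by (intro integral_nonneg_AE) (auto elim: AE_mp)
  moreover have "(\<integral>y. ?f y \<partial>N) \<noteq> 0"
  proof
    assume "(\<integral>y. ?f y \<partial>N) = 0"
    then have "AE y in N. ?f y = 0"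
      using AEpos int by (subst integral_nonneg_eq_0_iff_AE[symmetric]) (auto elim: AE_mp)
    \<comment> \<open>This would make \<open>N\<close> the null measure, against mom 0 > 0.\<close>
    with AEpos have "AE y in N. False" by eventually_elim simp
    then have "(\<integral>y. eta r y * y ^ 0 \<partial>N) = (\<integral>y. 0 \<partial>N)" by (intro integral_cong_AE) auto
    then show False using m by (simp add: mom_def)
  qed
  ultimately have "0 < mom 3 - c * mom 2 - c\<^sup>2 * mom 1 + c ^ 3 * mom 0" unfolding val by simp
  then have "0 < mom 0 * (mom 3 - c * mom 2 - c\<^sup>2 * mom 1 + c ^ 3 * mom 0)" using m by simp
  also have "\<dots> = mom 0 * mom 3 - mom 1 * mom 2"
    using m by (simp add: c_def field_simps power2_eq_square power3_eq_cube)
  finally show ?thesis by simp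
qed

lemma W1_lower:
  assumes m: "mom 0 > 0" and atom: "\<And>c. emeasure N {c} = 0"
  shows "\<exists>l>0. \<forall>\<^sub>F T in at_top. ereal (l / T) \<le> W1 (pre_law T) limit_law"
proof -
  \<comment> \<open>Half the covariance of y and y^2 under \<open>limit_law\<close>.\<close>
  define l where "l = (mom 0 * mom 3 - mom 1 * mom 2) / (2 * (mom 0)\<^sup>2)"
  have l: "l > 0" using covariance_pos[OF assms] m by (simp add: l_def)
  let ?D = "\<lambda>T. (\<integral>x. 1 + x \<partial>pre_law T) - (\<integral>x. 1 + x \<partial>limit_law)"
  let ?d = "\<lambda>T. \<integral>y. eta r y * ((1 - rel_surv r T y) * y ^ 0) \<partial>N"
  let ?dg = "\<lambda>T. \<integral>y. eta r y * ((1 - rel_surv r T y) * y ^ 1) \<partial>N"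
  have ev: "\<forall>\<^sub>F T in at_top. 0 < T \<and> 0 < mass T"
    using eventually_gt_at_top[of 0] order_tendstoD(1)[OF mass_tendsto m] by eventually_elim simp
  have "((\<lambda>T. (mom 1 * (T * ?d T) - mom 0 * (T * ?dg T)) / (mom 0 * mass T)) \<longlongrightarrow>
     (mom 1 * ((mom (0 + 2) + erlang_moment2 r * mom 0) / 2) - mom 0 * ((mom (1 + 2) + erlang_moment2 r * mom 1) / 2)) / (mom 0 * mom 0)) at_top"
    using m by (intro tendsto_intros integral_defect_tendsto mass_tendsto) auto
  \<comment> \<open>The two terms containing \<open>erlang_moment2\<close> are both mom 0 * mom 1
    times it, with opposite signs.\<close>
  also have "(mom 1 * ((mom (0 + 2) + erlang_moment2 r * mom 0) / 2) - mom 0 * ((mom (1 + 2) + erlang_moment2 r * mom 1) / 2)) / (mom 0 * mom 0) = - l"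
    using m by (simp add: l_def field_simps power2_eq_square numeral_3_eq_3 numeral_2_eq_2)
  finally have lim: "((\<lambda>T. (mom 1 * (T * ?d T) - mom 0 * (T * ?dg T)) / (mom 0 * mass T)) \<longlongrightarrow> - l) at_top" .
  have "\<forall>\<^sub>F T in at_top. (mom 1 * (T * ?d T) - mom 0 * (T * ?dg T)) / (mom 0 * mass T) < - (l / 2)"
    using l by (intro order_tendstoD(2)[OF lim]) simp
  then have "\<forall>\<^sub>F T in at_top. ereal (l / 2 / T) \<le> W1 (pre_law T) limit_law"
    using ev
  proof eventually_elim
    case (elim T)
    have "?D T = (mom 1 * ?d T - mom 0 * ?dg T) / (mom 0 * mass T)"
      using difference_eq[of T "\<lambda>y. y"] elim m by (simp add: mom_def)
    then have "T * ?D T = (mom 1 * (T * ?d T) - mom 0 * (T * ?dg T)) / (mom 0 * mass T)"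
      by (simp add: algebra_simps)
    then have "T * ?D T < - (l / 2)" using elim by simp
    moreover have "T * \<bar>?D T\<bar> = \<bar>T * ?D T\<bar>" using elim by (simp add: abs_mult)
    ultimately have "l / 2 \<le> T * \<bar>?D T\<bar>" by linarith
    then have "l / 2 / T \<le> \<bar>?D T\<bar>" using elim by (simp add: field_simps)
    moreover have "(\<lambda>x. 1 + x) \<in> Lip11" by (simp add: Lip11_def)
    ultimately show ?case unfolding W1_def by (intro SUP_upper2) auto
  qed
  then show ?thesis using l by (intro exI[of _ "l / 2"]) simp
qed

theorem W1_rate:
  assumes m: "mom 0 > 0" and atom: "\<And>c. emeasure N {c} = 0" and s: "s \<ge> 0"
  shows "0 < Liminf at_top (\<lambda>t. ereal t * W1 (pre_law (t - s)) limit_law)"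
    "Limsup at_top (\<lambda>t. ereal t * W1 (pre_law (t - s)) limit_law) < \<infinity>"
proof -
  have shift: "filterlim (\<lambda>t. t - s) at_top at_top" by real_asymp
  obtain l where l: "l > 0" "\<forall>\<^sub>F T in at_top. ereal (l / T) \<le> W1 (pre_law T) limit_law"
    using W1_lower[OF m atom] by blast
  have "\<forall>\<^sub>F t in at_top. ereal (l / (t - s)) \<le> W1 (pre_law (t - s)) limit_law"
    using l(2) shift unfolding filterlim_iff by blast
  then have "\<forall>\<^sub>F t in at_top. ereal l \<le> ereal t * W1 (pre_law (t - s)) limit_law"
    using eventually_gt_at_top[of s]
  proof eventually_elim
    case (elim t)
    have "l \<le> t * (l / (t - s))" using elim l(1) s by (simp add: field_simps)
    then have "ereal l \<le> ereal t * ereal (l / (t - s))" by simp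
    also have "\<dots> \<le> ereal t * W1 (pre_law (t - s)) limit_law"
      using elim s by (intro ereal_mult_left_mono) auto
    finally show ?case .
  qed
  then have "ereal l \<le> Liminf at_top (\<lambda>t. ereal t * W1 (pre_law (t - s)) limit_law)"
    by (rule Liminf_bounded)
  then show "0 < Liminf at_top (\<lambda>t. ereal t * W1 (pre_law (t - s)) limit_law)"
    using l(1) by (metis ereal_less(2) less_le_trans)
  have "\<forall>\<^sub>F T in at_top. mom 0 / 2 < mass T"
    using m by (intro order_tendstoD(1)[OF mass_tendsto]) simp
  then have "\<forall>\<^sub>F t in at_top. mom 0 / 2 < mass (t - s)"
    using shift unfolding filterlim_iff by blast
  \<comment> \<open>The factor 4 is 2 * 2: t > 2 s gives t / (t - s) \<le> 2, and mass > mom 0 / 2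
    gives 1 / mass \<le> 2 / mom 0.\<close>
  then have "\<forall>\<^sub>F t in at_top. ereal t * W1 (pre_law (t - s)) limit_law \<le> ereal (4 * \<bar>W1_const\<bar> / mom 0)"
    using eventually_gt_at_top[of s] eventually_gt_at_top[of "2 * s"]
  proof eventually_elim
    case (elim t)
    then have pos: "t - s > 0" "mass (t - s) > 0" using m by auto
    have "ereal t * W1 (pre_law (t - s)) limit_law \<le> ereal t * ereal (W1_const / ((t - s) * mass (t - s)))"
      using elim s pos m by (intro ereal_mult_left_mono W1_upper) auto
    also have "\<dots> = ereal (W1_const * (t / (t - s)) * (1 / mass (t - s)))" by simp
    also have "\<dots> \<le> ereal (\<bar>W1_const\<bar> * 2 * (2 / mom 0))"
    proof -
      have "t / (t - s) \<le> 2" "1 / mass (t - s) \<le> 2 / mom 0"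
        using elim pos m by (auto simp: field_simps)
      then have "W1_const * (t / (t - s)) * (1 / mass (t - s)) \<le> \<bar>W1_const\<bar> * 2 * (2 / mom 0)"
        using elim pos s m by (intro mult_mono) auto
      then show ?thesis by (simp only: ereal_less_eq)
    qed
    finally show ?case by simp
  qed
  then have "Limsup at_top (\<lambda>t. ereal t * W1 (pre_law (t - s)) limit_law) \<le> ereal (4 * \<bar>W1_const\<bar> / mom 0)"
    by (rule Limsup_bounded)
  then show "Limsup at_top (\<lambda>t. ereal t * W1 (pre_law (t - s)) limit_law) < \<infinity>"
    by (rule le_less_trans) simp
qed

end

section \<open>Independent increments\<close>

text \<open>Unlike \<open>indep_var\<close>, this relates random variables with values in different types.\<close>

definition (in prob_space) indep_rv :: "'b measure \<Rightarrow> ('a \<Rightarrow> 'b) \<Rightarrow> 'c measure \<Rightarrow> ('a \<Rightarrow> 'c) \<Rightarrow> bool" where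
  "indep_rv S X T Y \<longleftrightarrow> X \<in> M \<rightarrow>\<^sub>M S \<and> Y \<in> M \<rightarrow>\<^sub>M T \<and>
     distr M S X \<Otimes>\<^sub>M distr M T Y = distr M (S \<Otimes>\<^sub>M T) (\<lambda>\<omega>. (X \<omega>, Y \<omega>))"

lemma (in prob_space) indep_rvI:
  assumes [measurable]: "X \<in> M \<rightarrow>\<^sub>M S" "Y \<in> M \<rightarrow>\<^sub>M T"
    and eq: "\<And>A C. A \<in> sets S \<Longrightarrow> C \<in> sets T \<Longrightarrow>
      prob {\<omega>\<in>space M. X \<omega> \<in> A \<and> Y \<omega> \<in> C} = prob {\<omega>\<in>space M. X \<omega> \<in> A} * prob {\<omega>\<in>space M. Y \<omega> \<in> C}"
  shows "indep_rv S X T Y"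
  unfolding indep_rv_def
proof (intro conjI assms(1,2) pair_measure_eqI)
  interpret X: prob_space "distr M S X" by (rule prob_space_distr) simp
  interpret Y: prob_space "distr M T Y" by (rule prob_space_distr) simp
  show "sigma_finite_measure (distr M S X)" "sigma_finite_measure (distr M T Y)"
    by (rule X.sigma_finite_measure_axioms Y.sigma_finite_measure_axioms)+
  fix A C assume "A \<in> sets (distr M S X)" "C \<in> sets (distr M T Y)"
  then have [measurable]: "A \<in> sets S" "C \<in> sets T" by auto
  have "emeasure (distr M S X) A = prob {\<omega>\<in>space M. X \<omega> \<in> A}"
    "emeasure (distr M T Y) C = prob {\<omega>\<in>space M. Y \<omega> \<in> C}"
    "emeasure (distr M (S \<Otimes>\<^sub>M T) (\<lambda>\<omega>. (X \<omega>, Y \<omega>))) (A \<times> C) = prob {\<omega>\<in>space M. X \<omega> \<in> A \<and> Y \<omega> \<in> C}"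
    by (auto simp: emeasure_distr emeasure_eq_measure intro!: arg_cong[where f=prob])
  then show "emeasure (distr M S X) A * emeasure (distr M T Y) C
      = emeasure (distr M (S \<Otimes>\<^sub>M T) (\<lambda>\<omega>. (X \<omega>, Y \<omega>))) (A \<times> C)"
    using eq[of A C] by (simp add: ennreal_mult)
qed (simp cong: sets_pair_measure_cong)

lemma (in prob_space) indep_rvD:
  assumes ind: "indep_rv S X T Y" and [measurable]: "A \<in> sets S" "C \<in> sets T"
  shows "prob {\<omega>\<in>space M. X \<omega> \<in> A \<and> Y \<omega> \<in> C} = prob {\<omega>\<in>space M. X \<omega> \<in> A} * prob {\<omega>\<in>space M. Y \<omega> \<in> C}"
proof -
  have [measurable]: "X \<in> M \<rightarrow>\<^sub>M S" "Y \<in> M \<rightarrow>\<^sub>M T"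
    and eq: "distr M S X \<Otimes>\<^sub>M distr M T Y = distr M (S \<Otimes>\<^sub>M T) (\<lambda>\<omega>. (X \<omega>, Y \<omega>))"
    using ind by (auto simp: indep_rv_def)
  interpret Y: prob_space "distr M T Y" by (rule prob_space_distr) simp
  have "emeasure (distr M S X \<Otimes>\<^sub>M distr M T Y) (A \<times> C) = emeasure (distr M S X) A * emeasure (distr M T Y) C"
    by (rule Y.emeasure_pair_measure_Times) auto
  moreover have "emeasure (distr M S X) A = prob {\<omega>\<in>space M. X \<omega> \<in> A}"
    "emeasure (distr M T Y) C = prob {\<omega>\<in>space M. Y \<omega> \<in> C}"
    "emeasure (distr M (S \<Otimes>\<^sub>M T) (\<lambda>\<omega>. (X \<omega>, Y \<omega>))) (A \<times> C) = prob {\<omega>\<in>space M. X \<omega> \<in> A \<and> Y \<omega> \<in> C}"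
    by (auto simp: emeasure_distr emeasure_eq_measure intro!: arg_cong[where f=prob])
  ultimately show ?thesis
    unfolding eq by (simp add: ennreal_mult[symmetric] del: ennreal_mult'')
qed

text \<open>By Fubini: with the value x of X frozen, the section of the event at x concerns D only
  and is independent of E. It merges the two sources of independence, with X the initial value, D
  the past increments and E the next one.\<close>

lemma (in prob_space) indep_rv_pair_left:
  assumes XDE: "indep_rv N X (N1 \<Otimes>\<^sub>M N2) (\<lambda>\<omega>. (D \<omega>, E \<omega>))" and DE: "indep_rv N1 D N2 E"
  shows "indep_rv (N \<Otimes>\<^sub>M N1) (\<lambda>\<omega>. (X \<omega>, D \<omega>)) N2 E"
proof -
  have [measurable]: "X \<in> M \<rightarrow>\<^sub>M N" "D \<in> M \<rightarrow>\<^sub>M N1" "E \<in> M \<rightarrow>\<^sub>M N2"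
    using XDE DE by (auto simp: indep_rv_def)
  interpret D: prob_space "distr M N1 D" by (rule prob_space_distr) simp
  interpret E: prob_space "distr M N2 E" by (rule prob_space_distr) simp
  interpret XD: prob_space "distr M (N \<Otimes>\<^sub>M N1) (\<lambda>\<omega>. (X \<omega>, D \<omega>))" by (rule prob_space_distr) simp
  interpret DE: prob_space "distr M (N1 \<Otimes>\<^sub>M N2) (\<lambda>\<omega>. (D \<omega>, E \<omega>))" by (rule prob_space_distr) simp
  have eqDE: "distr M N1 D \<Otimes>\<^sub>M distr M N2 E = distr M (N1 \<Otimes>\<^sub>M N2) (\<lambda>\<omega>. (D \<omega>, E \<omega>))"
    using DE by (simp add: indep_rv_def)
  have eqX: "distr M N X \<Otimes>\<^sub>M distr M (N1 \<Otimes>\<^sub>M N2) (\<lambda>\<omega>. (D \<omega>, E \<omega>))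
      = distr M (N \<Otimes>\<^sub>M (N1 \<Otimes>\<^sub>M N2)) (\<lambda>\<omega>. (X \<omega>, D \<omega>, E \<omega>))"
    using XDE by (simp add: indep_rv_def)
  have "distr M (N \<Otimes>\<^sub>M N1) (\<lambda>\<omega>. (X \<omega>, D \<omega>)) \<Otimes>\<^sub>M distr M N2 E
      = distr M ((N \<Otimes>\<^sub>M N1) \<Otimes>\<^sub>M N2) (\<lambda>\<omega>. ((X \<omega>, D \<omega>), E \<omega>))"
  proof (rule pair_measure_eqI)
    fix A B assume "A \<in> sets (distr M (N \<Otimes>\<^sub>M N1) (\<lambda>\<omega>. (X \<omega>, D \<omega>)))" "B \<in> sets (distr M N2 E)"
    then have A[measurable]: "A \<in> sets (N \<Otimes>\<^sub>M N1)" and B[measurable]: "B \<in> sets N2" by auto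
    have 1: "emeasure (distr M N1 D) {d\<in>space N1. (x, d) \<in> A} * emeasure (distr M N2 E) B
       = emeasure (distr M (N1 \<Otimes>\<^sub>M N2) (\<lambda>\<omega>. (D \<omega>, E \<omega>))) ({d\<in>space N1. (x, d) \<in> A} \<times> B)" if "x \<in> space N" for x
      using that unfolding eqDE[symmetric] by (subst E.emeasure_pair_measure_Times) auto
    have Aset: "{z \<in> space (N \<Otimes>\<^sub>M (N1 \<Otimes>\<^sub>M N2)). (fst z, fst (snd z)) \<in> A \<and> snd (snd z) \<in> B} \<in> sets (N \<Otimes>\<^sub>M (N1 \<Otimes>\<^sub>M N2))"
      by measurable
    have eqXD: "distr M N X \<Otimes>\<^sub>M distr M N1 D = distr M (N \<Otimes>\<^sub>M N1) (\<lambda>\<omega>. (X \<omega>, D \<omega>))"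
    proof -
      have "indep_rv N X N1 D"
      proof (rule indep_rvI)
        fix A C assume [measurable]: "A \<in> sets N" "C \<in> sets N1"
        have "prob {\<omega> \<in> space M. X \<omega> \<in> A \<and> (D \<omega>, E \<omega>) \<in> C \<times> space N2}
          = prob {\<omega> \<in> space M. X \<omega> \<in> A} * prob {\<omega> \<in> space M. (D \<omega>, E \<omega>) \<in> C \<times> space N2}"
          by (rule indep_rvD[OF XDE]) auto
        then show "prob {\<omega> \<in> space M. X \<omega> \<in> A \<and> D \<omega> \<in> C} = prob {\<omega> \<in> space M. X \<omega> \<in> A} * prob {\<omega> \<in> space M. D \<omega> \<in> C}"
          using measurable_space[OF \<open>E \<in> M \<rightarrow>\<^sub>M N2\<close>] by (simp cong: conj_cong)
      qed auto
      then show ?thesis by (simp add: indep_rv_def)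
    qed
    have "emeasure (distr M ((N \<Otimes>\<^sub>M N1) \<Otimes>\<^sub>M N2) (\<lambda>\<omega>. ((X \<omega>, D \<omega>), E \<omega>))) (A \<times> B)
       = emeasure M {\<omega>\<in>space M. (X \<omega>, D \<omega>) \<in> A \<and> E \<omega> \<in> B}"
      by (subst emeasure_distr) (auto intro!: arg_cong[where f="emeasure M"])
    also have "\<dots> = emeasure (distr M (N \<Otimes>\<^sub>M (N1 \<Otimes>\<^sub>M N2)) (\<lambda>\<omega>. (X \<omega>, D \<omega>, E \<omega>)))
        {z \<in> space (N \<Otimes>\<^sub>M (N1 \<Otimes>\<^sub>M N2)). (fst z, fst (snd z)) \<in> A \<and> snd (snd z) \<in> B}"
      using Aset by (subst emeasure_distr)
        (auto intro!: arg_cong[where f="emeasure M"] simp: space_pair_measure dest: measurable_space[OF \<open>X \<in> M \<rightarrow>\<^sub>M N\<close>]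
          measurable_space[OF \<open>D \<in> M \<rightarrow>\<^sub>M N1\<close>] measurable_space[OF \<open>E \<in> M \<rightarrow>\<^sub>M N2\<close>])
    also have "\<dots> = (\<integral>\<^sup>+x. emeasure (distr M (N1 \<Otimes>\<^sub>M N2) (\<lambda>\<omega>. (D \<omega>, E \<omega>)))
        (Pair x -` {z \<in> space (N \<Otimes>\<^sub>M (N1 \<Otimes>\<^sub>M N2)). (fst z, fst (snd z)) \<in> A \<and> snd (snd z) \<in> B}) \<partial>distr M N X)"
      unfolding eqX[symmetric] using Aset by (subst DE.emeasure_pair_measure_alt) auto
    also have "\<dots> = (\<integral>\<^sup>+x. emeasure (distr M N1 D) {d\<in>space N1. (x, d) \<in> A} * emeasure (distr M N2 E) B \<partial>distr M N X)"
      using sets.sets_into_space[OF B]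
      by (intro nn_integral_cong) (auto simp: 1 space_pair_measure intro!: arg_cong2[where f=emeasure])
    also have "\<dots> = (\<integral>\<^sup>+x. emeasure (distr M N1 D) {d\<in>space N1. (x, d) \<in> A} \<partial>distr M N X) * emeasure (distr M N2 E) B"
      by (subst nn_integral_multc) (auto intro!: D.measurable_emeasure simp: space_pair_measure)
    also have "(\<integral>\<^sup>+x. emeasure (distr M N1 D) {d\<in>space N1. (x, d) \<in> A} \<partial>distr M N X)
        = emeasure (distr M (N \<Otimes>\<^sub>M N1) (\<lambda>\<omega>. (X \<omega>, D \<omega>))) A"
      unfolding eqXD[symmetric] using sets.sets_into_space[OF A]
      by (subst D.emeasure_pair_measure_alt)
        (auto intro!: nn_integral_cong arg_cong2[where f=emeasure] simp: space_pair_measure)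
    finally show "emeasure (distr M (N \<Otimes>\<^sub>M N1) (\<lambda>\<omega>. (X \<omega>, D \<omega>))) A * emeasure (distr M N2 E) B
      = emeasure (distr M ((N \<Otimes>\<^sub>M N1) \<Otimes>\<^sub>M N2) (\<lambda>\<omega>. ((X \<omega>, D \<omega>), E \<omega>))) (A \<times> B)" by simp
  qed (auto intro: E.sigma_finite_measure_axioms XD.sigma_finite_measure_axioms cong: sets_pair_measure_cong)
  then show ?thesis by (simp add: indep_rv_def)
qed

text \<open>The freezing lemma: by independence the expectation may be taken over Y first, with X
  held fixed.\<close>

lemma (in prob_space) indep_rv_integral_eq:
  fixes f :: "'b \<times> 'c \<Rightarrow> real"
  assumes ind: "indep_rv S X T Y" and f[measurable]: "f \<in> borel_measurable (S \<Otimes>\<^sub>M T)"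
    and bd: "\<And>z. \<bar>f z\<bar> \<le> c"
  shows "(\<integral>\<omega>. f (X \<omega>, Y \<omega>) \<partial>M) = (\<integral>\<omega>. (\<integral>y. f (X \<omega>, y) \<partial>distr M T Y) \<partial>M)"
proof -
  have [measurable]: "X \<in> M \<rightarrow>\<^sub>M S" "Y \<in> M \<rightarrow>\<^sub>M T"
    using ind by (auto simp: indep_rv_def)
  interpret X: prob_space "distr M S X" by (rule prob_space_distr) simp
  interpret Y: prob_space "distr M T Y" by (rule prob_space_distr) simp
  interpret P: pair_prob_space "distr M S X" "distr M T Y" ..
  have eq: "distr M S X \<Otimes>\<^sub>M distr M T Y = distr M (S \<Otimes>\<^sub>M T) (\<lambda>x. (X x, Y x))"
    using ind by (simp add: indep_rv_def)
  have int: "integrable (distr M S X \<Otimes>\<^sub>M distr M T Y) f"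
    by (rule P.integrable_const_bound[where B=c]) (use bd in auto)
  have "(\<integral>\<omega>. f (X \<omega>, Y \<omega>) \<partial>M) = (\<integral>z. f z \<partial>(distr M S X \<Otimes>\<^sub>M distr M T Y))"
    unfolding eq by (subst integral_distr) auto
  also have "\<dots> = (\<integral>x. (\<integral>y. f (x, y) \<partial>distr M T Y) \<partial>distr M S X)"
    using P.integral_fst'[OF int] by simp
  also have "\<dots> = (\<integral>\<omega>. (\<integral>y. f (X \<omega>, y) \<partial>distr M T Y) \<partial>M)"
    by (subst integral_distr) auto
  finally show ?thesis .
qed

section \<open>The drifted Brownian motion and its Markov property\<close>

locale drifted_bm = prob_space M for M :: "'a measure" +
  fixes B :: "real \<Rightarrow> 'a \<Rightarrow> real" and X0 :: "'a \<Rightarrow> real" and r :: real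
  assumes bm: "std_BM M B" and X0[measurable]: "X0 \<in> borel_measurable M"
    and indep_X0: "indep_set
       (sigma_sets (space M) {X0 -` A \<inter> space M | A. A \<in> sets borel})
       (sigma_sets (space M) {B t -` A \<inter> space M | t A. 0 \<le> t \<and> A \<in> sets borel})"
    and r_pos: "r > 0"
begin

abbreviation X :: "real \<Rightarrow> 'a \<Rightarrow> real" where "X \<equiv> Xp r X0 B"

lemma B_measurable[measurable]: "B t \<in> borel_measurable M"
  using bm by (simp add: std_BM_def)

lemma X_measurable[measurable]: "X t \<in> borel_measurable M"
  unfolding Xp_def[abs_def] by simp

lemma B_zero: "\<omega> \<in> space M \<Longrightarrow> B 0 \<omega> = 0"
  using bm by (simp add: std_BM_def)

lemma continuous_B: "\<omega> \<in> space M \<Longrightarrow> continuous_on {0..} (\<lambda>t. B t \<omega>)"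
  using bm by (simp add: std_BM_def)

lemma continuous_X: "\<omega> \<in> space M \<Longrightarrow> continuous_on {0..} (\<lambda>t. X t \<omega>)"
  unfolding Xp_def by (intro continuous_intros continuous_B)

lemma distributed_increment:
  "0 \<le> s \<Longrightarrow> s < t \<Longrightarrow>
    distributed M lborel (\<lambda>\<omega>. B t \<omega> - B s \<omega>) (\<lambda>x. ennreal (normal_density 0 (sqrt (t - s)) x))"
  using bm unfolding std_BM_def by blast

lemma indep_increments:
  "0 \<le> ts 0 \<Longrightarrow> (\<And>i. i < n \<Longrightarrow> ts i < ts (Suc i)) \<Longrightarrow>
    indep_vars (\<lambda>_. borel) (\<lambda>i \<omega>. B (ts (Suc i)) \<omega> - B (ts i) \<omega>) {..<n}" for n :: nat
  using bm unfolding std_BM_def by blast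

text \<open>Generated by the initial value and the increments rather than by the values of the path,
  so that the hypotheses on independence apply directly; the values are recovered by
  telescoping.\<close>

definition past :: "(nat \<Rightarrow> real) \<Rightarrow> nat \<Rightarrow> 'a measure" where
  "past ts k = vimage_algebra (space M)
     (\<lambda>\<omega>. (X0 \<omega>, \<lambda>i\<in>{..<k}. B (ts (Suc i)) \<omega> - B (ts i) \<omega>)) (borel \<Otimes>\<^sub>M PiM {..<k} (\<lambda>_. borel))"

lemma space_past[simp]: "space (past ts k) = space M"
  by (simp add: past_def)

lemma past_vector_measurable:
  "(\<lambda>\<omega>. (X0 \<omega>, \<lambda>i\<in>{..<k}. B (ts (Suc i)) \<omega> - B (ts i) \<omega>)) \<in> past ts k \<rightarrow>\<^sub>M borel \<Otimes>\<^sub>M PiM {..<k} (\<lambda>_. borel)"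
  unfolding past_def by (rule measurable_vimage_algebra1) (auto simp: space_pair_measure space_PiM)

lemma X_past_measurable:
  assumes "ts 0 = 0" "j \<le> k"
  shows "X (ts j) \<in> borel_measurable (past ts k)"
proof -
  have m: "X0 \<in> borel_measurable (past ts k)"
    using measurable_compose[OF past_vector_measurable measurable_fst] by simp
  have d: "(\<lambda>\<omega>. B (ts (Suc i)) \<omega> - B (ts i) \<omega>) \<in> borel_measurable (past ts k)" if "i < k" for i
  proof -
    have "(\<lambda>\<omega>. (\<lambda>i\<in>{..<k}. B (ts (Suc i)) \<omega> - B (ts i) \<omega>) i) \<in> borel_measurable (past ts k)"
      by (rule measurable_compose[OF _ measurable_component_singleton[where I="{..<k}" and M="\<lambda>_. borel"]])
        (use that measurable_compose[OF past_vector_measurable measurable_snd, of ts k] in \<open>simp_all add: restrict_def\<close>)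
    then show ?thesis using that by simp
  qed
  have "(\<lambda>\<omega>. X0 \<omega> + (\<Sum>i<j. B (ts (Suc i)) \<omega> - B (ts i) \<omega>) - r * ts j) \<in> borel_measurable (past ts k)"
    using assms by (intro borel_measurable_diff borel_measurable_add m borel_measurable_sum d) auto
  then show ?thesis
    by (rule measurable_cong[THEN iffD1, rotated])
      (simp add: Xp_def sum_lessThan_telescope[of "\<lambda>i. B (ts i) _"] B_zero assms(1))
qed

lemma past_subset: 
  shows "sets (past ts k) \<subseteq> sets M"
proof -
  let ?P = "PiM {..<k} (\<lambda>_. borel) :: (nat \<Rightarrow> real) measure"
  have "(\<lambda>\<omega>. (X0 \<omega>, \<lambda>i\<in>{..<k}. B (ts (Suc i)) \<omega> - B (ts i) \<omega>)) \<in> M \<rightarrow>\<^sub>M borel \<Otimes>\<^sub>M ?P"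
    by measurable
  then show ?thesis
    unfolding past_def by (subst sets_vimage_algebra2) (auto simp: space_pair_measure space_PiM intro: measurable_sets)
qed

lemma measurable_from_past: "Y \<in> past ts k \<rightarrow>\<^sub>M K \<Longrightarrow> Y \<in> M \<rightarrow>\<^sub>M K"
  using past_subset[of ts k] measurable_space[of Y "past ts k" K] measurable_sets[of Y "past ts k" K]
  by (auto intro!: measurableI)

text \<open>Independence of increments separates the past increments from the jump,
  \<open>indep_X0\<close> separates \<open>X0\<close> from both, and
  \<open>indep_rv_pair_left\<close> regroups them.\<close>

lemma indep_past_increment:
  assumes ts: "ts 0 = 0" "\<And>i. ts i < ts (Suc i)" and k: "k < n"
    and Y: "Y \<in> past ts k \<rightarrow>\<^sub>M K"
  shows "indep_rv K Y borel (\<lambda>\<omega>. B (ts n) \<omega> - B (ts k) \<omega>)"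
proof -
  let ?D = "\<lambda>\<omega>. \<lambda>i\<in>{..<k}. B (ts (Suc i)) \<omega> - B (ts i) \<omega>"
  let ?E = "\<lambda>\<omega>. B (ts n) \<omega> - B (ts k) \<omega>"
  let ?V = "\<lambda>\<omega>. (X0 \<omega>, ?D \<omega>)"
  let ?P = "PiM {..<k} (\<lambda>_. borel) :: (nat \<Rightarrow> real) measure"
  have mono: "ts i < ts j" if "i < j" for i j
    using lift_Suc_mono_less[of ts, OF ts(2) that] .
  have nn: "0 \<le> ts i" for i
    using mono[of 0 i] ts(1) by (cases i) auto
  define Z where "Z i \<omega> = (if i < k then B (ts (Suc i)) \<omega> - B (ts i) \<omega> else ?E \<omega>)" for i \<omega>
  have iv: "indep_vars (\<lambda>_. borel) Z {..<Suc k}"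
  proof -
    \<comment> \<open>This sequence follows \<open>ts\<close> up to index k and then goes to ts n at
      once, so that its first k + 1 increments are the past ones and \<open>?E\<close>. It needs to
      increase only up to index k + 1.\<close>
    define us where "us i = (if i \<le> k then ts i else ts n)" for i
    have "indep_vars (\<lambda>_. borel) (\<lambda>i \<omega>. B (us (Suc i)) \<omega> - B (us i) \<omega>) {..<Suc k}"
      by (rule indep_increments) (use mono k ts nn in \<open>auto simp: us_def less_Suc_eq\<close>)
    also have "?this \<longleftrightarrow> indep_vars (\<lambda>_. borel) Z {..<Suc k}"
      by (rule indep_vars_cong) (auto simp: us_def Z_def fun_eq_iff less_Suc_eq)
    finally show ?thesis .
  qed
  have "indep_var ?P (\<lambda>\<omega>. \<lambda>i\<in>{..<k}. Z i \<omega>) (PiM {k} (\<lambda>_. borel)) (\<lambda>\<omega>. \<lambda>i\<in>{k}. Z i \<omega>)"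
    by (rule indep_var_restrict[OF iv]) auto
  moreover have Deq: "(\<lambda>\<omega>. \<lambda>i\<in>{..<k}. Z i \<omega>) = ?D"
    by (auto simp: Z_def fun_eq_iff)
  ultimately have iv2: "indep_var ?P ?D (PiM {k} (\<lambda>_. borel)) (\<lambda>\<omega>. \<lambda>i\<in>{k}. Z i \<omega>)" by simp
  have DE: "indep_rv ?P ?D borel ?E"
  proof (rule indep_rvI)
    fix A and C :: "real set" assume A: "A \<in> sets ?P" and [measurable]: "C \<in> sets borel"
    let ?C = "{f\<in>space (PiM {k} (\<lambda>_. borel)). f k \<in> C}"
    have "?C \<in> sets (PiM {k} (\<lambda>_. borel))" by measurable
    from indep_varD[OF iv2 A this]
    show "prob {\<omega> \<in> space M. ?D \<omega> \<in> A \<and> ?E \<omega> \<in> C} = prob {\<omega> \<in> space M. ?D \<omega> \<in> A} * prob {\<omega> \<in> space M. ?E \<omega> \<in> C}"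
      by (simp add: Z_def vimage_def Int_def space_PiM conj_commute)
  qed measurable
  \<comment> \<open>Makes a measure space out of the second family in \<open>indep_X0\<close>, so
    that the vector of increments can be shown measurable by the usual rules.\<close>
  define MB where "MB = sigma (space M) {B t -` A \<inter> space M | t A. 0 \<le> t \<and> A \<in> sets (borel :: real measure)}"
  have MBspace[simp]: "space MB = space M" unfolding MB_def by (rule space_measure_of) auto
  have MBsets: "sets MB = sigma_sets (space M) {B t -` A \<inter> space M | t A. 0 \<le> t \<and> A \<in> sets (borel :: real measure)}"
    unfolding MB_def by (rule sets_measure_of) auto
  have MBm: "B t \<in> borel_measurable MB" if "t \<ge> 0" for t
    by (rule measurableI) (use that in \<open>auto simp: MBsets\<close>)
  have DEm: "(\<lambda>\<omega>. (?D \<omega>, ?E \<omega>)) \<in> MB \<rightarrow>\<^sub>M ?P \<Otimes>\<^sub>M borel"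
    by (intro measurable_Pair measurable_restrict borel_measurable_diff MBm nn)
  have X0DE: "indep_rv borel X0 (?P \<Otimes>\<^sub>M borel) (\<lambda>\<omega>. (?D \<omega>, ?E \<omega>))"
  proof (rule indep_rvI)
    fix A :: "real set" and C assume A: "A \<in> sets borel" and C: "C \<in> sets (?P \<Otimes>\<^sub>M (borel :: real measure))"
    have "(\<lambda>\<omega>. (?D \<omega>, ?E \<omega>)) -` C \<inter> space M \<in> sets MB"
      using measurable_sets[OF DEm C] by simp
    then have "prob ((X0 -` A \<inter> space M) \<inter> ((\<lambda>\<omega>. (?D \<omega>, ?E \<omega>)) -` C \<inter> space M))
      = prob (X0 -` A \<inter> space M) * prob ((\<lambda>\<omega>. (?D \<omega>, ?E \<omega>)) -` C \<inter> space M)"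
      using A by (intro indep_setD[OF indep_X0]) (auto simp: MBsets)
    then show "prob {\<omega> \<in> space M. X0 \<omega> \<in> A \<and> (?D \<omega>, ?E \<omega>) \<in> C}
      = prob {\<omega> \<in> space M. X0 \<omega> \<in> A} * prob {\<omega> \<in> space M. (?D \<omega>, ?E \<omega>) \<in> C}"
      by (simp add: vimage_def Int_def conj_ac cong: conj_cong)
  qed measurable
  have VE: "indep_rv (borel \<Otimes>\<^sub>M ?P) ?V borel ?E"
    by (rule indep_rv_pair_left[OF X0DE DE])
  have sub: "sets (past ts k) = {?V -` A \<inter> space M | A. A \<in> sets (borel \<Otimes>\<^sub>M ?P)}"
    unfolding past_def by (subst sets_vimage_algebra2) (auto simp: space_pair_measure space_PiM)
  show ?thesis
  proof (rule indep_rvI)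
    fix A and C :: "real set" assume A: "A \<in> sets K" and C: "C \<in> sets borel"
    obtain A' where A': "A' \<in> sets (borel \<Otimes>\<^sub>M ?P)" "Y -` A \<inter> space M = ?V -` A' \<inter> space M"
      using measurable_sets[OF Y A] sub by auto
    have "{\<omega> \<in> space M. Y \<omega> \<in> A} = {\<omega> \<in> space M. ?V \<omega> \<in> A'}" 
      "{\<omega> \<in> space M. Y \<omega> \<in> A \<and> ?E \<omega> \<in> C} = {\<omega> \<in> space M. ?V \<omega> \<in> A' \<and> ?E \<omega> \<in> C}"
      using A'(2) by (auto simp: vimage_def set_eq_iff)
    then show "prob {\<omega> \<in> space M. Y \<omega> \<in> A \<and> ?E \<omega> \<in> C} = prob {\<omega> \<in> space M. Y \<omega> \<in> A} * prob {\<omega> \<in> space M. ?E \<omega> \<in> C}"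
      using indep_rvD[OF VE A'(1) C] by simp
  qed (use measurable_from_past[OF Y] in simp_all)
qed

lemma markov_step:
  assumes ts: "ts 0 = 0" "\<And>i. ts i < ts (Suc i)" and k: "k < n"
    and G: "G \<in> borel_measurable (past ts k)" "\<And>\<omega>. \<bar>G \<omega>\<bar> \<le> c"
    and h[measurable]: "h \<in> borel_measurable borel" and hb: "\<And>x. \<bar>h x\<bar> \<le> d"
  shows "(\<integral>\<omega>. G \<omega> * h (X (ts n) \<omega>) \<partial>M) = (\<integral>\<omega>. G \<omega> * drift_op r h (ts n - ts k) (X (ts k) \<omega>) \<partial>M)"
proof -
  have mono: "ts i < ts j" if "i < j" for i j
    using lift_Suc_mono_less[of ts, OF ts(2) that] .
  have nn: "0 \<le> ts i" for i
    using mono[of 0 i] ts(1) by (cases i) auto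
  let ?E = "\<lambda>\<omega>. B (ts n) \<omega> - B (ts k) \<omega>"
  have ind: "indep_rv (borel \<Otimes>\<^sub>M borel) (\<lambda>\<omega>. (G \<omega>, X (ts k) \<omega>)) borel ?E"
    by (rule indep_past_increment[OF ts k]) (intro measurable_Pair G X_past_measurable ts order.refl)
  have dist: "distr M borel ?E = density lborel (\<lambda>x. ennreal (normal_density 0 (sqrt (ts n - ts k)) x))"
    using distributed_increment[OF nn mono[OF k]] unfolding distributed_def
    by (metis distr_cong sets_lborel)
  \<comment> \<open>The indicator makes \<open>?f\<close> bounded on the whole product space, as
    \<open>indep_rv_integral_eq\<close> demands; it equals 1 along G because
    \<open>\<bar>G \<omega>\<bar> \<le> c\<close>.\<close>
  let ?f = "\<lambda>z. fst (fst z) * h (snd (fst z) + snd z - r * (ts n - ts k)) * indicator {-c..c} (fst (fst z))" 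
  have "(\<integral>\<omega>. G \<omega> * h (X (ts n) \<omega>) \<partial>M) = (\<integral>\<omega>. ?f ((G \<omega>, X (ts k) \<omega>), ?E \<omega>) \<partial>M)"
    using G(2) by (intro Bochner_Integration.integral_cong) (auto simp: Xp_def algebra_simps abs_le_iff minus_le_iff)
  also have "\<dots> = (\<integral>\<omega>. (\<integral>y. ?f ((G \<omega>, X (ts k) \<omega>), y) \<partial>distr M borel ?E) \<partial>M)"
  proof (rule indep_rv_integral_eq[OF ind])
    fix z :: "(real \<times> real) \<times> real"
    have "c \<ge> 0" using G(2)[of undefined] by linarith
    then show "\<bar>?f z\<bar> \<le> c * d"
      using hb[of "snd (fst z) + snd z - r * (ts n - ts k)"]
      by (auto simp: abs_mult indicator_def intro!: mult_mono)
  qed measurable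
  also have "\<dots> = (\<integral>\<omega>. G \<omega> * drift_op r h (ts n - ts k) (X (ts k) \<omega>) \<partial>M)"
  proof (rule Bochner_Integration.integral_cong[OF refl])
    fix \<omega>
    have "G \<omega> \<in> {-c..c}" using G(2)[of \<omega>] by auto
    then show "(\<integral>y. ?f ((G \<omega>, X (ts k) \<omega>), y) \<partial>distr M borel ?E) = G \<omega> * drift_op r h (ts n - ts k) (X (ts k) \<omega>)"
      unfolding dist drift_op_def
      by (subst integral_density) (auto simp: mult_ac)
  qed
  finally show ?thesis .
qed

end

section \<open>Killing along grids\<close>

lemma mesh_cover:
  fixes t :: "nat \<Rightarrow> real"
  assumes "\<And>k. t (Suc k) - t k \<le> d" "d \<ge> 0" "t 0 \<le> v" "v \<le> t K"
  shows "\<exists>k\<le>K. \<bar>t k - v\<bar> \<le> d"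
  using assms(4)
proof (induction K)
  case 0
  then show ?case using assms(2,3) by (intro exI[of _ 0]) auto
next
  case (Suc K)
  show ?case
  proof (cases "v \<le> t K")
    case True
    then show ?thesis using Suc.IH le_Suc_eq by blast
  next
    case False
    then have "\<bar>t K - v\<bar> \<le> d" using Suc.prems assms(1)[of K] by linarith
    then show ?thesis using le_SucI by blast
  qed
qed

text \<open>The margin 1 / (j + 1) has to be common to all grids: strict positivity at grid points
  alone allows f to touch 0 in between, whereas continuity carries a uniform margin over to every v.
  Conversely the minimum over the compact interval supplies the margin.\<close>

lemma pos_on_interval_iff_meshes:
  fixes t :: "nat \<Rightarrow> nat \<Rightarrow> real" and f :: "real \<Rightarrow> real"
  assumes t0: "\<And>n. t n 0 = 0" and tK: "\<And>n. t n (K n) = U" and inc: "\<And>n k. t n k < t n (Suc k)"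
    and mesh: "\<And>n k. t n (Suc k) - t n k \<le> d n" and d: "d \<longlonglongrightarrow> 0"
    and cont: "continuous_on {0..} f"
  shows "(\<exists>j::nat. \<forall>n. \<forall>k\<le>K n. f (t n k) > 1 / (real j + 1)) \<longleftrightarrow> (\<forall>v\<in>{0..U}. f v > 0)"
proof -
  have mono: "t n i \<le> t n j" if "i \<le> j" for n i j
    using lift_Suc_mono_le[of "t n", OF _ that] inc less_imp_le by blast
  have tin: "t n k \<in> {0..U}" if "k \<le> K n" for n k
    using mono[of 0 k n] mono[OF that, of n] t0[of n] tK[of n] by auto
  have U: "U \<ge> 0" using tin[of 0 0] by auto
  have dpos: "0 \<le> d n" for n using mesh[of n 0] inc[of n 0] by linarith
  show ?thesis
  proof safe
    fix j :: nat and v assume j: "\<forall>n. \<forall>k\<le>K n. f (t n k) > 1 / (real j + 1)" and v: "v \<in> {0..U}"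
    show "f v > 0"
    proof (rule ccontr)
      assume neg: "\<not> f v > 0"
      have "continuous (at v within {0..}) f" using cont v by (auto simp: continuous_on_eq_continuous_within)
      then obtain \<delta> where \<delta>: "\<delta> > 0" "\<And>x. x \<in> {0..} \<Longrightarrow> dist x v < \<delta> \<Longrightarrow> dist (f x) (f v) < 1 / (real j + 1)"
        unfolding continuous_within_eps_delta by (metis divide_pos_pos of_nat_0_le_iff add_nonneg_pos zero_less_one)
      obtain n where n: "d n < \<delta>" using order_tendstoD(2)[OF d \<delta>(1)] by (auto simp: eventually_sequentially)
      obtain k where k: "k \<le> K n" "\<bar>t n k - v\<bar> \<le> d n"
        using mesh_cover[of "t n" "d n" v "K n"] mesh dpos v t0 tK by auto
      have "dist (f (t n k)) (f v) < 1 / (real j + 1)"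
        using \<delta>(2)[of "t n k"] k n tin[OF k(1)] by (auto simp: dist_real_def)
      then show False using j[rule_format, OF k(1)] neg by (auto simp: dist_real_def)
    qed
  next
    assume pos: "\<forall>v\<in>{0..U}. f v > 0"
    have "continuous_on {0..U} f" using cont by (rule continuous_on_subset) auto
    then obtain x where x: "x \<in> {0..U}" "\<And>y. y \<in> {0..U} \<Longrightarrow> f x \<le> f y"
      using continuous_attains_inf[of "{0..U}" f] U by auto
    obtain j :: nat where "1 / (real j + 1) < f x"
      using reals_Archimedean[of "f x"] pos x(1) by (auto simp: inverse_eq_divide add.commute)
    then show "\<exists>j::nat. \<forall>n. \<forall>k\<le>K n. f (t n k) > 1 / (real j + 1)"
      using x(2) tin by (meson less_le_trans)
  qed
qed

lemma mesh_oscillation_tendsto_0: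
  fixes t :: "nat \<Rightarrow> nat \<Rightarrow> real" and f :: "real \<Rightarrow> real"
  assumes t0: "\<And>n. t n 0 = 0" and tK: "\<And>n. t n (K n) = U" and inc: "\<And>n k. t n k < t n (Suc k)"
    and mesh: "\<And>n k. t n (Suc k) - t n k \<le> d n" and d: "d \<longlonglongrightarrow> 0"
    and cont: "continuous_on {0..} f" and Kpos: "\<And>n. 0 < K n"
  shows "(\<lambda>n. MAX k\<in>{..<K n}. \<bar>f (t n (Suc k)) - f (t n k)\<bar>) \<longlonglongrightarrow> 0"
proof (rule LIMSEQ_I)
  fix e :: real assume e: "0 < e"
  have mono: "t n i \<le> t n j" if "i \<le> j" for n i j
    using lift_Suc_mono_le[of "t n", OF _ that] inc less_imp_le by blast
  have tin: "t n k \<in> {0..U}" if "k \<le> K n" for n k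
    using mono[of 0 k n] mono[OF that, of n] t0[of n] tK[of n] by auto
  have "continuous_on {0..U} f" using cont by (rule continuous_on_subset) auto
  then have "uniformly_continuous_on {0..U} f" by (intro compact_uniformly_continuous) auto
  then obtain \<delta> where \<delta>: "\<delta> > 0" "\<And>x y. x \<in> {0..U} \<Longrightarrow> y \<in> {0..U} \<Longrightarrow> dist y x < \<delta> \<Longrightarrow> dist (f y) (f x) < e"
    unfolding uniformly_continuous_on_def using e by metis
  have "eventually (\<lambda>n. d n < \<delta>) sequentially" using order_tendstoD(2)[OF d \<delta>(1)] .
  then obtain N where N: "\<And>n. n \<ge> N \<Longrightarrow> d n < \<delta>" by (auto simp: eventually_sequentially)
  show "\<exists>no. \<forall>n\<ge>no. norm ((MAX k\<in>{..<K n}. \<bar>f (t n (Suc k)) - f (t n k)\<bar>) - 0) < e"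
  proof (intro exI allI impI)
    fix n assume n: "n \<ge> N"
    have ne: "{..<K n} \<noteq> {}" using Kpos[of n] by auto
    have lt: "\<bar>f (t n (Suc k)) - f (t n k)\<bar> < e" if "k < K n" for k
      using \<delta>(2)[OF tin[of k n] tin[of "Suc k" n]] that mesh[of n k] inc[of n k] N[OF n]
      by (auto simp: dist_real_def)
    have "(MAX k\<in>{..<K n}. \<bar>f (t n (Suc k)) - f (t n k)\<bar>) < e"
      using lt ne by (subst Max_less_iff) auto
    moreover have "0 \<le> (MAX k\<in>{..<K n}. \<bar>f (t n (Suc k)) - f (t n k)\<bar>)"
      using Kpos[of n] by (subst Max_ge_iff) auto
    ultimately show "norm ((MAX k\<in>{..<K n}. \<bar>f (t n (Suc k)) - f (t n k)\<bar>) - 0) < e" by simp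
  qed
qed

text \<open>The grids contain \<open>s\<close>, are nested, and degenerate to dyadic grids of \<open>[0, T]\<close> if \<open>s = 0\<close>.\<close>

definition split_index :: "real \<Rightarrow> nat \<Rightarrow> nat" where
  "split_index s n = (if s = 0 then 0 else 2 ^ n)"

definition grid :: "real \<Rightarrow> real \<Rightarrow> nat \<Rightarrow> nat \<Rightarrow> real" where
  "grid s T n k = (if k < split_index s n then s * real k / 2 ^ n
     else s + (T - s) * (real k - real (split_index s n)) / 2 ^ n)"

lemma grid_0[simp]: "grid s T n 0 = 0"
  by (simp add: grid_def split_index_def)

lemma grid_split_index[simp]: "grid s T n (split_index s n) = s"
  by (simp add: grid_def)

lemma grid_end[simp]: "grid s T n (split_index s n + 2 ^ n) = T"
  by (simp add: grid_def)

lemma grid_step: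
  "grid s T n (Suc k) - grid s T n k = (if k < split_index s n then s else T - s) / 2 ^ n"
proof -
  consider "Suc k < split_index s n" | "Suc k = split_index s n" "s \<noteq> 0" | "k \<ge> split_index s n"
    by (metis Suc_lessI not_le split_index_def zero_le)
  then show ?thesis
  proof cases
    \<comment> \<open>The step at which the branches switch: index k still uses the first formula,
      Suc k already the second.\<close>
    case 2
    then have "real k = 2 ^ n - 1" by (simp add: split_index_def) (metis of_nat_Suc of_nat_numeral of_nat_power add_diff_cancel_left')
    then have k: "real k = 2 ^ n - 1" by simp
    have "grid s T n k = s * (2 ^ n - 1) / 2 ^ n" using 2 k by (simp add: grid_def)
    moreover have "grid s T n (Suc k) = s" using 2 grid_split_index by metis
    moreover have "s - s * (2 ^ n - 1) / 2 ^ n = s / 2 ^ n" by (simp add: right_diff_distrib diff_divide_distrib)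
    ultimately show ?thesis using 2 by (metis lessI)
  qed (auto simp: grid_def field_simps)
qed

text \<open>This holds for every index: beyond time T the second branch keeps its step, and for s =
  0 the first branch is empty.\<close>

lemma grid_less: "0 \<le> s \<Longrightarrow> s < T \<Longrightarrow> grid s T n k < grid s T n (Suc k)"
proof -
  assume *: "0 \<le> s" "s < T"
  have "0 < (if k < split_index s n then s else T - s)"
    using * by (auto simp: split_index_def split: if_splits)
  then show ?thesis using grid_step[of s T n k] by (metis diff_gt_0_iff_gt divide_pos_pos zero_less_numeral zero_less_power)
qed

lemma grid_mesh: "0 \<le> s \<Longrightarrow> s < T \<Longrightarrow> grid s T n (Suc k) - grid s T n k \<le> T / 2 ^ n"
  unfolding grid_step by (intro divide_right_mono) auto

lemma grid_refine: "grid s T (Suc n) (2 * k) = grid s T n k"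
  by (auto simp: grid_def split_index_def field_simps)

lemma mesh_tendsto_0: "(\<lambda>n. T / 2 ^ n :: real) \<longlonglongrightarrow> 0"
  using tendsto_mult_right_zero[OF LIMSEQ_power_zero[of "1/2 :: real"], of T] by (simp add: power_one_over field_simps)

context drifted_bm
begin

definition alive :: "(nat \<Rightarrow> real) \<Rightarrow> real \<Rightarrow> nat \<Rightarrow> 'a \<Rightarrow> real" where
  "alive ts \<epsilon> k \<omega> = (if \<forall>j\<le>k. X (ts j) \<omega> > \<epsilon> then 1 else 0)"

lemma alive_past_measurable:
  assumes "ts 0 = 0" "k \<le> l"
  shows "alive ts \<epsilon> k \<in> borel_measurable (past ts l)"
proof -
  have m: "X (ts j) \<in> borel_measurable (past ts l)" if "j \<le> k" for j
    by (rule X_past_measurable) (use assms that in auto)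
  have "{\<omega> \<in> space (past ts l). X (ts j) \<omega> > \<epsilon>} \<in> sets (past ts l)" if "j \<le> k" for j
    using m[OF that] by measurable
  then have "{\<omega> \<in> space (past ts l). \<forall>j\<in>{..k}. X (ts j) \<omega> > \<epsilon>} \<in> sets (past ts l)"
    by (rule sets.sets_Collect_finite_All) auto
  moreover have "{\<omega> \<in> space (past ts l). \<forall>j\<in>{..k}. X (ts j) \<omega> > \<epsilon>} = {\<omega> \<in> space (past ts l). \<forall>j\<le>k. X (ts j) \<omega> > \<epsilon>}"
    by auto
  ultimately have "{\<omega> \<in> space (past ts l). \<forall>j\<le>k. X (ts j) \<omega> > \<epsilon>} \<in> sets (past ts l)"
    by (rule back_subst)
  from measurable_If[OF borel_measurable_const borel_measurable_const this, of "1 :: real" 0]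
  show ?thesis unfolding alive_def[abs_def] .
qed

lemma alive_measurable[measurable]: "alive ts \<epsilon> k \<in> borel_measurable M"
  unfolding alive_def[abs_def] by measurable

lemma alive_bounds: "0 \<le> alive ts \<epsilon> k \<omega>" "alive ts \<epsilon> k \<omega> \<le> 1"
  by (auto simp: alive_def)

lemma alive_antimono: "k \<le> l \<Longrightarrow> alive ts \<epsilon> l \<omega> \<le> alive ts \<epsilon> k \<omega>"
  by (auto simp: alive_def)

lemma integrable_bounded: "f \<in> borel_measurable M \<Longrightarrow> (\<And>\<omega>. \<bar>f \<omega> :: real\<bar> \<le> c) \<Longrightarrow> integrable M f"
  by (rule integrable_const_bound[where B=c]) auto

lemma abs_mult_le1: "\<bar>a\<bar> \<le> 1 \<Longrightarrow> \<bar>b\<bar> \<le> 1 \<Longrightarrow> \<bar>a * b :: real\<bar> \<le> 1"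
  by (simp add: abs_mult mult_le_one)

text \<open>The difference is nonzero only if Suc k is the first index with value at most
  \<epsilon>. The previous value exceeds \<epsilon> > 0, so the path lies below 0 by at most one
  grid oscillation.\<close>

lemma alive_drop_bound:
  assumes "\<epsilon> > 0" "k < N" and L: "L \<ge> 0"
  shows "(alive ts \<epsilon> k \<omega> - alive ts \<epsilon> (Suc k) \<omega>) * min 1 (L * \<bar>X (ts (Suc k)) \<omega>\<bar>)
    \<le> (alive ts \<epsilon> k \<omega> - alive ts \<epsilon> (Suc k) \<omega>) * min 1 (L * (\<epsilon> + (MAX k\<in>{..<N}. \<bar>X (ts (Suc k)) \<omega> - X (ts k) \<omega>\<bar>)))"
proof (cases "alive ts \<epsilon> k \<omega> = alive ts \<epsilon> (Suc k) \<omega>")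
  case False
  then have k: "X (ts k) \<omega> > \<epsilon>" "X (ts (Suc k)) \<omega> \<le> \<epsilon>"
    by (auto simp: alive_def le_Suc_eq split: if_splits)
  have "\<bar>X (ts (Suc k)) \<omega> - X (ts k) \<omega>\<bar> \<le> (MAX k\<in>{..<N}. \<bar>X (ts (Suc k)) \<omega> - X (ts k) \<omega>\<bar>)"
    using assms(2) by (intro Max_ge) auto
  then have "\<bar>X (ts (Suc k)) \<omega>\<bar> \<le> \<epsilon> + (MAX k\<in>{..<N}. \<bar>X (ts (Suc k)) \<omega> - X (ts k) \<omega>\<bar>)"
    using k assms(1) by linarith
  then have "L * \<bar>X (ts (Suc k)) \<omega>\<bar> \<le> L * (\<epsilon> + (MAX k\<in>{..<N}. \<bar>X (ts (Suc k)) \<omega> - X (ts k) \<omega>\<bar>))"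
    using L by (intro mult_left_mono)
  then show ?thesis using alive_antimono[of k "Suc k" ts \<epsilon> \<omega>] by (intro mult_left_mono) auto
qed simp

text \<open>At the first grid time at which the path is at most \<open>\<epsilon>\<close> it lies within \<open>\<epsilon>\<close> plus one grid
  oscillation of 0, where the Lipschitz function \<open>drift_op r (ramp r q) t\<close> vanishes; hence paths
  that come close to 0 contribute almost nothing.\<close>

lemma discrete_killing:
  fixes ts :: "nat \<Rightarrow> real" and q :: nat
  assumes ts: "ts 0 = 0" "\<And>i. ts i < ts (Suc i)" and mN: "m < N"
    and g[measurable]: "g \<in> borel_measurable borel" and gb: "\<And>x. \<bar>g x\<bar> \<le> 1" and eps: "\<epsilon> > 0"
  defines "W \<equiv> \<lambda>\<omega>. min 1 ((real q + 2 * r) * (\<epsilon> + (MAX k\<in>{..<N}. \<bar>X (ts (Suc k)) \<omega> - X (ts k) \<omega>\<bar>)))"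
  shows "\<bar>(\<integral>\<omega>. g (X (ts m) \<omega>) * alive ts \<epsilon> N \<omega> * ramp r q (X (ts N) \<omega>) \<partial>M)
    - (\<integral>\<omega>. g (X (ts m) \<omega>) * alive ts \<epsilon> m \<omega> * drift_op r (ramp r q) (ts N - ts m) (X (ts m) \<omega>) \<partial>M)\<bar>
    \<le> (\<integral>\<omega>. W \<omega> \<partial>M)"
proof -
  let ?L = "real q + 2 * r"
  have L: "?L \<ge> 0" using r_pos by simp
  have mono: "ts i < ts j" if "i < j" for i j
    using lift_Suc_mono_less[of ts, OF ts(2) that] .
  define G where "G k \<omega> = g (X (ts m) \<omega>) * alive ts \<epsilon> k \<omega>" for k \<omega>
  \<comment> \<open>The values \<open>a k\<close> interpolate between the two expectations: in
    \<open>a m\<close> nothing is killed after ts m, in \<open>a N\<close> killing acts along the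
    whole grid, and consecutive values differ only on paths that drop at that step.\<close>
  define a where "a k = (\<integral>\<omega>. G k \<omega> * ramp r q (X (ts N) \<omega>) \<partial>M)" for k
  have Gm: "G k \<in> borel_measurable (past ts l)" if "m \<le> l" "k \<le> l" for k l
    unfolding G_def[abs_def]
    by (intro borel_measurable_times alive_past_measurable measurable_compose[OF X_past_measurable g] ts that)
  have GM[measurable]: "G k \<in> borel_measurable M" for k
    unfolding G_def[abs_def] by measurable
  have Gb: "\<bar>G k \<omega>\<bar> \<le> 1" for k \<omega>
    unfolding G_def by (intro abs_mult_le1 gb) (auto simp: alive_def)
  have Wm[measurable]: "W \<in> borel_measurable M"
    unfolding W_def using mN by measurable
  have Wb: "0 \<le> W \<omega>" "W \<omega> \<le> 1" for \<omega>
  proof -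
    have "0 \<le> (MAX k\<in>{..<N}. \<bar>X (ts (Suc k)) \<omega> - X (ts k) \<omega>\<bar>)"
      using mN by (subst Max_ge_iff) auto
    then show "0 \<le> W \<omega>" unfolding W_def using L eps by simp
  qed (simp add: W_def)
  have one_step: "\<bar>a k - a (Suc k)\<bar> \<le> (\<integral>\<omega>. (alive ts \<epsilon> k \<omega> - alive ts \<epsilon> (Suc k) \<omega>) * W \<omega> \<partial>M)" if k: "m \<le> k" "k < N" for k
  proof -
    let ?H = "\<lambda>\<omega>. G k \<omega> - G (Suc k) \<omega>"
    have Heq: "?H \<omega> = g (X (ts m) \<omega>) * (alive ts \<epsilon> k \<omega> - alive ts \<epsilon> (Suc k) \<omega>)" for \<omega>
      by (simp add: G_def right_diff_distrib)
    have Habs: "\<bar>?H \<omega>\<bar> \<le> alive ts \<epsilon> k \<omega> - alive ts \<epsilon> (Suc k) \<omega>" for \<omega>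
      unfolding Heq abs_mult using alive_antimono[of k "Suc k" ts \<epsilon> \<omega>] gb[of "X (ts m) \<omega>"]
      by (auto intro: mult_left_le_one_le)
    have Hb: "\<bar>?H \<omega>\<bar> \<le> 1" for \<omega>
      using Habs[of \<omega>] alive_bounds[of ts \<epsilon> k \<omega>] alive_bounds[of ts \<epsilon> "Suc k" \<omega>] by linarith
    have aeq: "a k - a (Suc k) = (\<integral>\<omega>. ?H \<omega> * ramp r q (X (ts N) \<omega>) \<partial>M)"
      unfolding a_def left_diff_distrib
      by (intro Bochner_Integration.integral_diff[symmetric] integrable_bounded[of _ 1] abs_mult_le1 Gb abs_ramp_le_1 r_pos) measurable
    \<comment> \<open>The witness is the ramp averaged over the remaining time, or the ramp itself
      at the last step, where \<open>markov_step\<close> has no positive time left to work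
      with.\<close>
    have "\<exists>v. v \<in> borel_measurable borel \<and> (\<forall>x. \<bar>v x\<bar> \<le> min 1 (?L * \<bar>x\<bar>)) \<and>
        (\<integral>\<omega>. ?H \<omega> * ramp r q (X (ts N) \<omega>) \<partial>M) = (\<integral>\<omega>. ?H \<omega> * v (X (ts (Suc k)) \<omega>) \<partial>M)"
    proof (cases "Suc k = N")
      case True
      have "\<bar>ramp r q x\<bar> \<le> min 1 (?L * \<bar>x\<bar>)" for x
        using abs_ramp_le_1[OF r_pos, of q x] ramp_lipschitz[OF r_pos, of q x 0] by simp
      then show ?thesis using True by (intro exI[of _ "ramp r q"]) auto
    next
      case False
      then have lt: "Suc k < N" using k by simp
      have "(\<integral>\<omega>. ?H \<omega> * ramp r q (X (ts N) \<omega>) \<partial>M)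
        = (\<integral>\<omega>. ?H \<omega> * drift_op r (ramp r q) (ts N - ts (Suc k)) (X (ts (Suc k)) \<omega>) \<partial>M)"
        by (rule markov_step[OF ts lt _ Hb _ abs_ramp_le_1[OF r_pos]])
          (use k in \<open>auto intro!: borel_measurable_diff Gm\<close>)
      moreover have "\<bar>drift_op r (ramp r q) (ts N - ts (Suc k)) x\<bar> \<le> min 1 (?L * \<bar>x\<bar>)" for x
        using drift_op_ramp_le[OF r_pos, of "ts N - ts (Suc k)" q x] mono[OF lt] by simp
      ultimately show ?thesis by (intro exI[of _ "drift_op r (ramp r q) (ts N - ts (Suc k))"]) auto
    qed
    then obtain v where v[measurable]: "v \<in> borel_measurable borel" and vb: "\<And>x. \<bar>v x\<bar> \<le> min 1 (?L * \<bar>x\<bar>)"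
      and veq: "(\<integral>\<omega>. ?H \<omega> * ramp r q (X (ts N) \<omega>) \<partial>M) = (\<integral>\<omega>. ?H \<omega> * v (X (ts (Suc k)) \<omega>) \<partial>M)"
      by blast
    have eq: "a k - a (Suc k) = (\<integral>\<omega>. ?H \<omega> * v (X (ts (Suc k)) \<omega>) \<partial>M)"
      using aeq veq by simp
    have vb1: "\<bar>v x\<bar> \<le> 1" for x using vb[of x] by simp
    have "\<bar>\<integral>\<omega>. ?H \<omega> * v (X (ts (Suc k)) \<omega>) \<partial>M\<bar> \<le> (\<integral>\<omega>. \<bar>?H \<omega> * v (X (ts (Suc k)) \<omega>)\<bar> \<partial>M)"
      by (rule integral_abs_bound)
    also have "\<dots> \<le> (\<integral>\<omega>. (alive ts \<epsilon> k \<omega> - alive ts \<epsilon> (Suc k) \<omega>) * W \<omega> \<partial>M)"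
    proof (rule integral_mono)
      show "integrable M (\<lambda>\<omega>. \<bar>?H \<omega> * v (X (ts (Suc k)) \<omega>)\<bar>)"
        by (intro integrable_abs integrable_bounded[of _ 1] abs_mult_le1 Hb vb1) measurable
      show "integrable M (\<lambda>\<omega>. (alive ts \<epsilon> k \<omega> - alive ts \<epsilon> (Suc k) \<omega>) * W \<omega>)"
      proof (intro integrable_bounded[of _ 1] abs_mult_le1)
        show "\<bar>alive ts \<epsilon> k \<omega> - alive ts \<epsilon> (Suc k) \<omega>\<bar> \<le> 1" for \<omega> by (auto simp: alive_def)
        show "\<bar>W \<omega>\<bar> \<le> 1" for \<omega> using Wb[of \<omega>] by simp
      qed measurable
      fix \<omega>
      have "\<bar>?H \<omega> * v (X (ts (Suc k)) \<omega>)\<bar> \<le> (alive ts \<epsilon> k \<omega> - alive ts \<epsilon> (Suc k) \<omega>) * min 1 (?L * \<bar>X (ts (Suc k)) \<omega>\<bar>)"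
        unfolding abs_mult using L by (intro mult_mono Habs vb) (auto simp: alive_antimono)
      also have "\<dots> \<le> (alive ts \<epsilon> k \<omega> - alive ts \<epsilon> (Suc k) \<omega>) * W \<omega>"
        unfolding W_def by (rule alive_drop_bound[OF eps k(2) L])
      finally show "\<bar>?H \<omega> * v (X (ts (Suc k)) \<omega>)\<bar> \<le> (alive ts \<epsilon> k \<omega> - alive ts \<epsilon> (Suc k) \<omega>) * W \<omega>" .
    qed
    finally show ?thesis unfolding eq .
  qed
  have intaW: "integrable M (\<lambda>\<omega>. (alive ts \<epsilon> k \<omega> - alive ts \<epsilon> l \<omega>) * W \<omega>)" for k l
  proof (intro integrable_bounded[of _ 1] abs_mult_le1)
    show "\<bar>alive ts \<epsilon> k \<omega> - alive ts \<epsilon> l \<omega>\<bar> \<le> 1" for \<omega> by (auto simp: alive_def)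
    show "\<bar>W \<omega>\<bar> \<le> 1" for \<omega> using Wb[of \<omega>] by simp
  qed measurable
  \<comment> \<open>The weights alive k - alive (Suc k) sum up to at most 1, so the errors of all
    steps together cost a single expectation of W, however fine the grid is.\<close>
  have tele: "\<bar>a m - a k\<bar> \<le> (\<integral>\<omega>. (alive ts \<epsilon> m \<omega> - alive ts \<epsilon> k \<omega>) * W \<omega> \<partial>M)" if "m \<le> k" "k \<le> N" for k
    using that
  proof (induction k rule: dec_induct)
    case (step k)
    have "\<bar>a m - a (Suc k)\<bar> \<le> \<bar>a m - a k\<bar> + \<bar>a k - a (Suc k)\<bar>" by linarith
    also have "\<dots> \<le> (\<integral>\<omega>. (alive ts \<epsilon> m \<omega> - alive ts \<epsilon> k \<omega>) * W \<omega> \<partial>M)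
        + (\<integral>\<omega>. (alive ts \<epsilon> k \<omega> - alive ts \<epsilon> (Suc k) \<omega>) * W \<omega> \<partial>M)"
      using step one_step[of k] by (intro add_mono) auto
    also have "\<dots> = (\<integral>\<omega>. (alive ts \<epsilon> m \<omega> - alive ts \<epsilon> (Suc k) \<omega>) * W \<omega> \<partial>M)"
      by (subst Bochner_Integration.integral_add[symmetric, OF intaW intaW]) (simp add: algebra_simps)
    finally show ?case .
  qed simp
  have "\<bar>a m - a N\<bar> \<le> (\<integral>\<omega>. (alive ts \<epsilon> m \<omega> - alive ts \<epsilon> N \<omega>) * W \<omega> \<partial>M)"
    using tele[of N] mN by simp
  also have "\<dots> \<le> (\<integral>\<omega>. W \<omega> \<partial>M)"
  proof (rule integral_mono[OF intaW])
    show "integrable M W" using Wb by (intro integrable_bounded[of _ 1]) simp_all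
    show "(alive ts \<epsilon> m \<omega> - alive ts \<epsilon> N \<omega>) * W \<omega> \<le> W \<omega>" for \<omega>
      using Wb[of \<omega>] by (intro mult_left_le_one_le) (use mN in \<open>auto simp: alive_def\<close>)
  qed
  also have "a m = (\<integral>\<omega>. G m \<omega> * drift_op r (ramp r q) (ts N - ts m) (X (ts m) \<omega>) \<partial>M)"
    unfolding a_def by (rule markov_step[OF ts mN Gm Gb ramp_measurable abs_ramp_le_1[OF r_pos]]) auto
  finally show ?thesis unfolding a_def G_def by (simp add: abs_minus_commute)
qed

end

section \<open>Killing in continuous time\<close>

context drifted_bm
begin

definition alive_lim :: "(nat \<Rightarrow> nat \<Rightarrow> real) \<Rightarrow> (nat \<Rightarrow> nat) \<Rightarrow> real \<Rightarrow> 'a \<Rightarrow> real" where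
  "alive_lim t K \<epsilon> \<omega> = (if \<forall>n. \<forall>k\<le>K n. X (t n k) \<omega> > \<epsilon> then 1 else 0)"

definition positive_until :: "real \<Rightarrow> 'a \<Rightarrow> real" where
  "positive_until U \<omega> = (if \<forall>v\<in>{0..U}. X v \<omega> > 0 then 1 else 0)"

lemma alive_lim_measurable[measurable]: "alive_lim t K \<epsilon> \<in> borel_measurable M"
  unfolding alive_lim_def[abs_def] by measurable

text \<open>Index k of one grid is index 2 k of the next, so a path found at or below \<epsilon>
  stays detected on every finer grid and the sequence is eventually constant.\<close>

lemma alive_tendsto_alive_lim:
  assumes ref: "\<And>n k. t (Suc n) (2 * k) = t n k" and K: "\<And>n. K (Suc n) = 2 * K n"
  shows "(\<lambda>n. alive (t n) \<epsilon> (K n) \<omega>) \<longlonglongrightarrow> alive_lim t K \<epsilon> \<omega>"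
proof (cases "\<forall>n. \<forall>k\<le>K n. X (t n k) \<omega> > \<epsilon>")
  case True
  then show ?thesis by (simp add: alive_def alive_lim_def)
next
  case False
  then obtain n0 k0 where nk: "k0 \<le> K n0" "\<not> X (t n0 k0) \<omega> > \<epsilon>" by auto
  have "\<exists>k\<le>K n. \<not> X (t n k) \<omega> > \<epsilon>" if "n \<ge> n0" for n
    using that
  proof (induction n rule: dec_induct)
    case base
    show ?case using nk by blast
  next
    case (step n)
    then obtain k where k: "k \<le> K n" "\<not> X (t n k) \<omega> > \<epsilon>" by blast
    have "2 * k \<le> K (Suc n)" using k(1) K[of n] by simp
    then show ?case using ref[of n k] k(2) by metis
  qed
  then have "alive (t n) \<epsilon> (K n) \<omega> = 0" if "n \<ge> n0" for n
    using that unfolding alive_def by meson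
  then have "\<forall>\<^sub>F n in sequentially. alive (t n) \<epsilon> (K n) \<omega> = 0"
    by (auto simp: eventually_sequentially)
  moreover have "alive_lim t K \<epsilon> \<omega> = 0" using False unfolding alive_lim_def by meson
  ultimately show ?thesis by (simp add: tendsto_eventually)
qed

lemma alive_lim_tendsto_positive_until:
  assumes "0 \<le> s" "s < T" and K: "\<And>n. grid s T n (K n) = U" and \<omega>: "\<omega> \<in> space M"
  shows "(\<lambda>j. alive_lim (grid s T) K (1 / (real j + 1)) \<omega>) \<longlonglongrightarrow> positive_until U \<omega>"
proof -
  have iff: "(\<exists>j::nat. \<forall>n. \<forall>k\<le>K n. X (grid s T n k) \<omega> > 1 / (real j + 1)) \<longleftrightarrow> (\<forall>v\<in>{0..U}. X v \<omega> > 0)"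
    by (rule pos_on_interval_iff_meshes[OF grid_0 K grid_less[OF assms(1,2)] grid_mesh[OF assms(1,2)]
      mesh_tendsto_0 continuous_X[OF \<omega>]])
  show ?thesis
  proof (cases "\<forall>v\<in>{0..U}. X v \<omega> > 0")
    case True
    then obtain j0 :: nat where j0: "\<And>n k. k \<le> K n \<Longrightarrow> X (grid s T n k) \<omega> > 1 / (real j0 + 1)"
      using iff by blast
    have "alive_lim (grid s T) K (1 / (real j + 1)) \<omega> = 1" if "j \<ge> j0" for j
    proof -
      have "1 / (real j + 1) \<le> 1 / (real j0 + 1)" using that by (intro divide_left_mono) auto
      then show ?thesis using j0 unfolding alive_lim_def by (metis le_less_trans)
    qed
    then show ?thesis using True
      by (intro tendsto_eventually) (auto simp: positive_until_def eventually_sequentially)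
  next
    case False
    then have "alive_lim (grid s T) K (1 / (real j + 1)) \<omega> = 0" for j
      using iff unfolding alive_lim_def by meson
    moreover have "positive_until U \<omega> = 0" using False unfolding positive_until_def by meson
    ultimately show ?thesis by simp
  qed
qed

lemma positive_until_measurable[measurable]:
  assumes "U \<ge> 0"
  shows "positive_until U \<in> borel_measurable M"
proof (cases "U = 0")
  case True
  then have "positive_until U = (\<lambda>\<omega>. if X 0 \<omega> > 0 then 1 else 0)" by (auto simp: positive_until_def fun_eq_iff)
  then show ?thesis by simp
next
  case False
  show ?thesis
  proof (rule borel_measurable_LIMSEQ_real[OF alive_lim_tendsto_positive_until[of 0 U "\<lambda>n. 2 ^ n"]])
    show "grid 0 U n (2 ^ n) = U" for n using grid_end[of 0 U n] by (simp add: split_index_def)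
  qed (use assms False in auto)
qed

text \<open>Survival is defined by the absence of zeros, on paths of either sign. Applying the grid
  criterion to the absolute value of X replaces the uncountable intersection by countable
  operations, which gives measurability without completeness of M.\<close>

lemma nonzero_measurable:
  assumes "U \<ge> 0"
  shows "{\<omega>\<in>space M. \<forall>v\<in>{0..U}. X v \<omega> \<noteq> 0} \<in> sets M"
proof (cases "U = 0")
  case True
  then have "{\<omega>\<in>space M. \<forall>v\<in>{0..U}. X v \<omega> \<noteq> 0} = {\<omega>\<in>space M. X 0 \<omega> \<noteq> 0}" by auto
  then show ?thesis by simp
next
  case False
  have "0 \<le> (0::real)" "0 < U" using assms False by auto
  note grid = grid_less[OF this] grid_mesh[OF this]
  have K: "grid 0 U n (2 ^ n) = U" for n using grid_end[of 0 U n] by (simp add: split_index_def)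
  have eq: "{\<omega>\<in>space M. \<forall>v\<in>{0..U}. X v \<omega> \<noteq> 0}
      = {\<omega>\<in>space M. \<exists>j::nat. \<forall>n. \<forall>k\<le>2 ^ n. \<bar>X (grid 0 U n k) \<omega>\<bar> > 1 / (real j + 1)}"
  proof (rule Collect_cong, rule conj_cong[OF refl])
    fix \<omega> assume "\<omega> \<in> space M"
    then have "continuous_on {0..} (\<lambda>v. \<bar>X v \<omega>\<bar>)" by (intro continuous_intros continuous_X)
    from pos_on_interval_iff_meshes[OF grid_0 K grid mesh_tendsto_0 this]
    show "(\<forall>v\<in>{0..U}. X v \<omega> \<noteq> 0) = (\<exists>j::nat. \<forall>n. \<forall>k\<le>2 ^ n. \<bar>X (grid 0 U n k) \<omega>\<bar> > 1 / (real j + 1))"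
      by simp
  qed
  show ?thesis unfolding eq by measurable
qed

lemma abs_le1_alive_lim: "\<bar>alive_lim t K \<epsilon> \<omega>\<bar> \<le> 1"
  by (simp add: alive_lim_def)

lemma abs_le1_alive: "\<bar>alive t \<epsilon> k \<omega>\<bar> \<le> 1"
  by (simp add: alive_def)

lemma abs_le1_positive_until: "\<bar>positive_until U \<omega>\<bar> \<le> 1"
  by (simp add: positive_until_def)

lemma bounded_convergence:
  fixes f :: "nat \<Rightarrow> 'a \<Rightarrow> real"
  assumes "\<And>n. f n \<in> borel_measurable M" "h \<in> borel_measurable M"
    and "\<And>\<omega>. \<omega> \<in> space M \<Longrightarrow> (\<lambda>n. f n \<omega>) \<longlonglongrightarrow> h \<omega>" and "\<And>n \<omega>. \<bar>f n \<omega>\<bar> \<le> 1"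
  shows "(\<lambda>n. \<integral>\<omega>. f n \<omega> \<partial>M) \<longlonglongrightarrow> (\<integral>\<omega>. h \<omega> \<partial>M)"
  by (rule integral_dominated_convergence[where w="\<lambda>_. 1"]) (use assms in auto)

text \<open>The mesh is refined with \<epsilon> fixed. The oscillation inside W tends to 0 on each
  path by uniform continuity, and the Lipschitz constant times \<epsilon> remains.\<close>

lemma grid_killing:
  assumes sT: "0 \<le> s" "s < T" and g[measurable]: "g \<in> borel_measurable borel" and gb: "\<And>x. \<bar>g x\<bar> \<le> 1"
    and eps: "\<epsilon> > 0"
  shows "\<bar>(\<integral>\<omega>. g (X s \<omega>) * alive_lim (grid s T) (\<lambda>n. split_index s n + 2 ^ n) \<epsilon> \<omega> * ramp r q (X T \<omega>) \<partial>M)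
    - (\<integral>\<omega>. g (X s \<omega>) * alive_lim (grid s T) (split_index s) \<epsilon> \<omega> * drift_op r (ramp r q) (T - s) (X s \<omega>) \<partial>M)\<bar>
    \<le> (real q + 2 * r) * \<epsilon>"
proof -
  let ?L = "real q + 2 * r"
  let ?N = "\<lambda>n. split_index s n + 2 ^ n"
  have L: "?L \<ge> 0" using r_pos by simp
  note grid = grid_0 grid_less[OF sT]
  have refK: "split_index s (Suc n) = 2 * split_index s n" "?N (Suc n) = 2 * ?N n" for n
    by (auto simp: split_index_def)
  define W where "W n \<omega> = min 1 (?L * (\<epsilon> + (MAX k\<in>{..<?N n}. \<bar>X (grid s T n (Suc k)) \<omega> - X (grid s T n k) \<omega>\<bar>)))" for n \<omega>
  have "0 < ?N n" for n by simp
  then have ne: "{..<?N n} \<noteq> {}" for n by (metis lessThan_iff empty_iff)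
  have Max0: "0 \<le> (MAX k\<in>{..<?N n}. \<bar>X (grid s T n (Suc k)) \<omega> - X (grid s T n k) \<omega>\<bar>)" for n \<omega>
    using ne[of n] by (subst Max_ge_iff) auto
  have Wb: "\<bar>W n \<omega>\<bar> \<le> 1" for n \<omega>
  proof -
    have "0 \<le> W n \<omega>" unfolding W_def using L eps r_pos Max0[of n \<omega>] by (intro min.boundedI mult_nonneg_nonneg add_nonneg_nonneg) auto
    then show ?thesis by (simp add: W_def)
  qed
  have Ddb: "\<bar>drift_op r (ramp r q) (T - s) x\<bar> \<le> 1" for x
    using drift_op_ramp_le[OF r_pos, of "T - s" q x] sT by simp
  have Wm[measurable]: "W n \<in> borel_measurable M" for n
    unfolding W_def using ne by measurable
  have ineq: "\<bar>(\<integral>\<omega>. g (X s \<omega>) * alive (grid s T n) \<epsilon> (?N n) \<omega> * ramp r q (X T \<omega>) \<partial>M)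
    - (\<integral>\<omega>. g (X s \<omega>) * alive (grid s T n) \<epsilon> (split_index s n) \<omega> * drift_op r (ramp r q) (T - s) (X s \<omega>) \<partial>M)\<bar>
    \<le> (\<integral>\<omega>. W n \<omega> \<partial>M)" for n
    using discrete_killing[of "grid s T n" "split_index s n" "?N n" g \<epsilon> q, OF grid _ g gb eps]
    unfolding W_def by simp
  have lim1: "(\<lambda>n. \<integral>\<omega>. g (X s \<omega>) * alive (grid s T n) \<epsilon> (?N n) \<omega> * ramp r q (X T \<omega>) \<partial>M)
    \<longlonglongrightarrow> (\<integral>\<omega>. g (X s \<omega>) * alive_lim (grid s T) ?N \<epsilon> \<omega> * ramp r q (X T \<omega>) \<partial>M)"
    by (intro bounded_convergence abs_mult_le1 gb abs_le1_alive abs_ramp_le_1 r_pos tendsto_mult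
        tendsto_const alive_tendsto_alive_lim grid_refine refK) measurable
  have lim2: "(\<lambda>n. \<integral>\<omega>. g (X s \<omega>) * alive (grid s T n) \<epsilon> (split_index s n) \<omega> * drift_op r (ramp r q) (T - s) (X s \<omega>) \<partial>M)
    \<longlonglongrightarrow> (\<integral>\<omega>. g (X s \<omega>) * alive_lim (grid s T) (split_index s) \<epsilon> \<omega> * drift_op r (ramp r q) (T - s) (X s \<omega>) \<partial>M)"
    by (intro bounded_convergence abs_mult_le1 gb abs_le1_alive Ddb tendsto_mult
        tendsto_const alive_tendsto_alive_lim grid_refine refK) measurable
  have lim3: "(\<lambda>n. \<integral>\<omega>. W n \<omega> \<partial>M) \<longlonglongrightarrow> (\<integral>\<omega>. min 1 (?L * (\<epsilon> + 0)) \<partial>M)"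
  proof (rule bounded_convergence)
    fix \<omega> assume \<omega>: "\<omega> \<in> space M"
    have "(\<lambda>n. MAX k\<in>{..<?N n}. \<bar>X (grid s T n (Suc k)) \<omega> - X (grid s T n k) \<omega>\<bar>) \<longlonglongrightarrow> 0"
      by (rule mesh_oscillation_tendsto_0[OF grid_0 grid_end grid_less[OF sT] grid_mesh[OF sT] mesh_tendsto_0 continuous_X[OF \<omega>]]) simp
    then show "(\<lambda>n. W n \<omega>) \<longlonglongrightarrow> min 1 (?L * (\<epsilon> + 0))"
      unfolding W_def by (intro tendsto_intros)
  qed (use Wb in auto)
  have "\<bar>(\<integral>\<omega>. g (X s \<omega>) * alive_lim (grid s T) ?N \<epsilon> \<omega> * ramp r q (X T \<omega>) \<partial>M)
    - (\<integral>\<omega>. g (X s \<omega>) * alive_lim (grid s T) (split_index s) \<epsilon> \<omega> * drift_op r (ramp r q) (T - s) (X s \<omega>) \<partial>M)\<bar>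
    \<le> (\<integral>\<omega>. min 1 (?L * (\<epsilon> + 0)) \<partial>M)"
    by (rule LIMSEQ_le[OF tendsto_rabs[OF tendsto_diff[OF lim1 lim2]] lim3]) (use ineq in blast)
  also have "\<dots> \<le> ?L * \<epsilon>" by (simp add: prob_space)
  finally show ?thesis .
qed

text \<open>The margin \<epsilon> = 1 / (j + 1) tends to 0 with q fixed, so the error (q + 2 r)
  \<epsilon> vanishes.\<close>

lemma ramp_killing:
  assumes sT: "0 \<le> s" "s < T" and g[measurable]: "g \<in> borel_measurable borel" and gb: "\<And>x. \<bar>g x\<bar> \<le> 1"
  shows "(\<integral>\<omega>. g (X s \<omega>) * positive_until T \<omega> * ramp r q (X T \<omega>) \<partial>M)
    = (\<integral>\<omega>. g (X s \<omega>) * positive_until s \<omega> * drift_op r (ramp r q) (T - s) (X s \<omega>) \<partial>M)"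
proof -
  let ?N = "\<lambda>n. split_index s n + 2 ^ n"
  let ?e = "\<lambda>j::nat. 1 / (real j + 1)"
  have [measurable]: "positive_until T \<in> borel_measurable M" "positive_until s \<in> borel_measurable M"
    using sT by auto
  have Ddb: "\<bar>drift_op r (ramp r q) (T - s) x\<bar> \<le> 1" for x
    using drift_op_ramp_le[OF r_pos, of "T - s" q x] sT by simp
  have lim1: "(\<lambda>j. \<integral>\<omega>. g (X s \<omega>) * alive_lim (grid s T) ?N (?e j) \<omega> * ramp r q (X T \<omega>) \<partial>M)
    \<longlonglongrightarrow> (\<integral>\<omega>. g (X s \<omega>) * positive_until T \<omega> * ramp r q (X T \<omega>) \<partial>M)"
    by (intro bounded_convergence abs_mult_le1 gb abs_le1_alive_lim abs_ramp_le_1 r_pos tendsto_mult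
        tendsto_const alive_lim_tendsto_positive_until sT grid_end) measurable
  have lim2: "(\<lambda>j. \<integral>\<omega>. g (X s \<omega>) * alive_lim (grid s T) (split_index s) (?e j) \<omega> * drift_op r (ramp r q) (T - s) (X s \<omega>) \<partial>M)
    \<longlonglongrightarrow> (\<integral>\<omega>. g (X s \<omega>) * positive_until s \<omega> * drift_op r (ramp r q) (T - s) (X s \<omega>) \<partial>M)"
    by (intro bounded_convergence abs_mult_le1 gb abs_le1_alive_lim Ddb tendsto_mult
        tendsto_const alive_lim_tendsto_positive_until sT grid_split_index) measurable
  have lim3: "(\<lambda>j. (real q + 2 * r) * ?e j) \<longlonglongrightarrow> (real q + 2 * r) * 0"
    using LIMSEQ_inverse_real_of_nat by (intro tendsto_mult_left) (simp add: inverse_eq_divide add.commute)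
  have "\<bar>(\<integral>\<omega>. g (X s \<omega>) * positive_until T \<omega> * ramp r q (X T \<omega>) \<partial>M)
    - (\<integral>\<omega>. g (X s \<omega>) * positive_until s \<omega> * drift_op r (ramp r q) (T - s) (X s \<omega>) \<partial>M)\<bar> \<le> (real q + 2 * r) * 0"
    by (rule LIMSEQ_le[OF tendsto_rabs[OF tendsto_diff[OF lim1 lim2]] lim3])
      (intro exI[of _ 0] allI impI grid_killing sT g gb, simp)
  then show ?thesis by simp
qed

text \<open>The Markov property at time s of the killed process. On survival up to T the endpoint is
  strictly positive, so the ramp there equals 1 for all large q; the other side converges by
  \<open>drift_op_ramp_tendsto\<close>.\<close>

lemma killing:
  assumes sT: "0 \<le> s" "s < T" and g[measurable]: "g \<in> borel_measurable borel" and gb: "\<And>x. \<bar>g x\<bar> \<le> 1"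
  shows "(\<integral>\<omega>. g (X s \<omega>) * positive_until T \<omega> \<partial>M) = (\<integral>\<omega>. g (X s \<omega>) * positive_until s \<omega> * surv_prob r (T - s) (X s \<omega>) \<partial>M)"
proof -
  have [measurable]: "positive_until T \<in> borel_measurable M" "positive_until s \<in> borel_measurable M"
    using sT by auto
  have Ddb: "\<bar>drift_op r (ramp r q) (T - s) x\<bar> \<le> 1" for q x
    using drift_op_ramp_le[OF r_pos, of "T - s" q x] sT by simp
  have "(\<lambda>q. \<integral>\<omega>. g (X s \<omega>) * positive_until T \<omega> * ramp r q (X T \<omega>) \<partial>M) \<longlonglongrightarrow> (\<integral>\<omega>. g (X s \<omega>) * positive_until T \<omega> \<partial>M)"
  proof (intro bounded_convergence abs_mult_le1 gb abs_le1_positive_until abs_ramp_le_1 r_pos)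
    fix \<omega>
    show "(\<lambda>q. g (X s \<omega>) * positive_until T \<omega> * ramp r q (X T \<omega>)) \<longlonglongrightarrow> g (X s \<omega>) * positive_until T \<omega>"
    proof (cases "positive_until T \<omega> = 0")
      case False
      then have XT: "X T \<omega> > 0" using sT by (auto simp: positive_until_def split: if_splits)
      have "\<forall>\<^sub>F q in sequentially. ramp r q (X T \<omega>) = 1"
        using eventually_ge_at_top[of "nat \<lceil>1 / X T \<omega>\<rceil>"]
      proof eventually_elim
        case (elim q)
        then have "1 / X T \<omega> \<le> real q" by linarith
        then have "1 \<le> real q * X T \<omega>" using XT by (simp add: field_simps)
        then show ?case using XT by (simp add: ramp_def)
      qed
      then have "(\<lambda>q. ramp r q (X T \<omega>)) \<longlonglongrightarrow> 1" by (rule tendsto_eventually)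
      from tendsto_mult_left[OF this, of "g (X s \<omega>) * positive_until T \<omega>"] show ?thesis by simp
    qed simp
  qed measurable
  moreover have "(\<lambda>q. \<integral>\<omega>. g (X s \<omega>) * positive_until s \<omega> * drift_op r (ramp r q) (T - s) (X s \<omega>) \<partial>M)
      \<longlonglongrightarrow> (\<integral>\<omega>. g (X s \<omega>) * positive_until s \<omega> * surv_prob r (T - s) (X s \<omega>) \<partial>M)"
  proof (rule bounded_convergence)
    show "(\<lambda>q. g (X s \<omega>) * positive_until s \<omega> * drift_op r (ramp r q) (T - s) (X s \<omega>))
        \<longlonglongrightarrow> g (X s \<omega>) * positive_until s \<omega> * surv_prob r (T - s) (X s \<omega>)" for \<omega>
      using sT by (intro tendsto_mult_left drift_op_ramp_tendsto r_pos) simp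
    show "\<bar>g (X s \<omega>) * positive_until s \<omega> * drift_op r (ramp r q) (T - s) (X s \<omega>)\<bar> \<le> 1" for q \<omega>
      by (intro abs_mult_le1 gb abs_le1_positive_until Ddb)
  qed measurable
  ultimately show ?thesis
    unfolding ramp_killing[OF assms] by (rule LIMSEQ_unique)
qed

text \<open>The infimum could equal t although no zero lies in [0, t]; this is excluded because X t
  is nonzero, so continuity keeps the path away from 0 for some further time \<delta>.\<close>

lemma less_tau0_iff:
  assumes \<omega>: "\<omega> \<in> space M" and t: "t \<ge> 0"
  shows "ereal t < tau0 r X0 B \<omega> \<longleftrightarrow> (\<forall>v\<in>{0..t}. X v \<omega> \<noteq> 0)"
proof
  assume *: "ereal t < tau0 r X0 B \<omega>"
  show "\<forall>v\<in>{0..t}. X v \<omega> \<noteq> 0"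
  proof (intro ballI notI)
    fix v assume v: "v \<in> {0..t}" "X v \<omega> = 0"
    then have "tau0 r X0 B \<omega> \<le> ereal v"
      unfolding tau0_def by (intro Inf_lower) auto
    then show False using * v(1) by (metis atLeastAtMost_iff ereal_less_eq(3) leD le_less_trans order_less_le_trans)
  qed
next
  assume nz: "\<forall>v\<in>{0..t}. X v \<omega> \<noteq> 0"
  have "continuous (at t within {0..}) (\<lambda>v. X v \<omega>)"
    using continuous_X[OF \<omega>] t by (auto simp: continuous_on_eq_continuous_within)
  moreover have "\<bar>X t \<omega>\<bar> > 0" using nz t by auto
  ultimately obtain \<delta> where \<delta>: "\<delta> > 0" "\<And>v. v \<in> {0..} \<Longrightarrow> dist v t < \<delta> \<Longrightarrow> dist (X v \<omega>) (X t \<omega>) < \<bar>X t \<omega>\<bar>"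
    unfolding continuous_within_eps_delta by metis
  have "ereal (t + \<delta>) \<le> tau0 r X0 B \<omega>"
    unfolding tau0_def
  proof (rule Inf_greatest, safe)
    fix v assume v: "0 \<le> v" "X v \<omega> = 0"
    have "\<not> v \<le> t" using nz v by auto
    moreover have "\<not> dist v t < \<delta>" using \<delta>(2)[of v] v by (auto simp: dist_real_def)
    ultimately show "ereal (t + \<delta>) \<le> ereal v" by (auto simp: dist_real_def)
  qed
  moreover have "ereal t < ereal (t + \<delta>)" using \<delta>(1) by simp
  ultimately show "ereal t < tau0 r X0 B \<omega>" by (rule less_le_trans[rotated])
qed

lemma surv_eq: "t \<ge> 0 \<Longrightarrow> surv M r X0 B t = {\<omega>\<in>space M. \<forall>v\<in>{0..t}. X v \<omega> \<noteq> 0}"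
  unfolding surv_def using less_tau0_iff by blast

lemma surv_measurable[measurable]: "t \<ge> 0 \<Longrightarrow> surv M r X0 B t \<in> sets M"
  using nonzero_measurable by (simp add: surv_eq)

text \<open>A continuous path that starts above 0 and avoids 0 stays above it, by the intermediate
  value theorem.\<close>

lemma indicator_surv_eq_positive_until:
  assumes \<omega>: "\<omega> \<in> space M" "X0 \<omega> > 0" and t: "t \<ge> 0"
  shows "indicator (surv M r X0 B t) \<omega> = positive_until t \<omega>"
proof -
  have X00: "X 0 \<omega> > 0" using \<omega> by (simp add: Xp_def B_zero)
  have "(\<forall>v\<in>{0..t}. X v \<omega> \<noteq> 0) \<longleftrightarrow> (\<forall>v\<in>{0..t}. X v \<omega> > 0)"
  proof safe
    fix v assume nz: "\<forall>v\<in>{0..t}. X v \<omega> \<noteq> 0" and v: "v \<in> {0..t}"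
    show "X v \<omega> > 0"
    proof (rule ccontr)
      assume "\<not> X v \<omega> > 0"
      moreover have "continuous_on {0..v} (\<lambda>v. X v \<omega>)"
        using continuous_X[OF \<omega>(1)] by (rule continuous_on_subset) auto
      ultimately obtain x where "0 \<le> x" "x \<le> v" "X x \<omega> = 0"
        using IVT2'[of "\<lambda>v. X v \<omega>" v 0 0] X00 v by auto
      then show False using nz v by auto
    qed
  qed fastforce
  then show ?thesis using \<omega> t by (auto simp: surv_eq positive_until_def indicator_def)
qed

end

section \<open>The laws of the killed process\<close>

lemma power4_add_le: "(x + z) ^ 4 \<le> 8 * (x ^ 4 + z ^ 4)" for x z :: real
proof -
  have a: "(u + v)\<^sup>2 \<le> 2 * (u\<^sup>2 + v\<^sup>2)" for u v :: real
    using zero_le_power2[of "u - v"] by (simp add: power2_eq_square algebra_simps)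
  have "(x + z) ^ 4 = ((x + z)\<^sup>2)\<^sup>2" by (simp flip: power_mult)
  also have "\<dots> \<le> (2 * (x\<^sup>2 + z\<^sup>2))\<^sup>2" by (intro power_mono a) simp
  also have "\<dots> = 4 * (x\<^sup>2 + z\<^sup>2)\<^sup>2" unfolding power_mult_distrib by simp
  also have "\<dots> \<le> 4 * (2 * ((x\<^sup>2)\<^sup>2 + (z\<^sup>2)\<^sup>2))" by (intro mult_left_mono a) simp
  finally show ?thesis by (simp flip: power_mult)
qed

text \<open>The factor 24 is 4!, from the term of degree four in the exponential series; adding exp
  (- z) covers both signs. It trades the fourth power of the Brownian part for exponentials with
  known expectations.\<close>

lemma power4_le_exp: "z ^ 4 \<le> 24 * (exp z + exp (- z))" for z :: real
proof -
  have le: "z ^ 4 \<le> 24 * exp z" if "z \<ge> 0" for z :: real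
  proof -
    have "(\<lambda>n. z ^ n / fact n) sums exp z"
      using exp_converges[of z] by (simp add: divide_inverse mult.commute)
    then have "(\<Sum>n<5. z ^ n / fact n) \<le> exp z"
      using that sum_le_suminf[of "\<lambda>n. z ^ n / fact n" "{..<5}"] by (auto simp: sums_iff)
    moreover have "z ^ 4 / 24 \<le> (\<Sum>n<5. z ^ n / fact n)"
      using that by (simp add: numeral_eq_Suc lessThan_Suc)
    ultimately show ?thesis by simp
  qed
  show ?thesis
  proof (cases "z \<ge> 0")
    case True
    from le[OF True] show ?thesis by (rule order_trans) simp
  next
    case False
    then have "z ^ 4 \<le> 24 * exp (- z)" using le[of "- z"] by simp
    then show ?thesis by (rule order_trans) simp
  qed
qed

locale started_bm = drifted_bm +
  assumes X0_pos: "AE \<omega> in M. 0 < X0 \<omega>"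
    and X0_moment: "integrable M (\<lambda>\<omega>. X0 \<omega> ^ 4 * exp (r * X0 \<omega>))"
begin

definition killed_law :: "real \<Rightarrow> real measure" where
  "killed_law s = distr (density M (\<lambda>\<omega>. ennreal (positive_until s \<omega>))) borel (X s)"

lemma sets_killed_law[simp, measurable_cong]: "sets (killed_law s) = sets borel"
  by (simp add: killed_law_def)

lemma space_killed_law[simp]: "space (killed_law s) = UNIV"
  by (simp add: killed_law_def)

lemma positive_until_nonneg: "0 \<le> positive_until s \<omega>"
  by (simp add: positive_until_def)

lemma nn_integral_killed_law:
  assumes "s \<ge> 0" and [measurable]: "f \<in> borel_measurable borel"
  shows "(\<integral>\<^sup>+y. f y \<partial>killed_law s) = (\<integral>\<^sup>+\<omega>. ennreal (positive_until s \<omega>) * f (X s \<omega>) \<partial>M)"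
proof -
  have [measurable]: "positive_until s \<in> borel_measurable M" using assms by simp
  show ?thesis unfolding killed_law_def by (simp add: nn_integral_distr nn_integral_density)
qed

lemma
  fixes f :: "real \<Rightarrow> real"
  assumes "s \<ge> 0" and [measurable]: "f \<in> borel_measurable borel"
  shows integral_killed_law: "(\<integral>y. f y \<partial>killed_law s) = (\<integral>\<omega>. positive_until s \<omega> * f (X s \<omega>) \<partial>M)"
    and integrable_killed_law: "integrable (killed_law s) f \<longleftrightarrow> integrable M (\<lambda>\<omega>. positive_until s \<omega> * f (X s \<omega>))"
proof -
  have [measurable]: "positive_until s \<in> borel_measurable M" using assms by simp
  show "(\<integral>y. f y \<partial>killed_law s) = (\<integral>\<omega>. positive_until s \<omega> * f (X s \<omega>) \<partial>M)"
    unfolding killed_law_def by (simp add: integral_distr integral_density positive_until_nonneg)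
  show "integrable (killed_law s) f \<longleftrightarrow> integrable M (\<lambda>\<omega>. positive_until s \<omega> * f (X s \<omega>))"
    unfolding killed_law_def by (simp add: integrable_distr_eq integrable_density positive_until_nonneg)
qed

lemma finite_killed_law: "s \<ge> 0 \<Longrightarrow> finite_measure (killed_law s)"
proof (rule finite_measureI)
  assume s: "s \<ge> 0"
  have [measurable]: "positive_until s \<in> borel_measurable M" using s by simp
  have "emeasure (killed_law s) (space (killed_law s)) = (\<integral>\<^sup>+\<omega>. ennreal (positive_until s \<omega>) \<partial>M)"
    using nn_integral_killed_law[OF s, of "\<lambda>_. 1"] by simp
  also have "\<dots> \<le> (\<integral>\<^sup>+\<omega>. 1 \<partial>M)" by (intro nn_integral_mono) (simp add: positive_until_def)
  also have "\<dots> = 1" by (simp add: emeasure_space_1)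
  finally show "emeasure (killed_law s) (space (killed_law s)) \<noteq> \<infinity>"
    by (auto simp: top_unique)
qed

lemma AE_killed_law_pos: "s \<ge> 0 \<Longrightarrow> AE y in killed_law s. 0 < y"
proof -
  assume s: "s \<ge> 0"
  have [measurable]: "positive_until s \<in> borel_measurable M" using s by simp
  have "AE \<omega> in M. 0 < ennreal (positive_until s \<omega>) \<longrightarrow> 0 < X s \<omega>"
    using s by (intro AE_I2) (simp add: positive_until_def)
  then show ?thesis
    unfolding killed_law_def by (simp add: AE_distr_iff AE_density)
qed

lemma indep_X0_B: "s \<ge> 0 \<Longrightarrow> indep_var borel X0 borel (B s)"
  unfolding indep_var_eq
proof safe
  assume s: "s \<ge> 0"
  show "indep_set (sigma_sets (space M) {X0 -` A \<inter> space M |A. A \<in> sets borel})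
     (sigma_sets (space M) {B s -` A \<inter> space M |A. A \<in> sets borel})"
    using indep_X0 unfolding indep_set_def
  proof (rule indep_sets_mono_sets)
    fix i :: bool
    have "sigma_sets (space M) {B s -` A \<inter> space M |A. A \<in> sets borel}
        \<subseteq> sigma_sets (space M) {B t -` A \<inter> space M |t A. 0 \<le> t \<and> A \<in> sets borel}"
      using s by (intro sigma_sets_mono') auto
    then show "case_bool (sigma_sets (space M) {X0 -` A \<inter> space M |A. A \<in> sets borel})
       (sigma_sets (space M) {B s -` A \<inter> space M |A. A \<in> sets borel}) i \<subseteq>
       case_bool (sigma_sets (space M) {X0 -` A \<inter> space M |A. A \<in> sets borel})
       (sigma_sets (space M) {B t -` A \<inter> space M |t A. 0 \<le> t \<and> A \<in> sets borel}) i"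
      by (auto split: bool.split)
  qed
qed simp_all

section \<open>Moments at time s\<close>

lemma integrable_exp_B: "s \<ge> 0 \<Longrightarrow> integrable M (\<lambda>\<omega>. exp (c * B s \<omega>))"
proof (cases "s = 0")
  \<comment> \<open>At s = 0 the Gaussian degenerates and \<open>distributed_increment\<close> does
    not apply.\<close>
  case True
  have "integrable M (\<lambda>\<omega>. 1 :: real)" by simp
  then show ?thesis using True by (subst Bochner_Integration.integrable_cong[where g="\<lambda>_. 1"]) (auto simp: B_zero)
next
  case False
  assume "s \<ge> 0"
  with False have s: "s > 0" by simp
  have d: "distributed M lborel (\<lambda>\<omega>. B s \<omega> - B 0 \<omega>) (\<lambda>x. ennreal (normal_density 0 (sqrt s) x))"
    using distributed_increment[of 0 s] s by simp
  \<comment> \<open>Completing the square: tilting by exp (c x) moves the mean to c s.\<close>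
  have eq: "normal_density 0 (sqrt s) x * exp (c * x) = exp (c\<^sup>2 * s / 2) * normal_density (c * s) (sqrt s) x" for x
  proof -
    have "- x\<^sup>2 / (2 * s) + c * x = c\<^sup>2 * s / 2 + (- (x - c * s)\<^sup>2 / (2 * s))"
      using s by (simp add: field_simps power2_eq_square)
    then show ?thesis using s by (simp add: normal_density_def exp_add[symmetric] mult_ac)
  qed
  have "integrable lborel (\<lambda>x. normal_density 0 (sqrt s) x * exp (c * x))"
    unfolding eq using s by simp
  then have "integrable M (\<lambda>\<omega>. exp (c * (B s \<omega> - B 0 \<omega>)))"
    using distributed_integrable[OF d, of "\<lambda>x. exp (c * x)"] by simp
  then show ?thesis
    by (subst Bochner_Integration.integrable_cong[where g="\<lambda>\<omega>. exp (c * (B s \<omega> - B 0 \<omega>))"]) (auto simp: B_zero)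
qed

lemma integrable_exp_X0: "integrable M (\<lambda>\<omega>. exp (r * X0 \<omega>))"
proof (rule Bochner_Integration.integrable_bound)
  show "integrable M (\<lambda>\<omega>. exp r + X0 \<omega> ^ 4 * exp (r * X0 \<omega>))"
    using X0_moment by simp
  have "exp (r * x) \<le> exp r + x ^ 4 * exp (r * x)" for x
  proof (cases "x \<le> 1")
    case True
    then have "exp (r * x) \<le> exp r" using r_pos by simp
    moreover have "0 \<le> x ^ 4 * exp (r * x)" by simp
    ultimately show ?thesis by linarith
  next
    case False
    then have "1 * exp (r * x) \<le> x ^ 4 * exp (r * x)" by (intro mult_right_mono) auto
    moreover have "0 < exp r" by simp
    ultimately show ?thesis by linarith
  qed
  then show "AE \<omega> in M. norm (exp (r * X0 \<omega>)) \<le> norm (exp r + X0 \<omega> ^ 4 * exp (r * X0 \<omega>))"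
    by (intro AE_I2) (simp add: order_trans[OF _ abs_ge_self])
qed simp

lemma integrable_X_moment:
  assumes s: "s \<ge> 0"
  shows "integrable M (\<lambda>\<omega>. X s \<omega> ^ 4 * exp (r * X s \<omega>))"
proof -
  define b where "b c \<omega> = exp (c * (B s \<omega> - r * s))" for c \<omega>
  have ib: "integrable M (b c)" for c
  proof -
    have "b c = (\<lambda>\<omega>. exp (c * B s \<omega>) * exp (- (c * (r * s))))" by (simp add: b_def fun_eq_iff right_diff_distrib exp_diff exp_minus divide_inverse)
    then show ?thesis using integrable_exp_B[OF s, of c] by simp
  qed
  have prod: "integrable M (\<lambda>\<omega>. f (X0 \<omega>) * b c \<omega>)" if "integrable M (\<lambda>\<omega>. f (X0 \<omega>))" and [measurable]: "f \<in> borel_measurable borel" for f :: "real \<Rightarrow> real" and c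
  proof -
    have "indep_var borel (f \<circ> X0) borel ((\<lambda>x. exp (c * (x - r * s))) \<circ> B s)"
      by (rule indep_var_compose[OF indep_X0_B[OF s]]) auto
    then have "indep_var borel (\<lambda>\<omega>. f (X0 \<omega>)) borel (b c)"
      by (simp add: comp_def b_def[abs_def])
    then show ?thesis by (rule indep_var_integrable) (fact that(1) ib)+
  qed
  \<comment> \<open>The constant 192 is 8 * 24, from \<open>power4_add_le\<close> and
    \<open>power4_le_exp\<close>; the exponents r + 1 and r - 1 arise from e^(r z) times e^z and
    e^(- z). Each summand is a function of \<open>X0\<close> times an independent exponential of B
    s.\<close>
  let ?w = "\<lambda>\<omega>. 8 * (X0 \<omega> ^ 4 * exp (r * X0 \<omega>) * b r \<omega>)
      + 192 * (exp (r * X0 \<omega>) * b (r + 1) \<omega> + exp (r * X0 \<omega>) * b (r - 1) \<omega>)"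
  show ?thesis
  proof (rule Bochner_Integration.integrable_bound)
    show "integrable M ?w"
      by (intro Bochner_Integration.integrable_add integrable_mult_right prod[of "\<lambda>x. exp (r * x)"]
          prod[of "\<lambda>x. x ^ 4 * exp (r * x)"] X0_moment integrable_exp_X0) auto
    have "X s \<omega> ^ 4 * exp (r * X s \<omega>) \<le> ?w \<omega>" for \<omega>
    proof -
      define x z where "x = X0 \<omega>" and "z = B s \<omega> - r * s"
      have X: "X s \<omega> = x + z" by (simp add: Xp_def x_def z_def)
      have "(x + z) ^ 4 \<le> 8 * (x ^ 4 + 24 * (exp z + exp (- z)))"
        by (rule order_trans[OF power4_add_le]) (intro mult_left_mono add_left_mono power4_le_exp, simp)
      then have "(x + z) ^ 4 * exp (r * (x + z)) \<le> 8 * (x ^ 4 + 24 * (exp z + exp (- z))) * exp (r * (x + z))"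
        by (intro mult_right_mono) auto
      also have "\<dots> = 8 * (x ^ 4 * exp (r * x) * exp (r * z))
          + 192 * (exp (r * x) * exp ((r + 1) * z) + exp (r * x) * exp ((r - 1) * z))"
        by (simp add: algebra_simps exp_add exp_diff exp_minus divide_inverse)
      finally show ?thesis by (simp add: X b_def x_def z_def)
    qed
    then show "AE \<omega> in M. norm (X s \<omega> ^ 4 * exp (r * X s \<omega>)) \<le> norm (?w \<omega>)"
      by (intro AE_I2) (simp add: order_trans[OF _ abs_ge_self])
  qed measurable
qed

text \<open>The moment hypothesis enters here: eta y * y^3 is y^4 e^(r y) up to the factor
  r^2.\<close>

lemma eta_moments_killed_law:
  assumes s: "s \<ge> 0"
  shows "eta_moments (killed_law s) r"
proof -
  have [measurable]: "positive_until s \<in> borel_measurable M" using s by simp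
  interpret finite_measure "killed_law s" by (rule finite_killed_law[OF s])
  show ?thesis
  proof unfold_locales
    have "integrable M (\<lambda>\<omega>. positive_until s \<omega> * (X s \<omega> ^ 4 * exp (r * X s \<omega>) / r\<^sup>2))"
    proof (rule Bochner_Integration.integrable_bound)
      show "integrable M (\<lambda>\<omega>. X s \<omega> ^ 4 * exp (r * X s \<omega>) / r\<^sup>2)"
        using integrable_X_moment[OF s] by simp
      show "AE \<omega> in M. norm (positive_until s \<omega> * (X s \<omega> ^ 4 * exp (r * X s \<omega>) / r\<^sup>2)) \<le> norm (X s \<omega> ^ 4 * exp (r * X s \<omega>) / r\<^sup>2)"
        by (intro AE_I2) (simp add: positive_until_def)
    qed measurable
    moreover have "eta r y * y ^ 3 = y ^ 4 * exp (r * y) / r\<^sup>2" for y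
      by (simp add: eta_def power_numeral_reduce)
    ultimately show "integrable (killed_law s) (\<lambda>y. eta r y * y ^ 3)"
      using s by (simp add: integrable_killed_law)
  qed (use s r_pos AE_killed_law_pos in auto)
qed

text \<open>One Markov step from time 0 to s > 0 gives the free process a Gaussian kernel, which
  does not charge points; killing only removes mass.\<close>

lemma killed_law_no_atoms:
  assumes s: "s > 0"
  shows "emeasure (killed_law s) {c} = 0"
proof -
  have [measurable]: "positive_until s \<in> borel_measurable M" using s by simp
  have dz: "drift_op r (indicator {c}) s x = 0" for x
  proof -
    have "drift_op r (indicator {c}) s x = (\<integral>z. indicator {c - x + r * s} z * normal_density 0 (sqrt s) z \<partial>lborel)"
      unfolding drift_op_def by (intro Bochner_Integration.integral_cong) (auto simp: indicator_def)
    also have "\<dots> = (\<integral>z. 0 \<partial>(lborel :: real measure))"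
    proof (rule integral_cong_AE)
      show "AE z in lborel. indicator {c - x + r * s} z * normal_density 0 (sqrt s) z = 0"
        using AE_lborel_singleton[of "c - x + r * s"] by eventually_elim simp
    qed simp_all
    finally show ?thesis by simp
  qed
  let ?ts = "\<lambda>i. s * real i"
  have "(\<integral>\<omega>. (\<lambda>_. 1) \<omega> * indicator {c} (X (?ts 1) \<omega>) \<partial>M)
    = (\<integral>\<omega>. (\<lambda>_. 1) \<omega> * drift_op r (indicator {c}) (?ts 1 - ?ts 0) (X (?ts 0) \<omega>) \<partial>M)"
    by (rule markov_step[of ?ts 0 1 "\<lambda>_. 1" 1 _ 1]) (use s in \<open>auto simp: indicator_def\<close>)
  then have "(\<integral>\<omega>. indicator {c} (X s \<omega>) \<partial>M) = (0::real)" by (simp add: dz)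
  then have "(\<integral>\<^sup>+\<omega>. ennreal (indicator {c} (X s \<omega>)) \<partial>M) = 0"
    by (subst nn_integral_eq_integral) (auto intro!: integrable_bounded[of _ 1] simp: indicator_def)
  moreover have "(\<integral>\<^sup>+\<omega>. ennreal (positive_until s \<omega>) * indicator {c} (X s \<omega>) \<partial>M) \<le> (\<integral>\<^sup>+\<omega>. ennreal (indicator {c} (X s \<omega>)) \<partial>M)"
    by (intro nn_integral_mono) (auto simp: positive_until_def indicator_def)
  moreover have "emeasure (killed_law s) {c} = (\<integral>\<^sup>+\<omega>. ennreal (positive_until s \<omega>) * indicator {c} (X s \<omega>) \<partial>M)"
    using s nn_integral_killed_law[of s "indicator {c}"] by (simp add: nn_integral_indicator)
  ultimately show ?thesis by simp
qed

lemma killing_killed_law: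
  assumes sT: "0 \<le> s" "s < t" and g[measurable]: "g \<in> borel_measurable borel" and gb: "\<And>x. \<bar>g x\<bar> \<le> 1"
  shows "(\<integral>\<omega>. g (X s \<omega>) * positive_until t \<omega> \<partial>M) = 2 / ((t - s) * sqrt (2 * pi * (t - s))) * exp (- r\<^sup>2 * (t - s) / 2)
      * (\<integral>y. g y * (eta r y * rel_surv r (t - s) y) \<partial>killed_law s)"
proof -
  let ?c = "2 / ((t - s) * sqrt (2 * pi * (t - s))) * exp (- r\<^sup>2 * (t - s) / 2)"
  have "(\<integral>\<omega>. g (X s \<omega>) * positive_until t \<omega> \<partial>M) = (\<integral>\<omega>. g (X s \<omega>) * positive_until s \<omega> * surv_prob r (t - s) (X s \<omega>) \<partial>M)"
    by (rule killing[OF assms])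
  also have "\<dots> = (\<integral>y. g y * surv_prob r (t - s) y \<partial>killed_law s)"
    using sT by (subst integral_killed_law) (auto simp: mult_ac)
  also have "\<dots> = (\<integral>y. ?c * (g y * (eta r y * rel_surv r (t - s) y)) \<partial>killed_law s)"
  proof (rule integral_cong_AE)
    show "AE y in killed_law s. g y * surv_prob r (t - s) y = ?c * (g y * (eta r y * rel_surv r (t - s) y))"
      using AE_killed_law_pos[OF sT(1)]
    proof eventually_elim
      case (elim y)
      show ?case using surv_prob_eq[OF r_pos _ elim, of "t - s"] sT by simp
    qed
  qed measurable
  finally show ?thesis by simp
qed

text \<open>Both sides are the limit as \<open>t \<rightarrow> \<infinity>\<close> of the normalised survival probability up to \<open>t\<close>,
  computed from the killed law at time \<open>s\<close> and at time 0.\<close>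

lemma mom_0_killed_law:
  assumes s: "s \<ge> 0"
  shows "exp (r\<^sup>2 * s / 2) * eta_moments.mom (killed_law s) r 0 = (\<integral>\<omega>. eta r (X0 \<omega>) \<partial>M)"
proof -
  interpret S: eta_moments "killed_law s" r by (rule eta_moments_killed_law[OF s])
  interpret Z: eta_moments "killed_law 0" r by (rule eta_moments_killed_law) simp
  let ?c = "\<lambda>t. 2 / (t * sqrt (2 * pi * t)) * exp (- r\<^sup>2 * t / 2)"
  have eq: "?c (t - s) * S.mass (t - s) = ?c t * Z.mass t" if "t > s" for t
    using killing_killed_law[OF s that, of "\<lambda>_. 1"] killing_killed_law[of 0 t "\<lambda>_. 1"] that s
    by (simp add: S.mass_def Z.mass_def)
  have ratio: "((\<lambda>t. ?c (t - s) / ?c t) \<longlongrightarrow> exp (r\<^sup>2 * s / 2)) at_top"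
  proof -
    \<comment> \<open>The ratio after cancellation: the prefactors t^(-3/2) give a power of t / (t -
      s), which tends to 1, and the exponentials give the constant exp (r^2 s / 2).\<close>
    have "((\<lambda>t. t / (t - s) * sqrt (t / (t - s)) * exp (r\<^sup>2 * s / 2)) \<longlongrightarrow> exp (r\<^sup>2 * s / 2)) at_top"
      by real_asymp
    moreover have "\<forall>\<^sub>F t in at_top. t / (t - s) * sqrt (t / (t - s)) * exp (r\<^sup>2 * s / 2) = ?c (t - s) / ?c t"
      using eventually_gt_at_top[of s]
    proof eventually_elim
      case (elim t)
      define a b e where "a = sqrt (2 * pi * t)" and "b = sqrt (2 * pi * (t - s))" and "e = exp (- r\<^sup>2 * t / 2)"
      have pos: "a > 0" "b > 0" "e > 0" "t > 0" "t - s > 0" using elim s by (simp_all add: a_def b_def e_def)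
      have ee: "exp (- r\<^sup>2 * (t - s) / 2) = e * exp (r\<^sup>2 * s / 2)"
        by (simp add: e_def exp_add[symmetric] field_simps)
      have ab: "sqrt (t / (t - s)) = a / b"
        by (simp add: a_def b_def flip: real_sqrt_divide)
      show ?case unfolding ee ab a_def[symmetric] b_def[symmetric] e_def[symmetric]
        using pos by (simp del: exp_gt_zero add: divide_simps)
    qed
    ultimately show ?thesis by (rule Lim_transform_eventually)
  qed
  have shift: "filterlim (\<lambda>t. t - s) at_top at_top" by real_asymp
  have "((\<lambda>t. ?c (t - s) / ?c t * S.mass (t - s)) \<longlongrightarrow> exp (r\<^sup>2 * s / 2) * S.mom 0) at_top"
    by (intro tendsto_mult ratio filterlim_compose[OF S.mass_tendsto shift])
  moreover have "\<forall>\<^sub>F t in at_top. ?c (t - s) / ?c t * S.mass (t - s) = Z.mass t"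
    using eventually_gt_at_top[of s]
  proof eventually_elim
    case (elim t)
    then have "?c t \<noteq> 0" using s by simp
    moreover have "a / b * m = n" if "b \<noteq> 0" "a * m = b * n" for a b m n :: real
      using that by (simp add: field_simps)
    ultimately show ?case using eq[OF elim] by blast
  qed
  ultimately have "(Z.mass \<longlongrightarrow> exp (r\<^sup>2 * s / 2) * S.mom 0) at_top"
    by (rule Lim_transform_eventually)
  then have "exp (r\<^sup>2 * s / 2) * S.mom 0 = Z.mom 0"
    using Z.mass_tendsto by (rule tendsto_unique[OF trivial_limit_at_top_linorder])
  also have "Z.mom 0 = (\<integral>\<omega>. positive_until 0 \<omega> * eta r (X 0 \<omega>) \<partial>M)"
    by (simp add: Z.mom_def integral_killed_law)
  also have "\<dots> = (\<integral>\<omega>. eta r (X0 \<omega>) \<partial>M)"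
  proof (rule integral_cong_AE)
    show "AE \<omega> in M. positive_until 0 \<omega> * eta r (X 0 \<omega>) = eta r (X0 \<omega>)"
      using X0_pos AE_space by eventually_elim (simp add: positive_until_def Xp_def B_zero)
  qed measurable
  finally show ?thesis .
qed

text \<open>\<open>mom_0_killed_law\<close> moves the question to time 0, where \<open>eta\<close>
  is almost surely positive; no lower bound on the probability of survival up to s has to be
  found.\<close>

lemma mom_0_pos:
  assumes s: "s \<ge> 0"
  shows "0 < eta_moments.mom (killed_law s) r 0"
proof -
  interpret Z: eta_moments "killed_law 0" r by (rule eta_moments_killed_law) simp
  have e: "AE \<omega> in M. 0 < eta r (X0 \<omega>)"
    using X0_pos by eventually_elim (rule Z.eta_pos)
  have "0 \<le> (\<integral>\<omega>. eta r (X0 \<omega>) \<partial>M)" using e by (intro integral_nonneg_AE) (auto elim: AE_mp)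
  moreover have "(\<integral>\<omega>. eta r (X0 \<omega>) \<partial>M) \<noteq> 0"
  proof
    assume 0: "(\<integral>\<omega>. eta r (X0 \<omega>) \<partial>M) = 0"
    have "integrable M (\<lambda>\<omega>. positive_until 0 \<omega> * eta r (X 0 \<omega>))"
      using Z.integrable_mom[of 0] by (simp add: integrable_killed_law)
    moreover have "AE \<omega> in M. positive_until 0 \<omega> * eta r (X 0 \<omega>) = eta r (X0 \<omega>)"
      using X0_pos AE_space by eventually_elim (simp add: positive_until_def Xp_def B_zero)
    ultimately have "integrable M (\<lambda>\<omega>. eta r (X0 \<omega>))"
      by (subst integrable_cong_AE[symmetric]) auto
    with 0 e have "AE \<omega> in M. eta r (X0 \<omega>) = 0"
      by (subst integral_nonneg_eq_0_iff_AE[symmetric]) (auto elim: AE_mp)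
    with e have "AE \<omega> in M. False" by eventually_elim simp
    then show False by (simp add: AE_False)
  qed
  ultimately have "0 < exp (r\<^sup>2 * s / 2) * eta_moments.mom (killed_law s) r 0"
    using mom_0_killed_law[OF s] by simp
  then show ?thesis by (simp add: zero_less_mult_iff)
qed

section \<open>Identification of the two laws\<close>

lemma AE_indicator_surv: "t \<ge> 0 \<Longrightarrow> AE \<omega> in M. indicator (surv M r X0 B t) \<omega> = positive_until t \<omega>"
  using X0_pos AE_space by eventually_elim (rule indicator_surv_eq_positive_until)

lemma Q_law_eq:
  assumes s: "s \<ge> 0"
  shows "Q_law M r X0 B (distr M borel X0) s = eta_moments.limit_law (killed_law s) r"
proof -
  interpret S: eta_moments "killed_law s" r by (rule eta_moments_killed_law[OF s])
  have [measurable]: "positive_until s \<in> borel_measurable M" "surv M r X0 B s \<in> sets M" using s by auto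
  let ?C = "exp (r\<^sup>2 * s / 2) / (\<integral>x. eta r x \<partial>distr M borel X0)"
  \<comment> \<open>By \<open>mom_0_killed_law\<close> the constant of the Q-process is exactly the
    one that normalises \<open>eta\<close> under the killed law.\<close>
  have C: "?C = 1 / S.mom 0"
    using mom_0_killed_law[OF s, symmetric] mom_0_pos[OF s] by (simp add: integral_distr)
  show ?thesis
  proof (rule measure_eqI)
    show "sets (Q_law M r X0 B (distr M borel X0) s) = sets S.limit_law"
      by (simp add: Q_law_def S.limit_law_def)
    fix A assume "A \<in> sets (Q_law M r X0 B (distr M borel X0) s)"
    then have [measurable]: "A \<in> sets borel" by (simp add: Q_law_def)
    have "emeasure (Q_law M r X0 B (distr M borel X0) s) A
        = (\<integral>\<^sup>+\<omega>. ennreal (?C * eta r (X s \<omega>) * indicator (surv M r X0 B s) \<omega>) * indicator A (X s \<omega>) \<partial>M)"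
      unfolding Q_law_def
      by (simp add: emeasure_distr emeasure_density) (auto intro!: nn_integral_cong simp: indicator_def)
    also have "\<dots> = (\<integral>\<^sup>+\<omega>. ennreal (positive_until s \<omega>) * (ennreal (eta r (X s \<omega>) / S.mom 0) * indicator A (X s \<omega>)) \<partial>M)"
      using AE_indicator_surv[OF s] unfolding C
      by (intro nn_integral_cong_AE, eventually_elim) (auto simp: positive_until_def)
    also have "\<dots> = (\<integral>\<^sup>+y. ennreal (eta r y / S.mom 0) * indicator A y \<partial>killed_law s)"
      using s by (subst nn_integral_killed_law) auto
    also have "\<dots> = emeasure S.limit_law A"
      unfolding S.limit_law_def by (subst emeasure_density) auto
    finally show "emeasure (Q_law M r X0 B (distr M borel X0) s) A = emeasure S.limit_law A" .
  qed
qed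

text \<open>The probability of survival up to t, with or without the restriction of
  \<open>X s\<close> to A, carries the same prefactor in t - s, which cancels in the
  quotient.\<close>

lemma cond_law_eq:
  assumes s: "s \<ge> 0" "s < t" and mass: "eta_moments.mass (killed_law s) r (t - s) > 0"
  shows "cond_law M r X0 B s t = eta_moments.pre_law (killed_law s) r (t - s)"
proof -
  interpret S: eta_moments "killed_law s" r by (rule eta_moments_killed_law[OF s(1)])
  let ?T = "t - s"
  let ?c = "2 / (?T * sqrt (2 * pi * ?T)) * exp (- r\<^sup>2 * ?T / 2)"
  have T: "?T > 0" and c: "?c > 0" using s by auto
  have [measurable]: "positive_until t \<in> borel_measurable M" "surv M r X0 B t \<in> sets M" using s by auto
  have int: "integrable (killed_law s) (\<lambda>y. eta r y * rel_surv r ?T y)"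
    using S.integrable_rel(1)[OF T, of "\<lambda>_. 1"] by simp
  have surv_A: "measure M (surv M r X0 B t \<inter> (X s -` A \<inter> space M))
      = ?c * (\<integral>y. indicator A y * (eta r y * rel_surv r ?T y) \<partial>killed_law s)" if [measurable]: "A \<in> sets borel" for A
  proof -
    have "measure M (surv M r X0 B t \<inter> (X s -` A \<inter> space M)) = (\<integral>\<omega>. indicator (surv M r X0 B t \<inter> (X s -` A \<inter> space M)) \<omega> \<partial>M)"
      by simp
    also have "\<dots> = (\<integral>\<omega>. indicator A (X s \<omega>) * positive_until t \<omega> \<partial>M)"
    proof (rule integral_cong_AE)
      have "t \<ge> 0" using s by simp
      from AE_indicator_surv[OF this] AE_space
      show "AE \<omega> in M. indicator (surv M r X0 B t \<inter> (X s -` A \<inter> space M)) \<omega> = indicator A (X s \<omega>) * positive_until t \<omega>"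
        by eventually_elim (auto simp: indicator_def split: if_splits)
    qed measurable
    also have "\<dots> = ?c * (\<integral>y. indicator A y * (eta r y * rel_surv r ?T y) \<partial>killed_law s)"
      by (rule killing_killed_law[OF s]) (auto simp: indicator_def)
    finally show ?thesis .
  qed
  have surv_UNIV: "measure M (surv M r X0 B t) = ?c * S.mass ?T"
  proof -
    have "surv M r X0 B t \<subseteq> space M" by (auto simp: surv_def)
    then show ?thesis using surv_A[of UNIV] by (simp add: S.mass_def Int_absorb2)
  qed
  have surv_pos: "measure M (surv M r X0 B t) > 0"
    unfolding surv_UNIV using c mass by (rule mult_pos_pos)
  show ?thesis
  proof (rule measure_eqI)
    show "sets (cond_law M r X0 B s t) = sets (S.pre_law ?T)"
      by (simp add: cond_law_def S.pre_law_def)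
    fix A assume "A \<in> sets (cond_law M r X0 B s t)"
    then have [measurable]: "A \<in> sets borel" by (simp add: cond_law_def)
    have "emeasure (cond_law M r X0 B s t) A = emeasure (uniform_measure M (surv M r X0 B t)) (X s -` A \<inter> space M)"
      unfolding cond_law_def by (subst emeasure_distr) auto
    also have "\<dots> = emeasure M (surv M r X0 B t \<inter> (X s -` A \<inter> space M)) / emeasure M (surv M r X0 B t)"
      by (rule emeasure_uniform_measure) auto
    also have "\<dots> = ennreal (measure M (surv M r X0 B t \<inter> (X s -` A \<inter> space M)) / measure M (surv M r X0 B t))"
      using surv_pos by (simp add: emeasure_eq_measure divide_ennreal)
    also have "measure M (surv M r X0 B t \<inter> (X s -` A \<inter> space M)) / measure M (surv M r X0 B t)
        = (\<integral>y. eta r y * rel_surv r ?T y / S.mass ?T * indicator A y \<partial>killed_law s)"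
    proof -
      have "?c * (\<integral>y. indicator A y * (eta r y * rel_surv r ?T y) \<partial>killed_law s) / (?c * S.mass ?T)
          = (\<integral>y. indicator A y * (eta r y * rel_surv r ?T y) \<partial>killed_law s) / S.mass ?T"
        by (rule mult_divide_mult_cancel_left) (rule less_imp_neq[OF c, symmetric])
      also have "\<dots> = (\<integral>y. indicator A y * (eta r y * rel_surv r ?T y) / S.mass ?T \<partial>killed_law s)" by simp
      also have "\<dots> = (\<integral>y. eta r y * rel_surv r ?T y / S.mass ?T * indicator A y \<partial>killed_law s)"
        by (intro Bochner_Integration.integral_cong) (simp_all add: mult_ac)
      finally show ?thesis unfolding surv_A[OF \<open>A \<in> sets borel\<close>] surv_UNIV .
    qed
    also have "ennreal \<dots> = (\<integral>\<^sup>+y. ennreal (eta r y * rel_surv r ?T y / S.mass ?T * indicator A y) \<partial>killed_law s)"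
    proof (rule nn_integral_eq_integral[symmetric])
      have "integrable (killed_law s) (\<lambda>y. eta r y * rel_surv r ?T y / S.mass ?T)" using int by simp
      then show "integrable (killed_law s) (\<lambda>y. eta r y * rel_surv r ?T y / S.mass ?T * indicator A y)"
        by (rule integrable_real_mult_indicator[rotated]) simp
      show "AE y in killed_law s. 0 \<le> eta r y * rel_surv r ?T y / S.mass ?T * indicator A y"
        using S.pre_law_density_nonneg[OF T mass] by eventually_elim (simp add: indicator_def)
    qed
    also have "\<dots> = (\<integral>\<^sup>+y. ennreal (eta r y * rel_surv r ?T y / S.mass ?T) * indicator A y \<partial>killed_law s)"
      by (intro nn_integral_cong) (simp add: indicator_def)
    also have "\<dots> = emeasure (S.pre_law ?T) A"
      unfolding S.pre_law_def by (subst emeasure_density) auto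
    finally show "emeasure (cond_law M r X0 B s t) A = emeasure (S.pre_law ?T) A" .
  qed
qed

theorem W1_cond_law_rate:
  assumes s: "s > 0"
  shows "0 < Liminf at_top (\<lambda>t. ereal t * W1 (cond_law M r X0 B s t) (Q_law M r X0 B (distr M borel X0) s))"
    "Limsup at_top (\<lambda>t. ereal t * W1 (cond_law M r X0 B s t) (Q_law M r X0 B (distr M borel X0) s)) < \<infinity>"
proof -
  have s0: "s \<ge> 0" using s by simp
  interpret S: eta_moments "killed_law s" r by (rule eta_moments_killed_law[OF s0])
  note m = mom_0_pos[OF s0]
  have shift: "filterlim (\<lambda>t. t - s) at_top at_top" by real_asymp
  have "\<forall>\<^sub>F T in at_top. 0 < S.mass T" by (rule order_tendstoD(1)[OF S.mass_tendsto m])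
  then have "\<forall>\<^sub>F t in at_top. 0 < S.mass (t - s)" using shift unfolding filterlim_iff by blast
  \<comment> \<open>The identification of the conditional law needs positive mass, which holds for
    large t only; this is enough for limits inferior and superior.\<close>
  then have ev: "\<forall>\<^sub>F t in at_top. ereal t * W1 (cond_law M r X0 B s t) (Q_law M r X0 B (distr M borel X0) s)
      = ereal t * W1 (S.pre_law (t - s)) S.limit_law"
    using eventually_gt_at_top[of s]
    by eventually_elim (simp add: cond_law_eq s0 Q_law_eq)
  note rate = S.W1_rate[OF m killed_law_no_atoms[OF s] s0]
  show "0 < Liminf at_top (\<lambda>t. ereal t * W1 (cond_law M r X0 B s t) (Q_law M r X0 B (distr M borel X0) s))"
    using rate(1) Liminf_eq[OF ev] by simp
  show "Limsup at_top (\<lambda>t. ereal t * W1 (cond_law M r X0 B s t) (Q_law M r X0 B (distr M borel X0) s)) < \<infinity>"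
    using rate(2) Limsup_eq[OF ev] by simp
qed

end

theorem theorem4p1:
  fixes r :: real
  assumes "r > 0"
  shows "\<exists>s0>0. \<forall>(M::'a measure) (B::real \<Rightarrow> 'a \<Rightarrow> real) (X0::'a \<Rightarrow> real) (mu::real measure) (s::real).
     std_BM M B \<and> X0 \<in> borel_measurable M \<and>
     prob_space.indep_set M
       (sigma_sets (space M) {X0 -` A \<inter> space M | A. A \<in> sets borel})
       (sigma_sets (space M) {B t -` A \<inter> space M | t A. 0 \<le> t \<and> A \<in> sets borel}) \<and>
     distr M borel X0 = mu \<and>
     prob_space mu \<and> sets mu = sets borel \<and> emeasure mu {0<..} = 1 \<and>
     integrable mu (\<lambda>x. x ^ 4 * exp (r * x)) \<and> s \<ge> s0 \<longrightarrow>
       0 < Liminf at_top (\<lambda>t. ereal t * W1 (cond_law M r X0 B s t) (Q_law M r X0 B mu s)) \<and>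
       Liminf at_top (\<lambda>t. ereal t * W1 (cond_law M r X0 B s t) (Q_law M r X0 B mu s))
         \<le> Limsup at_top (\<lambda>t. ereal t * W1 (cond_law M r X0 B s t) (Q_law M r X0 B mu s)) \<and>
       Limsup at_top (\<lambda>t. ereal t * W1 (cond_law M r X0 B s t) (Q_law M r X0 B mu s)) < \<infinity>"
\<comment> \<open>The choice of 1 is arbitrary: \<open>W1_cond_law_rate\<close> covers every s >
  0.\<close>
proof (intro exI[of _ 1] conjI allI impI)
  fix M :: "'a measure" and B :: "real \<Rightarrow> 'a \<Rightarrow> real" and X0 :: "'a \<Rightarrow> real" and mu :: "real measure" and s :: real
  let ?w = "\<lambda>t. ereal t * W1 (cond_law M r X0 B s t) (Q_law M r X0 B mu s)"
  assume *: "std_BM M B \<and> X0 \<in> borel_measurable M \<and>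
     prob_space.indep_set M
       (sigma_sets (space M) {X0 -` A \<inter> space M | A. A \<in> sets borel})
       (sigma_sets (space M) {B t -` A \<inter> space M | t A. 0 \<le> t \<and> A \<in> sets borel}) \<and>
     distr M borel X0 = mu \<and>
     prob_space mu \<and> sets mu = sets borel \<and> emeasure mu {0<..} = 1 \<and>
     integrable mu (\<lambda>x. x ^ 4 * exp (r * x)) \<and> s \<ge> 1"
  then have mu: "mu = distr M borel X0" and [measurable]: "X0 \<in> borel_measurable M" by auto
  interpret mu: prob_space mu using * by simp
  have "AE x in mu. x \<in> {0<..}"
    using * by (intro mu.AE_prob_1) (simp add: measure_def)
  then have AE: "AE \<omega> in M. 0 < X0 \<omega>"
    unfolding mu by (subst (asm) AE_distr_iff) auto
  have int: "integrable M (\<lambda>\<omega>. X0 \<omega> ^ 4 * exp (r * X0 \<omega>))"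
    using * unfolding mu by (subst (asm) integrable_distr_eq) auto
  have bm: "std_BM M B" and s: "s \<ge> 1"
    and indep: "prob_space.indep_set M
       (sigma_sets (space M) {X0 -` A \<inter> space M | A. A \<in> sets borel})
       (sigma_sets (space M) {B t -` A \<inter> space M | t A. 0 \<le> t \<and> A \<in> sets borel})"
    using * by blast+
  interpret M: prob_space M using bm unfolding std_BM_def by blast
  interpret started_bm M B X0 r
    by unfold_locales (fact bm indep assms AE int \<open>X0 \<in> borel_measurable M\<close>)+
  show "0 < Liminf at_top ?w" "Limsup at_top ?w < \<infinity>"
    unfolding mu by (rule W1_cond_law_rate, use s in linarith)+
  show "Liminf at_top ?w \<le> Limsup at_top ?w"
    by (rule Liminf_le_Limsup) simp
qed simp

end
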